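(* Let $(M,\omega,I)$ be a prequantizable Kähler manifold of complex dimension $n$, let $\hbar>0$, and let $(\mathcal{L},\nabla,\langle\cdot,\cdot\rangle)\to (M,i\omega/\hbar)$ be a prequantum line bundle, i.e. a Hermitian line bundle with Hermitian connection $\nabla$ of curvature $i\omega/\hbar$. Let $B$ be its Bergman kernel, a section of $\pi_1^*\mathcal{L}^*\otimes\pi_2^*\mathcal{L}\to M\times M$, whose restriction to the diagonal is identified with a positive-valued function $x\mapsto B(x,x)$ on $M$. Define $$\Omega(x,y)=\frac{B(x,y)}{\sqrt{B(x,x)}\sqrt{B(y,y)}}\,,\qquad (x,y)\in M\times M .$$ Then $\Omega$ integrates $\nabla$ (as a propagator) with respect to the Bergman measure $$d\mu_x=\frac{B(x,x)}{\hbar^n}\,\omega_x^n$$ if and only if the function $x\mapsto B(x,x)$ is constant.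
   Context: **Holomorphic sections.** A section $\Psi$ of $\mathcal{L}$ is holomorphic (Kähler-polarized) if $\nabla_Z\Psi=0$ for every $Z\in T_{\mathbb{C}}M$ in the $-i$ eigenspace of $I$. The Hermitian form is linear in the second argument. **Bergman kernel.** Let $\pi_1,\pi_2:M\times M\to M$ be the projections onto the first and second factor. Let $\{\Psi_\alpha\}_\alpha$ be an orthonormal basis of the Hilbert space of square-integrable holomorphic sections of $\mathcal{L}$, with inner product $\int_M\langle\Psi_1(x),\Psi_2(x)\rangle\,\omega_x^n/\hbar^n$. The Bergman kernel is the section of $\pi_1^*\mathcal{L}^*\otimes\pi_2^*\mathcal{L}\to M\times M$ given by $$B(x,y)=\sum_\alpha \Psi_\alpha(x)^*\otimes\Psi_\alpha(y),$$ where $\Psi_\alpha(x)^*=\langle\Psi_\alpha(x),\cdot\rangle\in\mathcal{L}_x^*$. The bundle $\pi_1^*\mathcal{L}^*\otimes\pi_2^*\mathcal{L}$ is canonically trivial over the diagonal, so $B(x,x)$ is identified with a number, namely $\sum_\alpha\langle\Psi_\alpha(x),\Psi_\alpha(x)\rangle$, which is taken to be positive for every $x\in M$. **Kernels as linear maps.** The value at $(x,y)$ of a section $\Omega$ of $\pi_1^*\mathcal{L}^*\otimes\pi_2^*\mathcal{L}$ is regarded as a linear map $\mathcal{L}_x\to\mathcal{L}_y$, written $l_x\mapsto l_x\Omega(x,y)$. Composition is written from left to right: $\Omega(x,z)\circ\Omega(z,y):\mathcal{L}_x\to\mathcal{L}_y$ means first apply $\Omega(x,z):\mathcal{L}_x\to\mathcal{L}_z$,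 then $\Omega(z,y):\mathcal{L}_z\to\mathcal{L}_y$. $\Omega(x,y)^*:\mathcal{L}_y\to\mathcal{L}_x$ denotes the adjoint with respect to $\langle\cdot,\cdot\rangle$. **Integrating a connection (propagator).** Given a measure $d\mu$ on $M$, a section $\Omega$ of $\pi_1^*\mathcal{L}^*\otimes\pi_2^*\mathcal{L}\to M\times M$ is said to integrate $\nabla$ (as a propagator) with respect to $d\mu$ if for all $(x,y)\in M\times M$: 1. $\int_M \Omega(x,z)\circ\Omega(z,y)\,d\mu_z=\Omega(x,y)$; 2. $\nabla_y\Omega(x,y)\vert_{y=x}=0$, meaning that for each $l_x\in\mathcal{L}_x$ the covariant derivative at $y=x$ of the section $y\mapsto l_x\Omega(x,y)\in\mathcal{L}_y$ of $\mathcal{L}$ vanishes; 3. $\Omega(x,x)=1$ (the identity of $\mathcal{L}_x$); 4. $\Omega(x,y)^*=\Omega(y,x)$; and the sesquilinear form $$\langle\Psi_1|\Psi_2\rangle=\int_{M\times M}\langle\Psi_1(y),\Psi_2(x)\Omega(x,y)\rangle\,d\mu_x\,d\mu_y$$ on the space of sections of $\mathcal{L}$ that are square-integrable with respect to $d\mu$ is bounded.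
   Formalization: M is assumed connected (and of complex dimension at least 1): on a disconnected M, e.g. two copies of CP^1 carrying O(1) and O(2), Ω integrates ∇ although B(x,x) takes different constant values on the components. *)

theory Defs
  imports "HOL-Analysis.Analysis"
begin

section \<open>Smooth functions on open subsets of normed spaces\<close>

fun Ck_on :: "nat \<Rightarrow> 'a::real_normed_vector set \<Rightarrow> ('a \<Rightarrow> 'b::real_normed_vector) \<Rightarrow> bool" where
  "Ck_on 0 S f \<longleftrightarrow> continuous_on S f"
| "Ck_on (Suc k) S f \<longleftrightarrow>
     (\<forall>p\<in>S. f differentiable (at p)) \<and> (\<forall>v. Ck_on k S (\<lambda>p. frechet_derivative f (at p) v))"

definition smooth_on :: "'a::real_normed_vector set \<Rightarrow> ('a \<Rightarrow> 'b::real_normed_vector) \<Rightarrow> bool" where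
  "smooth_on S f \<longleftrightarrow> (\<forall>k. Ck_on k S f)"

section \<open>Complex manifolds\<close>

text \<open>The manifold is the whole type \<open>'m\<close>; its complex dimension is \<open>CARD('n)\<close>.\<close>

type_synonym ('m, 'n) chart = "'m set \<times> ('m \<Rightarrow> complex ^ 'n)"

abbreviation chart_inv :: "('m, 'n::finite) chart \<Rightarrow> complex ^ 'n \<Rightarrow> 'm" where
  "chart_inv c \<equiv> inv_into (fst c) (snd c)"

definition holomorphic_transition ::
    "('m::topological_space, 'n::finite) chart \<Rightarrow> ('m, 'n) chart \<Rightarrow> bool" where
  "holomorphic_transition c d \<longleftrightarrow>
     (let S = snd c ` (fst c \<inter> fst d); f = snd d \<circ> chart_inv c in
       smooth_on S f \<and>
       (\<forall>p\<in>S. \<forall>z a. frechet_derivative f (at p) (z *s a) = z *s frechet_derivative f (at p) a))"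

definition complex_atlas :: "('m::topological_space, 'n::finite) chart set \<Rightarrow> bool" where
  "complex_atlas A \<longleftrightarrow>
     (\<forall>c\<in>A. open (fst c) \<and> open (snd c ` fst c) \<and>
             homeomorphism (fst c) (snd c ` fst c) (snd c) (chart_inv c)) \<and>
     (\<Union>c\<in>A. fst c) = UNIV \<and>
     (\<forall>c\<in>A. \<forall>d\<in>A. holomorphic_transition c d)"

definition smooth_fun ::
    "('m::topological_space, 'n::finite) chart set \<Rightarrow> 'm set \<Rightarrow> ('m \<Rightarrow> 'b::real_normed_vector) \<Rightarrow> bool" where
  "smooth_fun A W f \<longleftrightarrow> (\<forall>c\<in>A. smooth_on (snd c ` (fst c \<inter> W)) (f \<circ> chart_inv c))"

definition smooth_near ::
    "('m::topological_space, 'n::finite) chart set \<Rightarrow> 'm \<Rightarrow> ('m \<Rightarrow> 'b::real_normed_vector) \<Rightarrow> bool" where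
  "smooth_near A x f \<longleftrightarrow> (\<exists>W. open W \<and> x \<in> W \<and> smooth_fun A W f)"

text \<open>Real tangent vectors are derivations on germs of smooth real functions. They are set to \<open>0\<close> on
  functions that are not smooth near the base point, so that vectors given in different charts
  are equal as soon as they agree as derivations.\<close>

type_synonym 'm tangent = "('m \<Rightarrow> real) \<Rightarrow> real"

definition coord_vec ::
    "('m::topological_space, 'n::finite) chart set \<Rightarrow> ('m, 'n) chart \<Rightarrow> 'm \<Rightarrow> complex ^ 'n \<Rightarrow> 'm tangent" where
  "coord_vec A c x a =
     (\<lambda>f. if smooth_near A x f then frechet_derivative (f \<circ> chart_inv c) (at (snd c x)) a else 0)"

definition tangent_space :: "('m::topological_space, 'n::finite) chart set \<Rightarrow> 'm \<Rightarrow> 'm tangent set" where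
  "tangent_space A x = {coord_vec A c x a | c a. c \<in> A \<and> x \<in> fst c}"

definition vec_lincomb :: "real \<Rightarrow> 'm tangent \<Rightarrow> real \<Rightarrow> 'm tangent \<Rightarrow> 'm tangent" where
  "vec_lincomb r u t v = (\<lambda>f. r * u f + t * v f)"

definition deriv_complex :: "'m tangent \<Rightarrow> ('m \<Rightarrow> complex) \<Rightarrow> complex" where
  "deriv_complex v f = Complex (v (\<lambda>x. Re (f x))) (v (\<lambda>x. Im (f x)))"

section \<open>Kaehler manifolds\<close>

record ('m, 'n::finite) kaehler_data =
  charts :: "('m, 'n) chart set"
  kform :: "'m \<Rightarrow> 'm tangent \<Rightarrow> 'm tangent \<Rightarrow> real"
  cplx :: "'m \<Rightarrow> 'm tangent \<Rightarrow> 'm tangent"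

definition kform_coord ::
    "('m::topological_space, 'n::finite) kaehler_data \<Rightarrow> ('m, 'n) chart \<Rightarrow>
     complex ^ 'n \<Rightarrow> complex ^ 'n \<Rightarrow> complex ^ 'n \<Rightarrow> real" where
  "kform_coord M c p a b =
     (let x = chart_inv c p in kform M x (coord_vec (charts M) c x a) (coord_vec (charts M) c x b))"

definition smooth_two_form :: "('m::topological_space, 'n::finite) kaehler_data \<Rightarrow> bool" where
  "smooth_two_form M \<longleftrightarrow>
     (\<forall>c\<in>charts M. \<forall>p\<in>snd c ` fst c.
        bilinear (kform_coord M c p) \<and> (\<forall>a. kform_coord M c p a a = 0)) \<and>
     (\<forall>c\<in>charts M. \<forall>a b. smooth_on (snd c ` fst c) (\<lambda>p. kform_coord M c p a b))"

definition closed_two_form :: "('m::topological_space, 'n::finite) kaehler_data \<Rightarrow> bool" where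
  "closed_two_form M \<longleftrightarrow>
     (\<forall>c\<in>charts M. \<forall>p\<in>snd c ` fst c. \<forall>a1 a2 a3.
        frechet_derivative (\<lambda>q. kform_coord M c q a2 a3) (at p) a1
      - frechet_derivative (\<lambda>q. kform_coord M c q a1 a3) (at p) a2
      + frechet_derivative (\<lambda>q. kform_coord M c q a1 a2) (at p) a3 = 0)"

text \<open>The charts are holomorphic for the complex structure \<open>I\<close>, which is therefore integrable.
  Both sign conventions for the metric, \<open>g(u,v) = \<omega>(u, I v)\<close> and \<open>g(u,v) = \<omega>(I u, v)\<close>, are admitted:
  with curvature \<open>i\<omega>/\<hbar>\<close> and holomorphic sections annihilated by the \<open>-i\<close> eigenspace of \<open>I\<close>, it is
  the second one that makes the prequantum line bundle positive.\<close>

definition kaehler_manifold ::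
    "('m::{t2_space, second_countable_topology}, 'n::finite) kaehler_data \<Rightarrow> bool" where
  "kaehler_manifold M \<longleftrightarrow>
     connected (UNIV :: 'm set) \<and>
     complex_atlas (charts M) \<and>
     (\<forall>c\<in>charts M. \<forall>x\<in>fst c. \<forall>a.
        cplx M x (coord_vec (charts M) c x a) = coord_vec (charts M) c x (\<i> *s a)) \<and>
     smooth_two_form M \<and> closed_two_form M \<and>
     (\<forall>x. \<forall>u\<in>tangent_space (charts M) x. \<forall>v\<in>tangent_space (charts M) x.
        kform M x (cplx M x u) (cplx M x v) = kform M x u v) \<and>
     ((\<forall>x. \<forall>u\<in>tangent_space (charts M) x. u \<noteq> (\<lambda>_. 0) \<longrightarrow> 0 < kform M x u (cplx M x u)) \<or>
      (\<forall>x. \<forall>u\<in>tangent_space (charts M) x. u \<noteq> (\<lambda>_. 0) \<longrightarrow> 0 < kform M x (cplx M x u) u))"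

text \<open>The \<open>n\<close>-fold wedge power of a 2-form, evaluated at \<open>v 0, \<dots>, v (2 n - 1)\<close>.\<close>

definition wedge_power :: "nat \<Rightarrow> ('a \<Rightarrow> 'a \<Rightarrow> real) \<Rightarrow> (nat \<Rightarrow> 'a) \<Rightarrow> real" where
  "wedge_power n w v =
     (\<Sum>\<sigma> | \<sigma> permutes {..<2 * n}.
        of_int (sign \<sigma>) * (\<Prod>k<n. w (v (\<sigma> (2 * k))) (v (\<sigma> (2 * k + 1))))) / 2 ^ n"

text \<open>\<open>V\<close> is integration against the volume form \<open>\<omega>\<^sup>n\<close>, for the orientation in which \<open>\<omega>\<^sup>n\<close> is positive.
  This determines \<open>V\<close>; the choice of the enumeration \<open>v\<close> of the standard real basis is irrelevant
  because of the absolute value.\<close>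

definition volume_measure ::
    "('m::topological_space, 'n::finite) kaehler_data \<Rightarrow> 'm measure \<Rightarrow> bool" where
  "volume_measure M V \<longleftrightarrow>
     sets V = sets borel \<and>
     (\<forall>c\<in>charts M. \<forall>S\<in>sets borel. S \<subseteq> fst c \<longrightarrow>
       (\<forall>v. bij_betw v {..<2 * CARD('n)} (Basis :: (complex ^ 'n) set) \<longrightarrow>
         emeasure V S =
           (\<integral>\<^sup>+p. ennreal \<bar>wedge_power (CARD('n)) (kform_coord M c p) v\<bar> * indicator (snd c ` S) p
              \<partial>lborel)))"

section \<open>Prequantum line bundles\<close>

text \<open>The fibres are one-dimensional subspaces of a complex vector space without further structure;
  every line bundle is of this form, since its fibres embed in their direct sum. The smooth
  structure is given by local frames. The connection acts on local sections: \<open>conn L x v s\<close> is the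
  covariant derivative along \<open>v\<close> in the tangent space at \<open>x\<close> of a section \<open>s\<close> smooth near \<open>x\<close>.\<close>

record ('m, 'e) line_bundle =
  scl :: "complex \<Rightarrow> 'e \<Rightarrow> 'e"
  fibre :: "'m \<Rightarrow> 'e set"
  frames :: "('m set \<times> ('m \<Rightarrow> 'e)) set"
  herm :: "'m \<Rightarrow> 'e \<Rightarrow> 'e \<Rightarrow> complex"
  conn :: "'m \<Rightarrow> 'm tangent \<Rightarrow> ('m \<Rightarrow> 'e) \<Rightarrow> 'e"

definition smooth_section ::
    "('m::topological_space, 'n::finite) kaehler_data \<Rightarrow> ('m, 'e) line_bundle \<Rightarrow> 'm set \<Rightarrow> ('m \<Rightarrow> 'e) \<Rightarrow> bool" where
  "smooth_section M L W s \<longleftrightarrow>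
     (\<forall>(U, e)\<in>frames L. \<exists>g :: 'm \<Rightarrow> complex.
        smooth_fun (charts M) (U \<inter> W) g \<and> (\<forall>x\<in>U \<inter> W. s x = scl L (g x) (e x)))"

definition smooth_section_near ::
    "('m::topological_space, 'n::finite) kaehler_data \<Rightarrow> ('m, 'e) line_bundle \<Rightarrow> 'm \<Rightarrow> ('m \<Rightarrow> 'e) \<Rightarrow> bool" where
  "smooth_section_near M L x s \<longleftrightarrow> (\<exists>W. open W \<and> x \<in> W \<and> smooth_section M L W s)"

definition complex_line_bundle ::
    "('m::topological_space, 'n::finite) kaehler_data \<Rightarrow> ('m, 'e::ab_group_add) line_bundle \<Rightarrow> bool" where
  "complex_line_bundle M L \<longleftrightarrow>
     vector_space (scl L) \<and>
     (\<forall>x. module.subspace (scl L) (fibre L x) \<and> vector_space.dim (scl L) (fibre L x) = 1) \<and>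
     (\<forall>(U, e)\<in>frames L. open U \<and> (\<forall>x\<in>U. e x \<in> fibre L x \<and> e x \<noteq> 0)) \<and>
     (\<Union>(U, e)\<in>frames L. U) = UNIV \<and>
     (\<forall>(U, e)\<in>frames L. smooth_section M L U e)"

definition hermitian_metric ::
    "('m::topological_space, 'n::finite) kaehler_data \<Rightarrow> ('m, 'e::ab_group_add) line_bundle \<Rightarrow> bool" where
  "hermitian_metric M L \<longleftrightarrow>
     (\<forall>x. \<forall>l\<in>fibre L x. \<forall>l1\<in>fibre L x. \<forall>l2\<in>fibre L x. \<forall>a b.
        herm L x l (scl L a l1 + scl L b l2) = a * herm L x l l1 + b * herm L x l l2) \<and>
     (\<forall>x. \<forall>l1\<in>fibre L x. \<forall>l2\<in>fibre L x. herm L x l2 l1 = cnj (herm L x l1 l2)) \<and>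
     (\<forall>x. \<forall>l\<in>fibre L x. l \<noteq> 0 \<longrightarrow> 0 < Re (herm L x l l)) \<and>
     (\<forall>(U, e)\<in>frames L. smooth_fun (charts M) U (\<lambda>x. herm L x (e x) (e x)))"

definition connection ::
    "('m::topological_space, 'n::finite) kaehler_data \<Rightarrow> ('m, 'e::ab_group_add) line_bundle \<Rightarrow> bool" where
  "connection M L \<longleftrightarrow>
     (\<forall>x s. smooth_section_near M L x s \<longrightarrow>
        (\<forall>v\<in>tangent_space (charts M) x. conn L x v s \<in> fibre L x) \<and>
        (\<forall>u\<in>tangent_space (charts M) x. \<forall>v\<in>tangent_space (charts M) x. \<forall>r t.
           conn L x (vec_lincomb r u t v) s =
             scl L (of_real r) (conn L x u s) + scl L (of_real t) (conn L x v s))) \<and>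
     (\<forall>x s1 s2. smooth_section_near M L x s1 \<longrightarrow> smooth_section_near M L x s2 \<longrightarrow>
        (\<forall>v\<in>tangent_space (charts M) x.
           conn L x v (\<lambda>y. s1 y + s2 y) = conn L x v s1 + conn L x v s2)) \<and>
     (\<forall>x s (f :: 'm \<Rightarrow> complex). smooth_section_near M L x s \<longrightarrow> smooth_near (charts M) x f \<longrightarrow>
        (\<forall>v\<in>tangent_space (charts M) x.
           conn L x v (\<lambda>y. scl L (f y) (s y)) =
             scl L (deriv_complex v f) (s x) + scl L (f x) (conn L x v s))) \<and>
     (\<forall>W s. open W \<longrightarrow> smooth_section M L W s \<longrightarrow>
        (\<forall>c\<in>charts M. \<forall>a.
           smooth_section M L (fst c \<inter> W) (\<lambda>x. conn L x (coord_vec (charts M) c x a) s)))"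

definition hermitian_connection ::
    "('m::topological_space, 'n::finite) kaehler_data \<Rightarrow> ('m, 'e::ab_group_add) line_bundle \<Rightarrow> bool" where
  "hermitian_connection M L \<longleftrightarrow>
     connection M L \<and>
     (\<forall>x s1 s2. smooth_section_near M L x s1 \<longrightarrow> smooth_section_near M L x s2 \<longrightarrow>
        (\<forall>v\<in>tangent_space (charts M) x.
           deriv_complex v (\<lambda>y. herm L y (s1 y) (s2 y)) =
             herm L x (conn L x v s1) (s2 x) + herm L x (s1 x) (conn L x v s2)))"

text \<open>Constant coordinate vector fields commute, so the curvature has no Lie bracket term.\<close>

definition has_curvature ::
    "('m::topological_space, 'n::finite) kaehler_data \<Rightarrow> ('m, 'e::ab_group_add) line_bundle \<Rightarrow>
     ('m \<Rightarrow> 'm tangent \<Rightarrow> 'm tangent \<Rightarrow> complex) \<Rightarrow> bool" where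
  "has_curvature M L F \<longleftrightarrow>
     (\<forall>x s. smooth_section_near M L x s \<longrightarrow>
        (\<forall>c\<in>charts M. x \<in> fst c \<longrightarrow> (\<forall>a b.
           (let X = (\<lambda>y. coord_vec (charts M) c y a); Y = (\<lambda>y. coord_vec (charts M) c y b) in
             conn L x (X x) (\<lambda>y. conn L y (Y y) s) - conn L x (Y x) (\<lambda>y. conn L y (X y) s)
               = scl L (F x (X x) (Y x)) (s x)))))"

definition prequantum_line_bundle ::
    "('m::{t2_space, second_countable_topology}, 'n::finite) kaehler_data \<Rightarrow>
     ('m, 'e::ab_group_add) line_bundle \<Rightarrow> real \<Rightarrow> bool" where
  "prequantum_line_bundle M L hbar \<longleftrightarrow>
     complex_line_bundle M L \<and> hermitian_metric M L \<and> hermitian_connection M L \<and>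
     has_curvature M L (\<lambda>x u v. \<i> * of_real (kform M x u v) / of_real hbar)"

section \<open>The Bergman kernel\<close>

text \<open>The pair \<open>(v, w)\<close> stands for the complexified tangent vector \<open>Z = v + i w\<close>;
  \<open>I Z = -i Z\<close> means \<open>I v = w\<close> and \<open>I w = -v\<close>.\<close>

definition minus_i_eigenspace ::
    "('m::topological_space, 'n::finite) kaehler_data \<Rightarrow> 'm \<Rightarrow> ('m tangent \<times> 'm tangent) set" where
  "minus_i_eigenspace M x =
     {(v, w). v \<in> tangent_space (charts M) x \<and> w \<in> tangent_space (charts M) x \<and>
              cplx M x v = w \<and> cplx M x w = (\<lambda>f. - v f)}"

definition holomorphic_section ::
    "('m::topological_space, 'n::finite) kaehler_data \<Rightarrow> ('m, 'e::ab_group_add) line_bundle \<Rightarrow> ('m \<Rightarrow> 'e) \<Rightarrow> bool" where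
  "holomorphic_section M L \<Psi> \<longleftrightarrow>
     smooth_section M L UNIV \<Psi> \<and>
     (\<forall>x. \<forall>(v, w)\<in>minus_i_eigenspace M x. conn L x v \<Psi> + scl L \<i> (conn L x w \<Psi>) = 0)"

definition measurable_section :: "('m::topological_space, 'e) line_bundle \<Rightarrow> ('m \<Rightarrow> 'e) \<Rightarrow> bool" where
  "measurable_section L \<Psi> \<longleftrightarrow>
     (\<forall>x. \<Psi> x \<in> fibre L x) \<and>
     (\<forall>(U, e)\<in>frames L. (\<lambda>x. herm L x (e x) (\<Psi> x)) \<in> borel_measurable (restrict_space borel U))"

definition norm_sq :: "('m, 'e) line_bundle \<Rightarrow> ('m \<Rightarrow> 'e) \<Rightarrow> 'm \<Rightarrow> real" where
  "norm_sq L \<Psi> x = Re (herm L x (\<Psi> x) (\<Psi> x))"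

definition square_integrable :: "('m::topological_space, 'e) line_bundle \<Rightarrow> 'm measure \<Rightarrow> ('m \<Rightarrow> 'e) \<Rightarrow> bool" where
  "square_integrable L N \<Psi> \<longleftrightarrow> measurable_section L \<Psi> \<and> integrable N (norm_sq L \<Psi>)"

definition l2_norm :: "('m, 'e) line_bundle \<Rightarrow> 'm measure \<Rightarrow> ('m \<Rightarrow> 'e) \<Rightarrow> real" where
  "l2_norm L N \<Psi> = sqrt (integral\<^sup>L N (norm_sq L \<Psi>))"

definition holomorphic_L2 ::
    "('m::topological_space, 'n::finite) kaehler_data \<Rightarrow> ('m, 'e::ab_group_add) line_bundle \<Rightarrow> 'm measure \<Rightarrow> ('m \<Rightarrow> 'e) set" where
  "holomorphic_L2 M L N = {\<Psi>. holomorphic_section M L \<Psi> \<and> square_integrable L N \<Psi>}"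

definition orthonormal_basis ::
    "('m::topological_space, 'n::finite) kaehler_data \<Rightarrow> ('m, 'e::ab_group_add) line_bundle \<Rightarrow> 'm measure \<Rightarrow>
     'i set \<Rightarrow> ('i \<Rightarrow> 'm \<Rightarrow> 'e) \<Rightarrow> bool" where
  "orthonormal_basis M L N J \<Psi> \<longleftrightarrow>
     (\<forall>\<alpha>\<in>J. \<Psi> \<alpha> \<in> holomorphic_L2 M L N) \<and>
     (\<forall>\<alpha>\<in>J. \<forall>\<beta>\<in>J. (LINT x|N. herm L x (\<Psi> \<alpha> x) (\<Psi> \<beta> x)) = (if \<alpha> = \<beta> then 1 else 0)) \<and>
     (\<forall>\<Phi>\<in>holomorphic_L2 M L N. \<forall>\<epsilon>>0. \<exists>F z. finite F \<and> F \<subseteq> J \<and>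
        l2_norm L N (\<lambda>x. \<Phi> x - (\<Sum>\<alpha>\<in>F. scl L (z \<alpha>) (\<Psi> \<alpha> x))) < \<epsilon>)"

text \<open>A section of \<open>\<pi>\<^sub>1\<^sup>* L\<^sup>* \<otimes> \<pi>\<^sub>2\<^sup>* L\<close> is a family of linear maps from the fibre over \<open>x\<close> to the
  fibre over \<open>y\<close>.\<close>

type_synonym ('m, 'e) kernel = "'m \<Rightarrow> 'm \<Rightarrow> 'e \<Rightarrow> 'e"

definition kernel_section :: "('m, 'e::ab_group_add) line_bundle \<Rightarrow> ('m, 'e) kernel \<Rightarrow> bool" where
  "kernel_section L K \<longleftrightarrow>
     (\<forall>x y. \<forall>l1\<in>fibre L x. \<forall>l2\<in>fibre L x. \<forall>a b.
        K x y l1 \<in> fibre L y \<and>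
        K x y (scl L a l1 + scl L b l2) = scl L a (K x y l1) + scl L b (K x y l2))"

text \<open>The series \<open>\<Sum>\<^sub>\<alpha> \<langle>\<Psi>\<^sub>\<alpha>(x), l\<rangle> \<Psi>\<^sub>\<alpha>(y)\<close> in the finite-dimensional fibre over \<open>y\<close>; convergence there is
  convergence after pairing with every element of the fibre.\<close>

definition bergman_kernel ::
    "('m, 'e) line_bundle \<Rightarrow> 'i set \<Rightarrow> ('i \<Rightarrow> 'm \<Rightarrow> 'e) \<Rightarrow> ('m, 'e) kernel" where
  "bergman_kernel L J \<Psi> x y l =
     (THE k. k \<in> fibre L y \<and>
        (\<forall>m\<in>fibre L y.
           ((\<lambda>\<alpha>. herm L x (\<Psi> \<alpha> x) l * herm L y m (\<Psi> \<alpha> y)) has_sum herm L y m k) J))"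

definition bergman_diag :: "('m, 'e) line_bundle \<Rightarrow> 'i set \<Rightarrow> ('i \<Rightarrow> 'm \<Rightarrow> 'e) \<Rightarrow> 'm \<Rightarrow> real" where
  "bergman_diag L J \<Psi> x = (\<Sum>\<^sub>\<infinity>\<alpha>\<in>J. norm_sq L (\<Psi> \<alpha>) x)"

definition normalized_kernel ::
    "('m, 'e) line_bundle \<Rightarrow> 'i set \<Rightarrow> ('i \<Rightarrow> 'm \<Rightarrow> 'e) \<Rightarrow> ('m, 'e) kernel" where
  "normalized_kernel L J \<Psi> x y l =
     scl L (of_real (1 / (sqrt (bergman_diag L J \<Psi> x) * sqrt (bergman_diag L J \<Psi> y))))
       (bergman_kernel L J \<Psi> x y l)"

section \<open>Propagators\<close>

text \<open>The double integral defining the sesquilinear form is an iterated one: absolute convergence on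
  the product space can fail for square-integrable sections. The integral of a family of linear maps from
  the fibre over \<open>x\<close> to the fibre over \<open>y\<close> is taken in matrix elements.\<close>

definition bounded_kernel_form ::
    "('m::topological_space, 'e) line_bundle \<Rightarrow> 'm measure \<Rightarrow> ('m, 'e) kernel \<Rightarrow> bool" where
  "bounded_kernel_form L \<mu> K \<longleftrightarrow>
     (\<exists>C. \<forall>\<Psi>1 \<Psi>2. square_integrable L \<mu> \<Psi>1 \<longrightarrow> square_integrable L \<mu> \<Psi>2 \<longrightarrow>
        (AE y in \<mu>. integrable \<mu> (\<lambda>x. herm L y (\<Psi>1 y) (K x y (\<Psi>2 x)))) \<and>
        integrable \<mu> (\<lambda>y. LINT x|\<mu>. herm L y (\<Psi>1 y) (K x y (\<Psi>2 x))) \<and>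
        cmod (LINT y|\<mu>. LINT x|\<mu>. herm L y (\<Psi>1 y) (K x y (\<Psi>2 x)))
          \<le> C * l2_norm L \<mu> \<Psi>1 * l2_norm L \<mu> \<Psi>2)"

definition integrates_connection ::
    "('m::topological_space, 'n::finite) kaehler_data \<Rightarrow> ('m, 'e::ab_group_add) line_bundle \<Rightarrow> 'm measure \<Rightarrow>
     ('m, 'e) kernel \<Rightarrow> bool" where
  "integrates_connection M L \<mu> K \<longleftrightarrow>
     kernel_section L K \<and>
     (\<forall>x y. \<forall>l\<in>fibre L x. \<forall>m\<in>fibre L y.
        has_bochner_integral \<mu> (\<lambda>z. herm L y m (K z y (K x z l))) (herm L y m (K x y l))) \<and>
     (\<forall>x. \<forall>l\<in>fibre L x. smooth_section_near M L x (\<lambda>y. K x y l) \<and>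
        (\<forall>v\<in>tangent_space (charts M) x. conn L x v (\<lambda>y. K x y l) = 0)) \<and>
     (\<forall>x. \<forall>l\<in>fibre L x. K x x l = l) \<and>
     (\<forall>x y. \<forall>l\<in>fibre L x. \<forall>m\<in>fibre L y. herm L y m (K x y l) = herm L x (K y x m) l) \<and>
     bounded_kernel_form L \<mu> K"

end

theory Submission
  imports Defs "HOL-Complex_Analysis.Cauchy_Integral_Formula"
begin

text \<open>Write \<open>b(x) = B(x, x)\<close>. By the Cauchy--Schwarz inequality \<open>|\<Omega>(x, y)| \<le> 1\<close>, with equality for \<open>y = x\<close>. When \<open>b\<close> is
  constant, \<open>s(y) = l \<Omega>(x, y)\<close> is holomorphic and \<open>|s|\<^sup>2\<close> is maximal at \<open>x\<close>, hence \<open>\<langle>s, \<nabla>s\<rangle> = 0\<close> and \<open>\<nabla>s = 0\<close> there.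
  Conversely, if \<open>s\<close> is smooth and parallel at \<open>x\<close>, the \<open>(0,1)\<close> part of \<open>\<nabla>(\<surd>b s)\<close> at \<open>x\<close> is \<open>s\<close> times that of \<open>d\<surd>b\<close>.
  It vanishes because \<open>\<surd>b s\<close> is a multiple of the holomorphic section \<open>y \<mapsto> l B(x, y)\<close>, so \<open>d\<surd>b = 0\<close>, as \<open>\<surd>b\<close> is real.

  The series \<open>l B(x, \<cdot>)\<close> is a holomorphic section because it converges locally uniformly, for which it suffices
  that \<open>b\<close> is locally bounded. This needs no estimate for the volume form: \<open>b\<close> is constant in one
  direction, and in the other its continuity follows from that of \<open>\<Omega>\<close> along the diagonal.\<close>

text \<open>Differentiation and integration call for different trivialisations. A unit section
  \<open>u\<close>, glued measurably from countably many frames, turns sections into scalar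
  functions. Continuity is lost, but the Hilbert space part becomes a statement about an orthonormal
  family of functions: integration against \<open>rkernel\<close> is an orthogonal projection, so it
  reproduces the kernel and has norm at most 1. Derivatives are taken relative to a basis section
  without zeros near the point, where holomorphic sections become holomorphic functions in the
  charts.

  The obstacle is regularity. The connection says nothing about a section that is not smooth, and
  smoothness means derivatives of every order; limits of holomorphic functions have to be shown to
  be smooth through Cauchy's estimates on complex lines. In the converse direction the diagonal is
  at first a bare infinite sum. Once it is continuous, its square root turns out to be smooth as a
  quotient of two smooth sections, and only then may it be differentiated.\<close>

section \<open>Calculus of functions of class C^k on open sets\<close>

lemma Ck_on_subset: "Ck_on k S f \<Longrightarrow> T \<subseteq> S \<Longrightarrow> Ck_on k T f"
  by (induction k arbitrary: f) (auto intro: continuous_on_subset)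

text \<open>\<open>frechet_derivative\<close> is taken in the whole space and depends only on the
  germ at the point, so agreement on an open set is enough, whatever the functions do
  elsewhere.\<close>

lemma Ck_on_cong:
  assumes "open S" "\<And>p. p \<in> S \<Longrightarrow> f p = g p" "Ck_on k S f"
  shows "Ck_on k S g"
  using assms(2,3)
proof (induction k arbitrary: f g)
  case 0
  then show ?case by (simp cong: continuous_on_cong)
next
  case (Suc k)
  have d: "f differentiable (at p)" if "p \<in> S" for p
    using Suc.prems that by auto
  have "frechet_derivative f (at p) = frechet_derivative g (at p)" if "p \<in> S" for p
    by (rule frechet_derivative_transform_within_open[OF d[OF that] assms(1) that]) (use Suc.prems in auto)
  moreover have "Ck_on k S (\<lambda>p. frechet_derivative f (at p) v)" for v
    using Suc.prems(2) by simp
  ultimately have "Ck_on k S (\<lambda>p. frechet_derivative g (at p) v)" for v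
    using Suc.IH[of "\<lambda>p. frechet_derivative f (at p) v" "\<lambda>p. frechet_derivative g (at p) v"] by simp
  moreover have "g differentiable (at p)" if "p \<in> S" for p
    using d[OF that] Suc.prems(1) that assms(1)
    by (meson differentiable_def has_derivative_transform_within_open)
  ultimately show ?case by simp
qed

lemma Ck_on_SucD: "Ck_on (Suc k) S f \<Longrightarrow> Ck_on k S f"
proof (induction k arbitrary: f)
  case 0
  then show ?case
    by (auto intro!: continuous_at_imp_continuous_on differentiable_imp_continuous_within)
qed auto

lemma Ck_on_const: "Ck_on k S (\<lambda>p. c)"
  by (induction k arbitrary: c) (simp_all add: frechet_derivative_const)

text \<open>\<open>frechet_derivative\<close> is a choice; uniqueness of derivatives lets an
  explicit formula \<open>D\<close>, valid on \<open>S\<close> only, take its place in inductions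
  over the order.\<close>

lemma Ck_on_SucI:
  assumes "open S" "\<And>p. p \<in> S \<Longrightarrow> (f has_derivative D p) (at p)"
    and "\<And>v. Ck_on k S (\<lambda>p. D p v)"
  shows "Ck_on (Suc k) S f"
proof -
  have "Ck_on k S (\<lambda>p. frechet_derivative f (at p) v)" for v
    by (rule Ck_on_cong[OF assms(1) _ assms(3)]) (simp add: frechet_derivative_at[OF assms(2), symmetric])
  then show ?thesis
    using assms(2) by (auto simp: differentiable_def)
qed

lemma Ck_on_Suc_has_derivative:
  "Ck_on (Suc k) S f \<Longrightarrow> p \<in> S \<Longrightarrow> (f has_derivative frechet_derivative f (at p)) (at p)"
  by (simp add: frechet_derivative_works)

lemma Ck_on_add:
  assumes "open S"
  shows "Ck_on k S f \<Longrightarrow> Ck_on k S g \<Longrightarrow> Ck_on k S (\<lambda>p. f p + g p)"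
proof (induction k arbitrary: f g)
  case (Suc k)
  show ?case
    by (rule Ck_on_SucI[OF assms, where D = "\<lambda>p v. frechet_derivative f (at p) v + frechet_derivative g (at p) v"])
      (use Suc in \<open>auto intro!: has_derivative_add simp: frechet_derivative_works\<close>)
qed (auto intro: continuous_intros)

lemma Ck_on_bounded_linear:
  assumes "open S" "bounded_linear h"
  shows "Ck_on k S f \<Longrightarrow> Ck_on k S (\<lambda>p. h (f p))"
proof (induction k arbitrary: f)
  case 0
  then show ?case using bounded_linear.continuous_on[OF assms(2)] by simp
next
  case (Suc k)
  show ?case
    by (rule Ck_on_SucI[OF assms(1), where D = "\<lambda>p v. h (frechet_derivative f (at p) v)"])
      (use Suc in \<open>auto intro!: bounded_linear.has_derivative[OF assms(2)] simp: frechet_derivative_works\<close>)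
qed

lemma Ck_on_mult:
  fixes f g :: "'a::real_normed_vector \<Rightarrow> 'b::real_normed_algebra"
  assumes "open S"
  shows "Ck_on k S f \<Longrightarrow> Ck_on k S g \<Longrightarrow> Ck_on k S (\<lambda>p. f p * g p)"
proof (induction k arbitrary: f g)
  case (Suc k)
  show ?case
    by (rule Ck_on_SucI[OF assms, where
          D = "\<lambda>p v. f p * frechet_derivative g (at p) v + frechet_derivative f (at p) v * g p"])
      (use Suc Ck_on_SucD[OF Suc.prems(1)] Ck_on_SucD[OF Suc.prems(2)] in
        \<open>auto intro!: has_derivative_mult Ck_on_add[OF assms] simp: frechet_derivative_works\<close>)
qed (auto intro: continuous_intros)

text \<open>The derivative of \<open>1 / f\<close> is \<open>- (1 / f) f' (1 / f)\<close>. It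
  contains \<open>1 / f\<close> itself only at order \<open>k\<close>, where the induction
  hypothesis applies.\<close>

lemma Ck_on_inverse:
  fixes f :: "'a::real_normed_vector \<Rightarrow> 'b::real_normed_field"
  assumes "open S" "\<And>p. p \<in> S \<Longrightarrow> f p \<noteq> 0"
  shows "Ck_on k S f \<Longrightarrow> Ck_on k S (\<lambda>p. inverse (f p))"
proof (induction k)
  case (Suc k)
  let ?D = "\<lambda>p v. (- 1) * (inverse (f p) * frechet_derivative f (at p) v * inverse (f p))"
  have "Ck_on k S (\<lambda>p. inverse (f p))"
    using Suc.IH Ck_on_SucD[OF Suc.prems] by blast
  then have "Ck_on k S (\<lambda>p. ?D p v)" for v
    using Suc.prems by (intro Ck_on_mult[OF assms(1)] Ck_on_const) auto
  moreover have "((\<lambda>p. inverse (f p)) has_derivative ?D p) (at p)" if "p \<in> S" for p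
    using Deriv.has_derivative_inverse[OF assms(2) Ck_on_Suc_has_derivative[OF Suc.prems]] that
    by simp
  ultimately show ?case
    by (intro Ck_on_SucI[OF assms(1), where D = ?D])
qed (auto intro!: continuous_intros simp: assms(2))

lemma smooth_on_imp_differentiable: "smooth_on S f \<Longrightarrow> p \<in> S \<Longrightarrow> f differentiable (at p)"
  unfolding smooth_on_def by (metis Ck_on.simps(2))

section \<open>Holomorphic functions of several variables\<close>

text \<open>The Cauchy-Riemann equations as complex linearity of the real derivative. Nothing is
  asked of the way in which \<open>D\<close> varies with the point; its regularity comes from
  Cauchy's estimates.\<close>

definition hol_on :: "(complex ^ 'n) set \<Rightarrow> (complex ^ 'n \<Rightarrow> complex) \<Rightarrow> bool" where
  "hol_on S f \<longleftrightarrow> (\<forall>p\<in>S. \<exists>D. (f has_derivative D) (at p) \<and> (\<forall>z a. D (z *s a) = z * D a))"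

lemma hol_on_frechet:
  assumes "hol_on S f" "p \<in> S"
  shows "(f has_derivative frechet_derivative f (at p)) (at p)"
    and "frechet_derivative f (at p) (z *s a) = z * frechet_derivative f (at p) a"
proof -
  obtain D where D: "(f has_derivative D) (at p)" "\<And>z a. D (z *s a) = z * D a"
    using assms unfolding hol_on_def by blast
  from frechet_derivative_at[OF D(1)] D
  show "(f has_derivative frechet_derivative f (at p)) (at p)"
    "frechet_derivative f (at p) (z *s a) = z * frechet_derivative f (at p) a" by simp_all
qed

text \<open>A real derivative is already real linear, so commuting with \<open>\<i>\<close> is all
  that has to be checked.\<close>

lemma hol_onI:
  fixes f :: "complex ^ 'n \<Rightarrow> complex"
  assumes d: "\<And>p. p \<in> S \<Longrightarrow> (f has_derivative D p) (at p)"
    and i: "\<And>p a. p \<in> S \<Longrightarrow> D p (\<i> *s a) = \<i> * D p a"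
  shows "hol_on S f"
  unfolding hol_on_def
proof (intro ballI exI conjI allI)
  fix p and z :: complex and a :: "complex ^ 'n" assume p: "p \<in> S"
  have "z *s a = Re z *\<^sub>R a + Im z *\<^sub>R (\<i> *s a)"
    by (simp add: vec_eq_iff complex_eq_iff)
  then show "D p (z *s a) = z * D p a"
    using has_derivative_linear[OF d[OF p]] i[OF p, of a]
    by (simp add: linear_add linear_scale complex_eq_iff)
qed (rule d)

lemma norm_vector_smult: "norm (z *s a) = cmod z * norm (a :: complex ^ 'n::finite)"
  by (simp add: norm_vec_def norm_mult L2_set_right_distrib)

lemma bounded_linear_smult_left: "bounded_linear (\<lambda>z. z *s (a :: complex ^ 'n::finite))"
  by (rule bounded_linear_intro[where K = "norm a"])
    (simp_all add: norm_vector_smult vec_eq_iff algebra_simps)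

text \<open>Restriction to a complex line gives a function of one complex variable, to which
  Cauchy's theory applies.\<close>

lemma hol_on_line:
  fixes f :: "complex ^ 'n::finite \<Rightarrow> complex"
  assumes "hol_on S f" "p + z *s v \<in> S"
  shows "((\<lambda>z. f (p + z *s v)) has_field_derivative frechet_derivative f (at (p + z *s v)) v) (at z)"
proof -
  have "((\<lambda>z. p + z *s v) has_derivative (\<lambda>h. 0 + h *s v)) (at z)"
    by (intro has_derivative_add has_derivative_const bounded_linear.has_derivative[OF bounded_linear_smult_left] has_derivative_ident)
  from has_derivative_compose[OF this hol_on_frechet(1)[OF assms]]
  show ?thesis
    by (simp add: has_field_derivative_def hol_on_frechet(2)[OF assms] mult.commute[of _ "frechet_derivative f (at (p + z *s v)) v"])
qed

lemma hol_on_imp_continuous_on: "hol_on S f \<Longrightarrow> continuous_on S f"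
  unfolding hol_on_def
  by (blast intro: continuous_at_imp_continuous_on has_derivative_continuous)

lemma hol_on_diff: "hol_on S f \<Longrightarrow> hol_on S g \<Longrightarrow> hol_on S (\<lambda>p. f p - g p)"
  by (rule hol_onI[where D = "\<lambda>p v. frechet_derivative f (at p) v - frechet_derivative g (at p) v"])
    (simp_all add: has_derivative_diff hol_on_frechet right_diff_distrib)

lemma hol_on_cmult: "hol_on S f \<Longrightarrow> hol_on S (\<lambda>p. c * f p)"
  by (rule hol_onI[where D = "\<lambda>p v. c * frechet_derivative f (at p) v"])
    (simp_all add: has_derivative_mult_right hol_on_frechet)

lemma hol_on_sum:
  assumes "\<And>i. i \<in> F \<Longrightarrow> hol_on S (f i)"
  shows "hol_on S (\<lambda>p. \<Sum>i\<in>F. f i p)"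
  by (rule hol_onI[where D = "\<lambda>p v. \<Sum>i\<in>F. frechet_derivative (f i) (at p) v"])
    (simp_all add: has_derivative_sum hol_on_frechet[OF assms] sum_distrib_left)

lemma hol_on_subset: "hol_on S f \<Longrightarrow> T \<subseteq> S \<Longrightarrow> hol_on T f"
  unfolding hol_on_def by blast

section \<open>Cauchy estimates and uniform limits of holomorphic functions\<close>

lemma holomorphic_on_ballI:
  fixes f D :: "complex \<Rightarrow> complex"
  assumes "\<And>z. cmod z < R \<Longrightarrow> (f has_field_derivative D z) (at z)"
  shows "f holomorphic_on ball 0 R"
  unfolding holomorphic_on_open[OF open_ball]
proof
  fix z :: complex assume "z \<in> ball 0 R"
  then have "cmod z < R" by simp
  from assms[OF this] show "\<exists>f'. (f has_field_derivative f') (at z)" ..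
qed

text \<open>Cauchy's inequality on the line through \<open>p\<close> in direction \<open>v\<close>:
  the parameter disc of radius \<open>r / norm v\<close> is mapped into \<open>cball p r\<close>.
  The vector 0 is separate because it spans no line.\<close>

lemma norm_frechet_derivative_le:
  fixes f :: "complex ^ 'n::finite \<Rightarrow> complex"
  assumes "hol_on (ball q s) f" "cball p r \<subseteq> ball q s" "0 < r"
    and B: "\<And>x. x \<in> cball p r \<Longrightarrow> cmod (f x) \<le> B"
  shows "cmod (frechet_derivative f (at p) v) \<le> B / r * norm v"
proof (cases "v = 0")
  case True
  have "p \<in> ball q s" using assms(2,3) by (meson centre_in_cball less_imp_le subsetD)
  then show ?thesis
    using has_derivative_linear[OF hol_on_frechet(1)[OF assms(1)]] True by (simp add: linear_0)
next
  case False
  let ?\<phi> = "\<lambda>z. f (p + z *s v)"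
  have in_cball: "p + z *s v \<in> cball p r" if "cmod z \<le> r / norm v" for z
    using that False by (simp add: dist_norm norm_vector_smult field_simps)
  have der: "(?\<phi> has_field_derivative frechet_derivative f (at (p + z *s v)) v) (at z)"
    if "cmod z \<le> r / norm v" for z
    using in_cball[OF that] assms(2) by (intro hol_on_line[OF assms(1)]) auto
  have "cmod ((deriv ^^ 1) ?\<phi> 0) \<le> fact 1 * B / (r / norm v) ^ 1"
  proof (rule Cauchy_inequality)
    show "?\<phi> holomorphic_on ball 0 (r / norm v)"
      by (rule holomorphic_on_ballI, rule der) simp
    show "continuous_on (cball 0 (r / norm v)) ?\<phi>"
      using der by (auto intro!: continuous_at_imp_continuous_on DERIV_isCont)
    show "cmod (f (p + x *s v)) \<le> B" if "cmod (0 - x) = r / norm v" for x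
      using that by (intro B in_cball) auto
  qed (use assms(3) False in auto)
  moreover have "deriv ?\<phi> 0 = frechet_derivative f (at p) v"
    using DERIV_imp_deriv[OF der[of 0]] assms(3) by simp
  ultimately show ?thesis by (simp add: field_simps)
qed

text \<open>Weierstrass's theorem. Cauchy's inequality for the differences \<open>F m - F n\<close>
  turns uniform convergence of the functions into uniform convergence of the derivatives on a
  smaller ball, so limit and derivative may be exchanged.\<close>

lemma hol_on_uniform_limit:
  fixes f :: "complex ^ 'n::finite \<Rightarrow> complex"
  assumes "\<And>p. p \<in> S \<Longrightarrow> \<exists>r>0. \<exists>F. (\<forall>n. hol_on (ball p r) (F n)) \<and> uniform_limit (ball p r) F f sequentially"
  shows "hol_on S f"
  unfolding hol_on_def
proof
  fix p assume "p \<in> S"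
  then obtain r F where r: "r > 0" and hF: "\<And>n. hol_on (ball p r) (F n)"
    and lim: "uniform_limit (ball p r) F f sequentially"
    using assms by metis
  \<comment> \<open>Radius \<open>r / 2\<close> for the points and \<open>r / 3\<close> for the
    Cauchy discs around them: the sum stays below \<open>r\<close>.\<close>
  define T where "T = ball p (r / 2)"
  have sub: "cball x (r / 3) \<subseteq> ball p r" if "x \<in> T" for x
  proof
    fix y assume "y \<in> cball x (r / 3)"
    then show "y \<in> ball p r"
      using that r dist_triangle[of p y x] unfolding T_def by auto
  qed
  have T: "T \<subseteq> ball p r" unfolding T_def using r by auto
  let ?D = "\<lambda>n x. frechet_derivative (F n) (at x)"
  have est: "cmod (?D m x h - ?D n x h) \<le> e / (r / 3) * norm h"
    if x: "x \<in> T" and e: "\<And>y. y \<in> ball p r \<Longrightarrow> cmod (F m y - F n y) \<le> e" for m n x h e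
  proof -
    have "x \<in> ball p r" using x T by auto
    then have "((\<lambda>y. F m y - F n y) has_derivative (\<lambda>h. ?D m x h - ?D n x h)) (at x)"
      by (intro has_derivative_diff hol_on_frechet(1)[OF hF])
    moreover have "cmod (frechet_derivative (\<lambda>y. F m y - F n y) (at x) h) \<le> e / (r / 3) * norm h"
    proof (rule norm_frechet_derivative_le[OF hol_on_diff[OF hF hF] sub[OF x]])
      show "cmod (F m y - F n y) \<le> e" if "y \<in> cball x (r / 3)" for y
        using sub[OF x] that by (intro e) blast
    qed (use r in simp)
    ultimately show ?thesis by (simp add: frechet_derivative_at[symmetric])
  qed
  have cau: "\<exists>N. \<forall>m\<ge>N. \<forall>n\<ge>N. \<forall>x\<in>T. \<forall>h. cmod (?D m x h - ?D n x h) \<le> e * norm h" if e: "e > 0" for e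
  proof -
    have "uniformly_Cauchy_on (ball p r) F"
      using lim uniformly_convergent_Cauchy uniformly_convergent_on_def by blast
    then obtain N where N: "\<And>m n y. m \<ge> N \<Longrightarrow> n \<ge> N \<Longrightarrow> y \<in> ball p r \<Longrightarrow> dist (F m y) (F n y) < e * (r / 3)"
      unfolding uniformly_Cauchy_on_def using r e
      by (metis divide_pos_pos mult_pos_pos zero_less_numeral)
    have "cmod (?D m x h - ?D n x h) \<le> e * (r / 3) / (r / 3) * norm h"
      if "m \<ge> N" "n \<ge> N" "x \<in> T" for m n x h
      by (intro est that) (use N[OF that(1,2)] in \<open>auto simp: dist_norm less_imp_le\<close>)
    then have "cmod (?D m x h - ?D n x h) \<le> e * norm h"
      if "m \<ge> N" "n \<ge> N" "x \<in> T" for m n x h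
      using that r by simp
    then show ?thesis by blast
  qed
  define G where "G x h = lim (\<lambda>n. ?D n x h)" for x h
  have G: "(\<lambda>n. ?D n x h) \<longlonglongrightarrow> G x h" if "x \<in> T" for x h
  proof -
    have "Cauchy (\<lambda>n. ?D n x h)"
    proof (rule metric_CauchyI)
      fix e :: real assume "e > 0"
      then have e: "e / (norm h + 1) > 0" by (simp add: add_nonneg_pos)
      have "e / (norm h + 1) * norm h < e"
        using \<open>e > 0\<close> by (simp add: pos_divide_less_eq add_nonneg_pos distrib_left)
      then show "\<exists>N. \<forall>m\<ge>N. \<forall>n\<ge>N. dist (?D m x h) (?D n x h) < e"
        using cau[OF e] that unfolding dist_norm by (meson le_less_trans)
    qed
    then show ?thesis unfolding G_def using Cauchy_convergent convergent_LIMSEQ_iff by blast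
  qed
  have p: "p \<in> T" unfolding T_def using r by auto
  have "\<exists>g. \<forall>x\<in>T. (\<lambda>n. F n x) \<longlonglongrightarrow> g x \<and> (g has_derivative G x) (at x within T)"
  proof (rule has_derivative_sequence[where f' = ?D])
    show "convex T" unfolding T_def by simp
    show "(F n has_derivative ?D n x) (at x within T)" if "x \<in> T" for n x
      using hol_on_frechet(1)[OF hF] that T by (blast intro: has_derivative_at_withinI)
    show "\<forall>\<^sub>F n in sequentially. \<forall>x\<in>T. \<forall>h. cmod (?D n x h - G x h) \<le> e * norm h" if e: "e > 0" for e
    proof -
      obtain N where N: "\<And>m n x h. m \<ge> N \<Longrightarrow> n \<ge> N \<Longrightarrow> x \<in> T \<Longrightarrow> cmod (?D m x h - ?D n x h) \<le> e * norm h"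
        using cau[OF e] by blast
      have "cmod (?D n x h - G x h) \<le> e * norm h" if n: "n \<ge> N" and x: "x \<in> T" for n x h
      proof (rule Lim_bounded)
        show "(\<lambda>m. cmod (?D n x h - ?D m x h)) \<longlonglongrightarrow> cmod (?D n x h - G x h)"
          by (intro tendsto_intros G x)
        show "\<forall>m\<ge>N. cmod (?D n x h - ?D m x h) \<le> e * norm h" using N n x by blast
      qed
      then show ?thesis unfolding eventually_sequentially by blast
    qed
    show "p \<in> T" by (rule p)
    show "(\<lambda>n. F n p) \<longlonglongrightarrow> f p" using tendsto_uniform_limitI[OF lim] r by auto
  qed
  then obtain g where g: "\<And>x. x \<in> T \<Longrightarrow> (\<lambda>n. F n x) \<longlonglongrightarrow> g x"
    "\<And>x. x \<in> T \<Longrightarrow> (g has_derivative G x) (at x within T)" by blast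
  have gf: "g x = f x" if "x \<in> T" for x
    using LIMSEQ_unique[OF g(1)[OF that] tendsto_uniform_limitI[OF lim]] that T by auto
  have "open T" unfolding T_def by simp
  then have "(g has_derivative G p) (at p)" using g(2)[OF p] p at_within_open by metis
  then have "(f has_derivative G p) (at p)"
    by (rule has_derivative_transform_within_open[OF _ \<open>open T\<close> p gf])
  \<comment> \<open>Complex linearity is a closed condition and survives the pointwise limit of the
    derivatives.\<close>
  moreover have "G p (z *s a) = z * G p a" for z a
  proof (rule LIMSEQ_unique[OF G[OF p]])
    have "?D n p (z *s a) = z * ?D n p a" for n
      using p T by (intro hol_on_frechet(2)[OF hF]) auto
    then show "(\<lambda>n. ?D n p (z *s a)) \<longlonglongrightarrow> z * G p a"
      using tendsto_mult_left[OF G[OF p]] by simp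
  qed
  ultimately show "\<exists>D. (f has_derivative D) (at p) \<and> (\<forall>z a. D (z *s a) = z * D a)" by blast
qed

section \<open>Derivatives of holomorphic functions are holomorphic\<close>

text \<open>The constant is \<open>2 / (1/4)^2 = 32\<close>, from Cauchy's inequality for the second
  derivative on circles of radius \<open>R / 4\<close> about points of the disc of radius
  \<open>R / 2\<close>.\<close>

lemma norm_taylor_quadratic:
  assumes "\<phi> holomorphic_on ball 0 R" "0 < R" and B: "\<And>z. z \<in> ball 0 R \<Longrightarrow> cmod (\<phi> z) \<le> C"
    and z: "cmod z \<le> R / 2"
  shows "cmod (\<phi> z - (\<phi> 0 + deriv \<phi> 0 * z)) \<le> 32 * C / R\<^sup>2 * (cmod z)\<^sup>2"
proof -
  have "cmod ((deriv ^^ 0) \<phi> z - (\<Sum>i\<le>1. (deriv ^^ i) \<phi> 0 * (z - 0) ^ i / fact i))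
      \<le> 32 * C / R\<^sup>2 * cmod (z - 0) ^ Suc 1 / fact 1"
  proof (rule complex_Taylor[of "cball 0 (R / 2)"])
    fix x :: complex assume x: "x \<in> cball 0 (R / 2)"
    then have xR: "x \<in> ball 0 R" using \<open>0 < R\<close> by auto
    show "((deriv ^^ i) \<phi> has_field_derivative (deriv ^^ Suc i) \<phi> x) (at x within cball 0 (R / 2))" for i
      using holomorphic_derivI[OF holomorphic_higher_deriv[OF assms(1) open_ball] open_ball xR]
      by (simp add: has_field_derivative_at_within)
    have sub: "cball x (R / 4) \<subseteq> ball 0 R"
    proof
      fix y assume "y \<in> cball x (R / 4)"
      then show "y \<in> ball 0 R"
        using x \<open>0 < R\<close> dist_triangle[of 0 y x] by auto
    qed
    have "cmod ((deriv ^^ 2) \<phi> x) \<le> fact 2 * C / (R / 4)\<^sup>2"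
    proof (rule Cauchy_inequality)
      show "\<phi> holomorphic_on ball x (R / 4)"
        using assms(1) sub ball_subset_cball by (meson holomorphic_on_subset subset_trans)
      show "continuous_on (cball x (R / 4)) \<phi>"
        using assms(1) sub holomorphic_on_imp_continuous_on continuous_on_subset by blast
      show "cmod (\<phi> y) \<le> C" if "cmod (x - y) = R / 4" for y
        using sub that by (intro B) (auto simp: dist_norm)
    qed (use \<open>0 < R\<close> in auto)
    then show "cmod ((deriv ^^ Suc 1) \<phi> x) \<le> 32 * C / R\<^sup>2"
      by (simp add: numeral_2_eq_2 power2_eq_square field_simps)
  qed (use z \<open>0 < R\<close> in auto)
  then show ?thesis by (simp add: power2_eq_square)
qed

lemma hol_on_shift:
  assumes "hol_on T f" "\<And>p. p \<in> S \<Longrightarrow> p + w \<in> T"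
  shows "hol_on S (\<lambda>p. f (p + w))"
proof (rule hol_onI)
  fix p assume "p \<in> S"
  then have p: "p + w \<in> T" by (rule assms(2))
  have "((\<lambda>p. p + w) has_derivative (\<lambda>h. h)) (at p)"
    by (auto intro!: derivative_eq_intros)
  from has_derivative_compose[OF this hol_on_frechet(1)[OF assms(1) p]]
  show "((\<lambda>p. f (p + w)) has_derivative frechet_derivative f (at (p + w))) (at p)" .
  show "frechet_derivative f (at (p + w)) (\<i> *s a) = \<i> * frechet_derivative f (at (p + w)) a" for a
    by (rule hol_on_frechet(2)[OF assms(1) p])
qed

text \<open>Difference quotients with a fixed small increment are holomorphic in \<open>p\<close>,
  and the quadratic Taylor remainder makes them converge uniformly in \<open>p\<close>;
  Weierstrass's theorem carries holomorphy over to the limit.\<close>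

lemma hol_on_frechet_derivative:
  fixes f :: "complex ^ 'n::finite \<Rightarrow> complex"
  assumes "open S" "hol_on S f"
  shows "hol_on S (\<lambda>p. frechet_derivative f (at p) v)"
proof (cases "v = 0")
  case True
  show ?thesis unfolding hol_on_def
  proof (intro ballI exI conjI)
    fix p assume p: "p \<in> S"
    show "((\<lambda>p. frechet_derivative f (at p) v) has_derivative (\<lambda>_. 0)) (at p)"
      by (rule has_derivative_transform_within_open[OF has_derivative_const[of 0] assms(1) p])
        (use has_derivative_linear[OF hol_on_frechet(1)[OF assms(2)]] True in \<open>simp add: linear_0\<close>)
  qed auto
next
  case False
  show ?thesis
  proof (rule hol_on_uniform_limit)
    fix q assume "q \<in> S"
    then obtain s where s: "s > 0" "cball q s \<subseteq> S" using assms(1) open_contains_cball by blast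
    \<comment> \<open>Halving leaves room for both the point and the increment: \<open>p\<close> and
      \<open>p + z *s v\<close> stay in one compact ball, on which \<open>f\<close> has a common
      bound.\<close>
    define r where "r = s / 2"
    have r: "r > 0" and qr: "cball q (2 * r) \<subseteq> S" using s unfolding r_def by auto
    have "bounded (f ` cball q (2 * r))"
      using hol_on_imp_continuous_on[OF assms(2)] qr
      by (intro compact_imp_bounded compact_continuous_image) (auto intro: continuous_on_subset)
    then obtain C where C: "\<And>x. x \<in> cball q (2 * r) \<Longrightarrow> cmod (f x) \<le> C"
      unfolding bounded_iff by blast
    define R where "R = r / norm v"
    have R: "R > 0" unfolding R_def using r False by simp
    \<comment> \<open>The shift by \<open>k\<close> makes even the first increment
      \<open>t 0 = 1 / k\<close> at most \<open>R / 2\<close>, as the Taylor estimate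
      requires.\<close>
    obtain k where k: "real k > 2 / R" using reals_Archimedean2 by blast
    then have k0: "real k > 0" using R by (meson divide_pos_pos less_trans zero_less_numeral)
    define t where "t n = 1 / real (n + k)" for n
    have t: "0 < t n" "t n \<le> R / 2" for n
    proof -
      show "0 < t n" unfolding t_def using k0 by simp
      have "2 / R < real (n + k)" using k by simp
      then show "t n \<le> R / 2" unfolding t_def using R k0 by (simp add: field_simps)
    qed
    have move: "p + z *s v \<in> cball q (2 * r)" if "p \<in> ball q r" "cmod z < R" for p z
    proof -
      have "cmod z * norm v < r" using that(2) False unfolding R_def by (simp add: field_simps)
      then have "dist p (p + z *s v) < r" by (simp add: dist_norm norm_vector_smult)
      then show ?thesis using that(1) dist_triangle[of q "p + z *s v" p] by auto
    qed
    define F where "F n p = (f (p + complex_of_real (t n) *s v) - f p) / complex_of_real (t n)" for n p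
    have tR: "cmod (complex_of_real (t n)) < R" for n using t[of n] R by simp
    have "hol_on (ball q r) (F n)" for n
    proof -
      have "hol_on (ball q r) (\<lambda>p. f (p + complex_of_real (t n) *s v) - f p)"
        using move tR qr r
        by (intro hol_on_diff hol_on_shift[OF assms(2)]) (force intro: hol_on_subset[OF assms(2)])+
      from hol_on_cmult[OF this, of "1 / complex_of_real (t n)"] show ?thesis
        unfolding F_def by simp
    qed
    moreover have "uniform_limit (ball q r) F (\<lambda>p. frechet_derivative f (at p) v) sequentially"
    proof (rule uniform_limitI)
      fix e :: real assume "e > 0"
      have est: "dist (F n p) (frechet_derivative f (at p) v) \<le> 32 * C / R\<^sup>2 * t n" if p: "p \<in> ball q r" for n p
      proof -
        let ?\<phi> = "\<lambda>z. f (p + z *s v)"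
        let ?t = "complex_of_real (t n)"
        have der: "(?\<phi> has_field_derivative frechet_derivative f (at (p + z *s v)) v) (at z)"
          if "cmod z < R" for z
          using move[OF p that] qr by (intro hol_on_line[OF assms(2)]) auto
        have "deriv ?\<phi> 0 = frechet_derivative f (at p) v"
          using DERIV_imp_deriv[OF der[of 0]] R by simp
        moreover have "cmod (?\<phi> ?t - (?\<phi> 0 + deriv ?\<phi> 0 * ?t)) \<le> 32 * C / R\<^sup>2 * (cmod ?t)\<^sup>2"
        proof (rule norm_taylor_quadratic[OF _ R])
          show "?\<phi> holomorphic_on ball 0 R" by (rule holomorphic_on_ballI, rule der)
          show "cmod ?t \<le> R / 2" using t[of n] by simp
        qed (use C move p in auto)
        ultimately have "cmod (f (p + ?t *s v) - f p - frechet_derivative f (at p) v * ?t) \<le> 32 * C / R\<^sup>2 * (t n)\<^sup>2"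
          by (simp add: diff_diff_eq)
        moreover have "f (p + ?t *s v) - f p - frechet_derivative f (at p) v * ?t
            = (F n p - frechet_derivative f (at p) v) * ?t"
          unfolding F_def using t(1)[of n] by (simp add: field_simps)
        ultimately have "cmod (F n p - frechet_derivative f (at p) v) * t n \<le> 32 * C / R\<^sup>2 * t n * t n"
          using t(1)[of n] by (simp add: norm_mult power2_eq_square mult.assoc)
        then show ?thesis using t(1)[of n] unfolding dist_norm by (rule mult_right_le_imp_le)
      qed
      have "(\<lambda>n. 32 * C / R\<^sup>2 * t n) \<longlonglongrightarrow> 32 * C / R\<^sup>2 * 0"
        unfolding t_def
        by (intro tendsto_mult_left LIMSEQ_ignore_initial_segment[OF lim_1_over_n, of k])
      then have "\<forall>\<^sub>F n in sequentially. 32 * C / R\<^sup>2 * t n < e"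
        using \<open>e > 0\<close> by (auto intro: order_tendstoD(2))
      then show "\<forall>\<^sub>F n in sequentially. \<forall>p\<in>ball q r. dist (F n p) (frechet_derivative f (at p) v) < e"
        by eventually_elim (use est in \<open>blast intro: le_less_trans\<close>)
    qed
    ultimately show "\<exists>r>0. \<exists>F. (\<forall>n. hol_on (ball q r) (F n)) \<and>
        uniform_limit (ball q r) F (\<lambda>p. frechet_derivative f (at p) v) sequentially"
      using r by blast
  qed
qed

text \<open>The derivative in a fixed direction is again holomorphic, which matches the recursion of
  \<open>Ck_on\<close>.\<close>

lemma hol_on_imp_smooth_on:
  fixes f :: "complex ^ 'n::finite \<Rightarrow> complex"
  assumes "open S" "hol_on S f"
  shows "smooth_on S f"
  unfolding smooth_on_def
proof
  show "Ck_on k S f" for k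
    using assms(2)
  proof (induction k arbitrary: f)
    case 0
    then show ?case using hol_on_imp_continuous_on by simp
  next
    case (Suc k)
    then show ?case
      using hol_on_frechet_derivative[OF assms(1)] hol_on_frechet(1)[OF Suc.prems]
      by (auto simp: frechet_derivative_works)
  qed
qed

section \<open>Square-summable combinations of an orthonormal family\<close>

definition sq_summable :: "'i set \<Rightarrow> ('i \<Rightarrow> complex) \<Rightarrow> bool" where
  "sq_summable J a \<longleftrightarrow> (\<lambda>\<alpha>. (cmod (a \<alpha>))\<^sup>2) summable_on J"

definition sq_sum :: "'i set \<Rightarrow> ('i \<Rightarrow> complex) \<Rightarrow> real" where
  "sq_sum J a = (\<Sum>\<^sub>\<infinity>\<alpha>\<in>J. (cmod (a \<alpha>))\<^sup>2)"

lemma sq_sum_nonneg: "0 \<le> sq_sum J a"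
  unfolding sq_sum_def by (rule infsum_nonneg) simp

lemma sum_le_sq_sum:
  "sq_summable J a \<Longrightarrow> finite F \<Longrightarrow> F \<subseteq> J \<Longrightarrow> (\<Sum>\<alpha>\<in>F. (cmod (a \<alpha>))\<^sup>2) \<le> sq_sum J a"
  unfolding sq_sum_def sq_summable_def by (rule finite_sum_le_infsum) auto

lemma sq_summable_mult_right:
  assumes "sq_summable J a"
  shows "sq_summable J (\<lambda>\<alpha>. a \<alpha> * c)" "sq_sum J (\<lambda>\<alpha>. a \<alpha> * c) = sq_sum J a * (cmod c)\<^sup>2"
  using assms unfolding sq_summable_def sq_sum_def norm_mult power_mult_distrib
  by (auto intro: summable_on_cmult_left simp: infsum_cmult_left)

lemma sq_summable_cnj:
  "sq_summable J (\<lambda>\<alpha>. cnj (a \<alpha>)) \<longleftrightarrow> sq_summable J a" "sq_sum J (\<lambda>\<alpha>. cnj (a \<alpha>)) = sq_sum J a"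
  unfolding sq_summable_def sq_sum_def by simp_all

lemma sum_cmod_mult_le:
  assumes "sq_summable J a" "sq_summable J b" "finite F" "F \<subseteq> J"
  shows "(\<Sum>\<alpha>\<in>F. cmod (a \<alpha> * b \<alpha>)) \<le> sqrt (sq_sum J a) * sqrt (sq_sum J b)"
proof -
  have "(\<Sum>\<alpha>\<in>F. cmod (a \<alpha>) * cmod (b \<alpha>))\<^sup>2 \<le> (\<Sum>\<alpha>\<in>F. (cmod (a \<alpha>))\<^sup>2) * (\<Sum>\<alpha>\<in>F. (cmod (b \<alpha>))\<^sup>2)"
    by (rule Cauchy_Schwarz_ineq_sum)
  also have "\<dots> \<le> sq_sum J a * sq_sum J b"
    using assms by (intro mult_mono sum_le_sq_sum sq_sum_nonneg sum_nonneg) auto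
  finally have "(\<Sum>\<alpha>\<in>F. cmod (a \<alpha>) * cmod (b \<alpha>)) \<le> sqrt (sq_sum J a * sq_sum J b)"
    by (rule real_le_rsqrt)
  then show ?thesis by (simp add: norm_mult real_sqrt_mult)
qed

lemma abs_summable_mult:
  assumes "sq_summable J a" "sq_summable J b"
  shows "(\<lambda>\<alpha>. norm (a \<alpha> * b \<alpha>)) summable_on J"
  using sum_cmod_mult_le[OF assms]
  by (intro nonneg_bdd_above_summable_on bdd_aboveI2) auto

lemma summable_mult:
  "sq_summable J a \<Longrightarrow> sq_summable J b \<Longrightarrow> (\<lambda>\<alpha>. a \<alpha> * b \<alpha>) summable_on J"
  by (rule abs_summable_summable[OF abs_summable_mult])

lemma infsum_cmod_mult_le:
  assumes "sq_summable J a" "sq_summable J b"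
  shows "(\<Sum>\<^sub>\<infinity>\<alpha>\<in>J. cmod (a \<alpha> * b \<alpha>)) \<le> sqrt (sq_sum J a) * sqrt (sq_sum J b)"
  by (rule infsum_le_finite_sums[OF abs_summable_mult[OF assms] sum_cmod_mult_le[OF assms]])

lemma cmod_infsum_mult_le:
  assumes "sq_summable J a" "sq_summable J b"
  shows "cmod (\<Sum>\<^sub>\<infinity>\<alpha>\<in>J. a \<alpha> * b \<alpha>) \<le> sqrt (sq_sum J a) * sqrt (sq_sum J b)"
  using norm_infsum_bound[OF abs_summable_mult[OF assms]] infsum_cmod_mult_le[OF assms] by linarith

text \<open>The coefficients of the remainder after the partial sum over \<open>F\<close>, kept as a
  family on all of \<open>J\<close> so that every estimate for full series applies to the error as
  it stands.\<close>

definition off :: "'i set \<Rightarrow> ('i \<Rightarrow> complex) \<Rightarrow> 'i \<Rightarrow> complex" where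
  "off F a = (\<lambda>\<alpha>. if \<alpha> \<in> F then 0 else a \<alpha>)"

lemma sq_summable_off:
  assumes "sq_summable J a" "finite F" "F \<subseteq> J"
  shows "sq_summable J (off F a)" "sq_sum J (off F a) = sq_sum J a - (\<Sum>\<alpha>\<in>F. (cmod (a \<alpha>))\<^sup>2)"
proof -
  have eq: "(cmod (off F a \<alpha>))\<^sup>2 = (cmod (a \<alpha>))\<^sup>2 + - (if \<alpha> \<in> F then (cmod (a \<alpha>))\<^sup>2 else 0)" for \<alpha>
    unfolding off_def by simp
  have "((\<lambda>\<alpha>. if \<alpha> \<in> F then (cmod (a \<alpha>))\<^sup>2 else 0) has_sum (\<Sum>\<alpha>\<in>F. (cmod (a \<alpha>))\<^sup>2)) F"
    using assms(2) by (intro has_sum_finiteI) auto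
  then have "((\<lambda>\<alpha>. if \<alpha> \<in> F then (cmod (a \<alpha>))\<^sup>2 else 0) has_sum (\<Sum>\<alpha>\<in>F. (cmod (a \<alpha>))\<^sup>2)) J"
    using assms(3) by (subst has_sum_cong_neutral[where g = "\<lambda>\<alpha>. if \<alpha> \<in> F then (cmod (a \<alpha>))\<^sup>2 else 0" and S = J and T = F]) auto
  moreover have "((\<lambda>\<alpha>. (cmod (a \<alpha>))\<^sup>2) has_sum sq_sum J a) J"
    using assms(1) unfolding sq_summable_def sq_sum_def by (rule has_sum_infsum)
  ultimately have "((\<lambda>\<alpha>. (cmod (off F a \<alpha>))\<^sup>2) has_sum (sq_sum J a + - (\<Sum>\<alpha>\<in>F. (cmod (a \<alpha>))\<^sup>2))) J"
    unfolding eq by (intro has_sum_add) (simp_all add: has_sum_uminus)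
  then show "sq_summable J (off F a)" "sq_sum J (off F a) = sq_sum J a - (\<Sum>\<alpha>\<in>F. (cmod (a \<alpha>))\<^sup>2)"
    unfolding sq_summable_def sq_sum_def using has_sum_imp_summable infsumI by fastforce+
qed

lemma sq_sum_tail:
  assumes "sq_summable J a" "e > 0"
  shows "\<exists>F. finite F \<and> F \<subseteq> J \<and> sq_sum J (off F a) \<le> e"
proof -
  obtain F where F: "finite F" "F \<subseteq> J" "dist (\<Sum>\<alpha>\<in>F. (cmod (a \<alpha>))\<^sup>2) (sq_sum J a) \<le> e"
    using infsum_finite_approximation[OF assms(1)[unfolded sq_summable_def] assms(2)]
    unfolding sq_sum_def by blast
  then have "sq_sum J (off F a) \<le> e"
    using sq_summable_off(2)[OF assms(1) F(1,2)] by (auto simp: dist_real_def)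
  then show ?thesis using F by blast
qed

text \<open>\<open>has_sum\<close> is a limit along the finite subsets of an arbitrary
  \<open>J\<close>, whereas Fatou's lemma and Weierstrass's theorem want sequences; this supplies
  one.\<close>

lemma sq_sum_tail_sequence:
  assumes "sq_summable J a"
  shows "\<exists>F. (\<forall>n. finite (F n) \<and> F n \<subseteq> J) \<and> (\<lambda>n. sq_sum J (off (F n) a)) \<longlonglongrightarrow> 0"
proof -
  have "\<exists>F. finite F \<and> F \<subseteq> J \<and> sq_sum J (off F a) \<le> 1 / real (Suc n)" for n
    by (rule sq_sum_tail[OF assms]) simp
  then obtain F where F: "\<And>n. finite (F n)" "\<And>n. F n \<subseteq> J" "\<And>n. sq_sum J (off (F n) a) \<le> 1 / real (Suc n)"
    by metis
  have "(\<lambda>n. sq_sum J (off (F n) a)) \<longlonglongrightarrow> 0"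
  proof (rule tendsto_sandwich)
    show "\<forall>\<^sub>F n in sequentially. 0 \<le> sq_sum J (off (F n) a)"
      by (intro always_eventually allI sq_sum_nonneg)
    show "\<forall>\<^sub>F n in sequentially. sq_sum J (off (F n) a) \<le> 1 / real (Suc n)"
      by (intro always_eventually allI F(3))
    show "(\<lambda>n. 1 / real (Suc n)) \<longlonglongrightarrow> 0" using LIMSEQ_Suc[OF lim_1_over_n] by simp
  qed simp
  then show ?thesis using F by blast
qed

lemma infsum_off:
  fixes a f :: "'i \<Rightarrow> complex"
  assumes "(\<lambda>\<alpha>. a \<alpha> * f \<alpha>) summable_on J" "finite F" "F \<subseteq> J"
  shows "(\<Sum>\<^sub>\<infinity>\<alpha>\<in>J. off F a \<alpha> * f \<alpha>) = (\<Sum>\<^sub>\<infinity>\<alpha>\<in>J. a \<alpha> * f \<alpha>) - (\<Sum>\<alpha>\<in>F. a \<alpha> * f \<alpha>)"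
proof -
  have "(\<Sum>\<^sub>\<infinity>\<alpha>\<in>J. a \<alpha> * f \<alpha>) = (\<Sum>\<^sub>\<infinity>\<alpha>\<in>F \<union> (J - F). a \<alpha> * f \<alpha>)"
    using assms(3) by (simp add: Un_absorb1)
  also have "\<dots> = (\<Sum>\<^sub>\<infinity>\<alpha>\<in>F. a \<alpha> * f \<alpha>) + (\<Sum>\<^sub>\<infinity>\<alpha>\<in>J - F. a \<alpha> * f \<alpha>)"
    using assms by (intro infsum_Un_disjoint) (auto intro: summable_on_subset_banach)
  also have "(\<Sum>\<^sub>\<infinity>\<alpha>\<in>J - F. a \<alpha> * f \<alpha>) = (\<Sum>\<^sub>\<infinity>\<alpha>\<in>J. off F a \<alpha> * f \<alpha>)"
    by (rule infsum_cong_neutral) (auto simp: off_def)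
  finally show ?thesis using assms(2) by simp
qed

section \<open>Square-integrable functions and orthonormal families\<close>

definition L2_fun :: "'m measure \<Rightarrow> ('m \<Rightarrow> complex) \<Rightarrow> bool" where
  "L2_fun N f \<longleftrightarrow> f \<in> borel_measurable N \<and> integrable N (\<lambda>x. (cmod (f x))\<^sup>2)"

definition L2_sq :: "'m measure \<Rightarrow> ('m \<Rightarrow> complex) \<Rightarrow> real" where
  "L2_sq N f = (LINT x|N. (cmod (f x))\<^sup>2)"

lemma L2_sq_nonneg: "0 \<le> L2_sq N f"
  unfolding L2_sq_def by simp

lemma borel_measurable_cnj:
  "f \<in> borel_measurable N \<Longrightarrow> (\<lambda>x. cnj (f x)) \<in> borel_measurable N"
  by (rule measurable_compose[OF _ borel_measurable_continuous_onI]) (auto intro: continuous_intros)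

lemma L2_fun_integrable_mult:
  assumes "L2_fun N f" "L2_fun N g"
  shows "integrable N (\<lambda>x. cnj (f x) * g x)"
proof (rule Bochner_Integration.integrable_bound)
  show "integrable N (\<lambda>x. (cmod (f x))\<^sup>2 + (cmod (g x))\<^sup>2)"
    using assms unfolding L2_fun_def by auto
  show "(\<lambda>x. cnj (f x) * g x) \<in> borel_measurable N"
    using assms unfolding L2_fun_def by (intro borel_measurable_times borel_measurable_cnj) auto
  have "cmod (f x) * cmod (g x) \<le> (cmod (f x))\<^sup>2 + (cmod (g x))\<^sup>2" for x
  proof -
    have "0 \<le> cmod (f x) * cmod (g x)" by simp
    then show ?thesis
      using sum_squares_bound[of "cmod (f x)" "cmod (g x)"] unfolding mult.assoc by linarith
  qed
  then show "AE x in N. cmod (cnj (f x) * g x) \<le> norm ((cmod (f x))\<^sup>2 + (cmod (g x))\<^sup>2)"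
    by (simp add: norm_mult)
qed

text \<open>The Cauchy-Schwarz inequality is applied to extended nonnegative integrals of the moduli
  and brought back by integrability of the product.\<close>

lemma cmod_integral_mult_le:
  assumes "L2_fun N f" "L2_fun N g"
  shows "cmod (LINT x|N. cnj (f x) * g x) \<le> sqrt (L2_sq N f) * sqrt (L2_sq N g)"
proof -
  let ?h = "\<lambda>x. cmod (f x) * cmod (g x)"
  have [measurable]: "f \<in> borel_measurable N" "g \<in> borel_measurable N"
    and int: "integrable N (\<lambda>x. (cmod (f x))\<^sup>2)" "integrable N (\<lambda>x. (cmod (g x))\<^sup>2)"
    using assms unfolding L2_fun_def by auto
  have h: "integrable N ?h"
    using integrable_norm[OF L2_fun_integrable_mult[OF assms]] by (simp add: norm_mult)
  have "(\<integral>\<^sup>+x. ennreal (cmod (f x)) * ennreal (cmod (g x)) \<partial>N)\<^sup>2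
      \<le> (\<integral>\<^sup>+x. (ennreal (cmod (f x)))\<^sup>2 \<partial>N) * (\<integral>\<^sup>+x. (ennreal (cmod (g x)))\<^sup>2 \<partial>N)"
    by (rule Cauchy_Schwarz_nn_integral) auto
  then have "(\<integral>\<^sup>+x. ennreal (?h x) \<partial>N)\<^sup>2
      \<le> (\<integral>\<^sup>+x. ennreal ((cmod (f x))\<^sup>2) \<partial>N) * (\<integral>\<^sup>+x. ennreal ((cmod (g x))\<^sup>2) \<partial>N)"
    by (simp add: ennreal_mult ennreal_power)
  then have "(ennreal (LINT x|N. ?h x))\<^sup>2 \<le> ennreal (L2_sq N f) * ennreal (L2_sq N g)"
    using h int by (simp add: nn_integral_eq_integral L2_sq_def)
  then have "(LINT x|N. ?h x)\<^sup>2 \<le> L2_sq N f * L2_sq N g"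
    by (simp add: ennreal_power L2_sq_nonneg flip: ennreal_mult)
  then have "(LINT x|N. ?h x) \<le> sqrt (L2_sq N f * L2_sq N g)"
    by (rule real_le_rsqrt)
  moreover have "cmod (LINT x|N. cnj (f x) * g x) \<le> (LINT x|N. ?h x)"
    using integral_norm_bound[of N "\<lambda>x. cnj (f x) * g x"] by (simp add: norm_mult)
  ultimately show ?thesis by (simp add: real_sqrt_mult)
qed

text \<open>The last assumption controls evaluation at a point. It makes series with square-summable
  coefficients converge at every point, so that they are functions and not merely classes modulo
  null sets.\<close>

locale orthonormal_family =
  fixes N :: "'m measure" and J :: "'i set" and \<psi> :: "'i \<Rightarrow> 'm \<Rightarrow> complex"
  assumes \<psi>_L2: "\<alpha> \<in> J \<Longrightarrow> L2_fun N (\<psi> \<alpha>)"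
    and ortho: "\<alpha> \<in> J \<Longrightarrow> \<beta> \<in> J \<Longrightarrow> (LINT x|N. cnj (\<psi> \<alpha> x) * \<psi> \<beta> x) = (if \<alpha> = \<beta> then 1 else 0)"
    and \<psi>_sq_summable: "sq_summable J (\<lambda>\<alpha>. \<psi> \<alpha> x)"
begin

definition lincomb :: "('i \<Rightarrow> complex) \<Rightarrow> 'm \<Rightarrow> complex" where
  "lincomb a x = (\<Sum>\<^sub>\<infinity>\<alpha>\<in>J. a \<alpha> * \<psi> \<alpha> x)"

definition coeff :: "('m \<Rightarrow> complex) \<Rightarrow> 'i \<Rightarrow> complex" where
  "coeff \<phi> \<alpha> = (LINT x|N. cnj (\<psi> \<alpha> x) * \<phi> x)"

lemma lincomb_off:
  assumes "sq_summable J a" "finite F" "F \<subseteq> J"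
  shows "lincomb (off F a) x = lincomb a x - (\<Sum>\<alpha>\<in>F. a \<alpha> * \<psi> \<alpha> x)"
  unfolding lincomb_def
  by (rule infsum_off[OF summable_mult[OF assms(1) \<psi>_sq_summable] assms(2,3)])

lemma cmod_lincomb_le:
  "sq_summable J a \<Longrightarrow> cmod (lincomb a x) \<le> sqrt (sq_sum J a) * sqrt (sq_sum J (\<lambda>\<alpha>. \<psi> \<alpha> x))"
  unfolding lincomb_def by (rule cmod_infsum_mult_le[OF _ \<psi>_sq_summable])

lemma L2_sq_finite_sum:
  assumes F: "finite F" "F \<subseteq> J"
  shows "L2_fun N (\<lambda>x. \<Sum>\<alpha>\<in>F. a \<alpha> * \<psi> \<alpha> x)"
    and "L2_sq N (\<lambda>x. \<Sum>\<alpha>\<in>F. a \<alpha> * \<psi> \<alpha> x) = (\<Sum>\<alpha>\<in>F. (cmod (a \<alpha>))\<^sup>2)"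
proof -
  let ?s = "\<lambda>x. \<Sum>\<alpha>\<in>F. a \<alpha> * \<psi> \<alpha> x"
  let ?t = "\<lambda>x. \<Sum>\<alpha>\<in>F. \<Sum>\<beta>\<in>F. (cnj (a \<alpha>) * a \<beta>) * (cnj (\<psi> \<alpha> x) * \<psi> \<beta> x)"
  \<comment> \<open>The squared modulus becomes a double sum of complex integrands, from which
    orthonormality removes the off-diagonal terms; the real part leads back to it.\<close>
  have st: "complex_of_real ((cmod (?s x))\<^sup>2) = ?t x" for x
  proof -
    have "complex_of_real ((cmod (?s x))\<^sup>2) = cnj (?s x) * ?s x"
      unfolding complex_norm_square by (rule mult.commute)
    also have "\<dots> = ?t x"
      by (simp only: cnj_sum sum_product complex_cnj_mult) (simp add: mult_ac)
    finally show ?thesis .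
  qed
  have int: "integrable N (\<lambda>x. (cnj (a \<alpha>) * a \<beta>) * (cnj (\<psi> \<alpha> x) * \<psi> \<beta> x))"
    if "\<alpha> \<in> F" "\<beta> \<in> F" for \<alpha> \<beta>
    using that F(2) by (intro integrable_mult_right L2_fun_integrable_mult \<psi>_L2) auto
  have it: "integrable N ?t"
    by (intro Bochner_Integration.integrable_sum int)
  have sq: "(cmod (?s x))\<^sup>2 = Re (?t x)" for x
    using st[of x] by (metis Re_complex_of_real)
  have "(\<lambda>x. ?s x) \<in> borel_measurable N"
    using \<psi>_L2 F unfolding L2_fun_def by (intro borel_measurable_sum borel_measurable_times) auto
  then show "L2_fun N ?s"
    unfolding L2_fun_def sq using integrable_Re[OF it] by simp
  have "L2_sq N ?s = Re (LINT x|N. ?t x)"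
    unfolding L2_sq_def sq by (rule integral_Re[OF it])
  also have "(LINT x|N. ?t x) = (\<Sum>\<alpha>\<in>F. \<Sum>\<beta>\<in>F. (cnj (a \<alpha>) * a \<beta>) * (if \<alpha> = \<beta> then 1 else 0))"
  proof -
    have "(LINT x|N. ?t x) = (\<Sum>\<alpha>\<in>F. (LINT x|N. (\<Sum>\<beta>\<in>F. (cnj (a \<alpha>) * a \<beta>) * (cnj (\<psi> \<alpha> x) * \<psi> \<beta> x))))"
      by (intro Bochner_Integration.integral_sum Bochner_Integration.integrable_sum int)
    also have "\<dots> = (\<Sum>\<alpha>\<in>F. \<Sum>\<beta>\<in>F. (LINT x|N. (cnj (a \<alpha>) * a \<beta>) * (cnj (\<psi> \<alpha> x) * \<psi> \<beta> x)))"
      by (intro sum.cong refl Bochner_Integration.integral_sum int)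
    also have "\<dots> = (\<Sum>\<alpha>\<in>F. \<Sum>\<beta>\<in>F. (cnj (a \<alpha>) * a \<beta>) * (if \<alpha> = \<beta> then 1 else 0))"
      using F(2) ortho by (intro sum.cong refl) (simp add: subset_eq)
    finally show ?thesis .
  qed
  also have "\<dots> = (\<Sum>\<alpha>\<in>F. cnj (a \<alpha>) * a \<alpha>)"
    using F by (intro sum.cong) (auto simp: if_distrib cong: if_cong)
  also have "Re \<dots> = (\<Sum>\<alpha>\<in>F. (cmod (a \<alpha>))\<^sup>2)"
    unfolding cmod_power2 by (simp add: power2_eq_square)
  finally show "L2_sq N ?s = (\<Sum>\<alpha>\<in>F. (cmod (a \<alpha>))\<^sup>2)" .
qed

text \<open>The norm bound is Fatou's lemma along finite partial sums with vanishing tails.\<close>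

lemma L2_lincomb:
  assumes a: "sq_summable J a"
  shows "L2_fun N (lincomb a)" "L2_sq N (lincomb a) \<le> sq_sum J a"
proof -
  obtain F where F: "\<And>n. finite (F n)" "\<And>n. F n \<subseteq> J" "(\<lambda>n. sq_sum J (off (F n) a)) \<longlonglongrightarrow> 0"
    using sq_sum_tail_sequence[OF a] by blast
  let ?s = "\<lambda>n x. \<Sum>\<alpha>\<in>F n. a \<alpha> * \<psi> \<alpha> x"
  have lim: "(\<lambda>n. ?s n x) \<longlonglongrightarrow> lincomb a x" for x
  proof -
    have "(\<lambda>n. lincomb (off (F n) a) x) \<longlonglongrightarrow> 0"
    proof (rule Lim_null_comparison)
      show "\<forall>\<^sub>F n in sequentially. cmod (lincomb (off (F n) a) x)
          \<le> sqrt (sq_sum J (off (F n) a)) * sqrt (sq_sum J (\<lambda>\<alpha>. \<psi> \<alpha> x))"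
        by (intro always_eventually allI cmod_lincomb_le sq_summable_off(1)[OF a F(1,2)])
      show "(\<lambda>n. sqrt (sq_sum J (off (F n) a)) * sqrt (sq_sum J (\<lambda>\<alpha>. \<psi> \<alpha> x))) \<longlonglongrightarrow> 0"
        using tendsto_mult_right[OF tendsto_real_sqrt[OF F(3)], of "sqrt (sq_sum J (\<lambda>\<alpha>. \<psi> \<alpha> x))"] by simp
    qed
    then have "(\<lambda>n. lincomb a x - ?s n x) \<longlonglongrightarrow> 0"
      by (simp add: lincomb_off[OF a F(1,2)])
    from tendsto_diff[OF tendsto_const[of "lincomb a x"] this] show ?thesis by simp
  qed
  have sm[measurable]: "?s n \<in> borel_measurable N" for n
    using L2_sq_finite_sum(1)[OF F(1,2)] unfolding L2_fun_def by blast
  have m[measurable]: "lincomb a \<in> borel_measurable N"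
    by (rule borel_measurable_LIMSEQ_metric[OF sm lim])
  have "(\<integral>\<^sup>+x. ennreal ((cmod (lincomb a x))\<^sup>2) \<partial>N) = (\<integral>\<^sup>+x. liminf (\<lambda>n. ennreal ((cmod (?s n x))\<^sup>2)) \<partial>N)"
    by (intro nn_integral_cong lim_imp_Liminf[symmetric]) (auto intro!: tendsto_intros lim)
  also have "\<dots> \<le> liminf (\<lambda>n. \<integral>\<^sup>+x. ennreal ((cmod (?s n x))\<^sup>2) \<partial>N)"
    by (rule nn_integral_liminf) auto
  also have "\<dots> \<le> liminf (\<lambda>n. ennreal (sq_sum J a))"
  proof (intro Liminf_mono always_eventually allI)
    fix n
    have "(\<integral>\<^sup>+x. ennreal ((cmod (?s n x))\<^sup>2) \<partial>N) = ennreal (L2_sq N (?s n))"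
      using L2_sq_finite_sum(1)[OF F(1)[of n] F(2)[of n], of a] unfolding L2_sq_def L2_fun_def
      by (intro nn_integral_eq_integral) auto
    also have "\<dots> \<le> ennreal (sq_sum J a)"
      using sum_le_sq_sum[OF a F(1,2)] by (simp add: L2_sq_finite_sum(2)[OF F(1,2)] ennreal_leI)
    finally show "(\<integral>\<^sup>+x. ennreal ((cmod (?s n x))\<^sup>2) \<partial>N) \<le> ennreal (sq_sum J a)" .
  qed
  finally have le: "(\<integral>\<^sup>+x. ennreal ((cmod (lincomb a x))\<^sup>2) \<partial>N) \<le> ennreal (sq_sum J a)"
    by (simp add: Liminf_const)
  then have int: "integrable N (\<lambda>x. (cmod (lincomb a x))\<^sup>2)"
    by (intro integrableI_bounded) (auto simp: less_top[symmetric] top_unique)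
  then show "L2_fun N (lincomb a)" unfolding L2_fun_def by simp
  show "L2_sq N (lincomb a) \<le> sq_sum J a"
    using le int by (simp add: nn_integral_eq_integral L2_sq_def sq_sum_nonneg)
qed

text \<open>The error after the sum over \<open>F\<close> is the pairing of \<open>\<phi>\<close>
  with \<open>lincomb (off F a)\<close>, whose norm is bounded by the tail of \<open>a\<close>. By
  the Cauchy-Schwarz inequality it is small for every \<open>F\<close> that contains a suitable
  \<open>F0\<close>.\<close>

lemma coeff_lincomb_pairing:
  assumes a: "sq_summable J a" and \<phi>: "L2_fun N \<phi>"
  shows "((\<lambda>\<alpha>. cnj (a \<alpha>) * coeff \<phi> \<alpha>) has_sum (LINT x|N. cnj (lincomb a x) * \<phi> x)) J"
  unfolding has_sum_def tendsto_iff eventually_finite_subsets_at_top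
proof (intro allI impI)
  fix e :: real assume "e > 0"
  \<comment> \<open>Chosen so that \<open>sqrt d\<close> times the norm of \<open>\<phi>\<close> is
    below \<open>e / 2\<close>; the added 1 covers a \<open>\<phi>\<close> of norm 0.\<close>
  define d where "d = (e / (sqrt (L2_sq N \<phi>) + 1))\<^sup>2 / 4"
  have pos: "sqrt (L2_sq N \<phi>) + 1 > 0" using L2_sq_nonneg[of N \<phi>] by (simp add: add_nonneg_pos)
  then have d: "d > 0" unfolding d_def using \<open>e > 0\<close> by simp
  have "sqrt d = e / (sqrt (L2_sq N \<phi>) + 1) / 2"
    unfolding d_def using \<open>e > 0\<close> pos by (simp add: real_sqrt_divide)
  then have small: "sqrt d * sqrt (L2_sq N \<phi>) < e"
  proof -
    have "e * sqrt (L2_sq N \<phi>) < e * ((sqrt (L2_sq N \<phi>) + 1) * 2)"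
      using \<open>e > 0\<close> L2_sq_nonneg[of N \<phi>] by (intro mult_strict_left_mono) (auto simp: add_nonneg_pos)
    then show ?thesis
      using pos unfolding \<open>sqrt d = _\<close> by (simp add: pos_divide_less_eq mult.assoc)
  qed
  obtain F0 where F0: "finite F0" "F0 \<subseteq> J" "sq_sum J (off F0 a) \<le> d"
    using sq_sum_tail[OF a d] by blast
  have "dist (\<Sum>\<alpha>\<in>F. cnj (a \<alpha>) * coeff \<phi> \<alpha>) (LINT x|N. cnj (lincomb a x) * \<phi> x) < e"
    if F: "finite F" "F0 \<subseteq> F" "F \<subseteq> J" for F
  proof -
    have off: "sq_summable J (off F a)" by (rule sq_summable_off[OF a F(1,3)])
    have "sq_sum J (off F a) \<le> sq_sum J (off F0 a)"
      using F F0 by (simp add: sq_summable_off(2)[OF a] sum_mono2)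
    then have sd: "sq_sum J (off F a) \<le> d" using F0 by simp
    have int: "integrable N (\<lambda>x. cnj (\<psi> \<alpha> x) * \<phi> x)" if "\<alpha> \<in> F" for \<alpha>
      using that F by (intro L2_fun_integrable_mult \<psi>_L2 \<phi>) auto
    have "(LINT x|N. cnj (lincomb (off F a) x) * \<phi> x)
        = (LINT x|N. cnj (lincomb a x) * \<phi> x - (\<Sum>\<alpha>\<in>F. cnj (a \<alpha>) * (cnj (\<psi> \<alpha> x) * \<phi> x)))"
      by (simp add: lincomb_off[OF a F(1,3)] algebra_simps sum_distrib_right sum_distrib_left)
    also have "\<dots> = (LINT x|N. cnj (lincomb a x) * \<phi> x) - (\<Sum>\<alpha>\<in>F. cnj (a \<alpha>) * coeff \<phi> \<alpha>)"
      using int by (subst Bochner_Integration.integral_diff)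
        (auto intro!: L2_fun_integrable_mult L2_lincomb a \<phi> Bochner_Integration.integrable_sum simp: coeff_def)
    finally have "dist (\<Sum>\<alpha>\<in>F. cnj (a \<alpha>) * coeff \<phi> \<alpha>) (LINT x|N. cnj (lincomb a x) * \<phi> x)
        = cmod (LINT x|N. cnj (lincomb (off F a) x) * \<phi> x)"
      by (simp add: dist_norm norm_minus_commute)
    also have "\<dots> \<le> sqrt (L2_sq N (lincomb (off F a))) * sqrt (L2_sq N \<phi>)"
      by (rule cmod_integral_mult_le[OF L2_lincomb(1)[OF off] \<phi>])
    also have "\<dots> \<le> sqrt d * sqrt (L2_sq N \<phi>)"
      using L2_lincomb(2)[OF off] sd L2_sq_nonneg[of N \<phi>] by (intro mult_right_mono) auto
    finally show ?thesis using small by simp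
  qed
  then show "\<exists>X. finite X \<and> X \<subseteq> J \<and> (\<forall>Y. finite Y \<and> X \<subseteq> Y \<and> Y \<subseteq> J \<longrightarrow>
      dist (\<Sum>\<alpha>\<in>Y. cnj (a \<alpha>) * coeff \<phi> \<alpha>) (LINT x|N. cnj (lincomb a x) * \<phi> x) < e)"
    using F0 by blast
qed

text \<open>Pairing with \<open>\<psi> \<alpha>\<close> leaves a single term of the series, and
  conjugation exchanges the two sides of the pairing.\<close>

lemma coeff_lincomb:
  assumes a: "sq_summable J a" and \<alpha>: "\<alpha> \<in> J"
  shows "coeff (lincomb a) \<alpha> = a \<alpha>"
proof -
  have "((\<lambda>\<beta>. cnj (a \<beta>) * coeff (\<psi> \<alpha>) \<beta>) has_sum cnj (a \<alpha>)) {\<alpha>}"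
    using \<alpha> by (intro has_sum_finiteI) (simp_all add: coeff_def ortho)
  then have "((\<lambda>\<beta>. cnj (a \<beta>) * coeff (\<psi> \<alpha>) \<beta>) has_sum cnj (a \<alpha>)) J"
    using \<alpha> by (subst has_sum_cong_neutral[where T = "{\<alpha>}" and g = "\<lambda>\<beta>. cnj (a \<beta>) * coeff (\<psi> \<alpha>) \<beta>"])
      (auto simp: coeff_def ortho)
  then have "cnj (LINT x|N. cnj (lincomb a x) * \<psi> \<alpha> x) = a \<alpha>"
    using has_sum_unique[OF coeff_lincomb_pairing[OF a \<psi>_L2[OF \<alpha>]]] by simp
  then show ?thesis
    unfolding coeff_def using Bochner_Integration.integral_cnj[of N "\<lambda>x. cnj (lincomb a x) * \<psi> \<alpha> x"]
    by (simp add: mult.commute)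
qed

text \<open>Bessel's inequality by pairing \<open>\<phi>\<close> with its own partial projection:
  the result is \<open>?X\<close>, the Cauchy-Schwarz bound is \<open>sqrt ?X\<close> times the norm
  of \<open>\<phi>\<close>, and a factor \<open>sqrt ?X\<close> cancels unless it is 0.\<close>

lemma bessel:
  assumes \<phi>: "L2_fun N \<phi>"
  shows "sq_summable J (coeff \<phi>)" "sq_sum J (coeff \<phi>) \<le> L2_sq N \<phi>"
proof -
  have fin: "(\<Sum>\<alpha>\<in>F. (cmod (coeff \<phi> \<alpha>))\<^sup>2) \<le> L2_sq N \<phi>" if F: "finite F" "F \<subseteq> J" for F
  proof -
    let ?X = "\<Sum>\<alpha>\<in>F. (cmod (coeff \<phi> \<alpha>))\<^sup>2"
    let ?s = "\<lambda>x. \<Sum>\<alpha>\<in>F. coeff \<phi> \<alpha> * \<psi> \<alpha> x"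
    have int: "integrable N (\<lambda>x. cnj (\<psi> \<alpha> x) * \<phi> x)" if "\<alpha> \<in> F" for \<alpha>
      using that F by (intro L2_fun_integrable_mult \<psi>_L2 \<phi>) auto
    have "(LINT x|N. cnj (?s x) * \<phi> x) = (LINT x|N. (\<Sum>\<alpha>\<in>F. cnj (coeff \<phi> \<alpha>) * (cnj (\<psi> \<alpha> x) * \<phi> x)))"
      by (simp add: sum_distrib_right mult.assoc)
    also have "\<dots> = (\<Sum>\<alpha>\<in>F. cnj (coeff \<phi> \<alpha>) * coeff \<phi> \<alpha>)"
      using int by (simp add: coeff_def)
    also have "\<dots> = complex_of_real ?X"
      by (simp add: complex_norm_square mult.commute del: of_real_power)
    finally have "complex_of_real ?X = (LINT x|N. cnj (?s x) * \<phi> x)" ..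
    then have "\<bar>?X\<bar> = cmod (LINT x|N. cnj (?s x) * \<phi> x)"
      by (metis norm_of_real)
    then have "?X = cmod (LINT x|N. cnj (?s x) * \<phi> x)"
      by (simp add: sum_nonneg)
    also have "\<dots> \<le> sqrt ?X * sqrt (L2_sq N \<phi>)"
      using cmod_integral_mult_le[OF L2_sq_finite_sum(1)[OF F] \<phi>] by (simp add: L2_sq_finite_sum(2)[OF F])
    finally have "sqrt ?X * sqrt ?X \<le> sqrt ?X * sqrt (L2_sq N \<phi>)"
      by (simp add: sum_nonneg)
    moreover have "0 \<le> ?X" by (simp add: sum_nonneg)
    ultimately have "?X = 0 \<or> sqrt ?X \<le> sqrt (L2_sq N \<phi>)"
      by (metis less_eq_real_def mult_le_cancel_left_pos real_sqrt_gt_zero)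
    then show ?thesis using L2_sq_nonneg[of N \<phi>] by auto
  qed
  show "sq_summable J (coeff \<phi>)"
    unfolding sq_summable_def using fin by (intro nonneg_bdd_above_summable_on bdd_aboveI2) auto
  then show "sq_sum J (coeff \<phi>) \<le> L2_sq N \<phi>"
    unfolding sq_summable_def sq_sum_def by (rule infsum_le_finite_sums) (use fin in auto)
qed

section \<open>The reproducing kernel and its projection\<close>

definition rkernel :: "'m \<Rightarrow> 'm \<Rightarrow> complex" where
  "rkernel x = lincomb (\<lambda>\<alpha>. cnj (\<psi> \<alpha> x))"

lemma cnj_rkernel: "cnj (rkernel x y) = rkernel y x"
  unfolding rkernel_def lincomb_def by (simp flip: infsum_cnj add: mult.commute)

text \<open>As a function of \<open>z\<close>, the conjugate of \<open>rkernel z y\<close> is the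
  series with coefficients \<open>cnj (\<psi> \<alpha> y)\<close>. Pairing it with
  \<open>\<phi>\<close> therefore sums the Fourier coefficients of \<open>\<phi>\<close> against
  \<open>\<psi> \<alpha> y\<close>, which is the orthogonal projection of \<open>\<phi>\<close>
  evaluated at \<open>y\<close>.\<close>

lemma integral_rkernel:
  assumes \<phi>: "L2_fun N \<phi>"
  shows "integrable N (\<lambda>z. rkernel z y * \<phi> z)"
    and "(LINT z|N. rkernel z y * \<phi> z) = lincomb (coeff \<phi>) y"
proof -
  have s: "sq_summable J (\<lambda>\<alpha>. cnj (\<psi> \<alpha> y))" by (simp add: sq_summable_cnj \<psi>_sq_summable)
  have eq: "rkernel z y = cnj (lincomb (\<lambda>\<alpha>. cnj (\<psi> \<alpha> y)) z)" for z
    by (metis cnj_rkernel rkernel_def)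
  show "integrable N (\<lambda>z. rkernel z y * \<phi> z)"
    unfolding eq by (rule L2_fun_integrable_mult[OF L2_lincomb(1)[OF s] \<phi>])
  show "(LINT z|N. rkernel z y * \<phi> z) = lincomb (coeff \<phi>) y"
    unfolding eq using infsumI[OF coeff_lincomb_pairing[OF s \<phi>]]
    by (simp add: lincomb_def mult.commute)
qed

text \<open>\<open>rkernel x\<close> lies in the range of the projection, which therefore fixes
  it.\<close>

lemma rkernel_reproducing:
  "has_bochner_integral N (\<lambda>z. rkernel z y * rkernel x z) (rkernel x y)"
proof -
  have s: "sq_summable J (\<lambda>\<alpha>. cnj (\<psi> \<alpha> x))" by (simp add: sq_summable_cnj \<psi>_sq_summable)
  have L: "L2_fun N (rkernel x)" unfolding rkernel_def by (rule L2_lincomb(1)[OF s])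
  have "lincomb (coeff (rkernel x)) y = rkernel x y"
    unfolding rkernel_def lincomb_def[of _ y] by (intro infsum_cong) (simp add: coeff_lincomb[OF s])
  then show ?thesis
    using integral_rkernel[OF L] by (simp add: has_bochner_integral_iff)
qed

text \<open>The iterated integral is the inner product of \<open>\<phi>1\<close> with the projection
  of \<open>\<phi>2\<close>; Bessel's inequality and the norm bound for \<open>lincomb\<close> make
  the projection a contraction.\<close>

lemma rkernel_form_bounded:
  assumes \<phi>1: "L2_fun N \<phi>1" and \<phi>2: "L2_fun N \<phi>2"
  shows "integrable N (\<lambda>x. cnj (\<phi>1 y) * (rkernel x y * \<phi>2 x))"
    and "integrable N (\<lambda>y. LINT x|N. cnj (\<phi>1 y) * (rkernel x y * \<phi>2 x))"
    and "cmod (LINT y|N. LINT x|N. cnj (\<phi>1 y) * (rkernel x y * \<phi>2 x)) \<le> sqrt (L2_sq N \<phi>1) * sqrt (L2_sq N \<phi>2)"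
proof -
  show "integrable N (\<lambda>x. cnj (\<phi>1 y) * (rkernel x y * \<phi>2 x))"
    by (intro integrable_mult_right integral_rkernel \<phi>2)
  have eq: "(LINT x|N. cnj (\<phi>1 y) * (rkernel x y * \<phi>2 x)) = cnj (\<phi>1 y) * lincomb (coeff \<phi>2) y" for y
    by (simp add: integral_rkernel[OF \<phi>2])
  note L = L2_lincomb[OF bessel(1)[OF \<phi>2]]
  show "integrable N (\<lambda>y. LINT x|N. cnj (\<phi>1 y) * (rkernel x y * \<phi>2 x))"
    unfolding eq by (rule L2_fun_integrable_mult[OF \<phi>1 L(1)])
  have "cmod (LINT y|N. cnj (\<phi>1 y) * lincomb (coeff \<phi>2) y) \<le> sqrt (L2_sq N \<phi>1) * sqrt (L2_sq N (lincomb (coeff \<phi>2)))"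
    by (rule cmod_integral_mult_le[OF \<phi>1 L(1)])
  also have "\<dots> \<le> sqrt (L2_sq N \<phi>1) * sqrt (L2_sq N \<phi>2)"
    using L(2) bessel(2)[OF \<phi>2] L2_sq_nonneg by (intro mult_left_mono) auto
  finally show "cmod (LINT y|N. LINT x|N. cnj (\<phi>1 y) * (rkernel x y * \<phi>2 x)) \<le> sqrt (L2_sq N \<phi>1) * sqrt (L2_sq N \<phi>2)"
    unfolding eq .
qed

end

section \<open>Sections of a prequantum line bundle\<close>

lemma has_derivative_Re: "(f has_derivative D) F \<Longrightarrow> ((\<lambda>x. Re (f x)) has_derivative (\<lambda>v. Re (D v))) F"
  by (rule bounded_linear.has_derivative[OF bounded_linear_Re])

lemma has_derivative_Im: "(f has_derivative D) F \<Longrightarrow> ((\<lambda>x. Im (f x)) has_derivative (\<lambda>v. Im (D v))) F"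
  by (rule bounded_linear.has_derivative[OF bounded_linear_Im])

lemma smooth_fun_subset: "smooth_fun A W f \<Longrightarrow> W' \<subseteq> W \<Longrightarrow> smooth_fun A W' f"
  unfolding smooth_fun_def smooth_on_def by (meson Ck_on_subset Int_mono image_mono order_refl)

text \<open>The quotient of two sections of a line bundle, written with the metric so that no frame
  has to be chosen.\<close>

definition ratio :: "('m, 'e) line_bundle \<Rightarrow> ('m \<Rightarrow> 'e) \<Rightarrow> ('m \<Rightarrow> 'e) \<Rightarrow> 'm \<Rightarrow> complex" where
  "ratio L s t y = herm L y (t y) (s y) / herm L y (t y) (t y)"

text \<open>A condition at one point, since the argument passes between sections that agree or are
  smooth only near it.\<close>

definition holomorphic_at ::
    "('m::topological_space, 'n::finite) kaehler_data \<Rightarrow> ('m, 'e::ab_group_add) line_bundle \<Rightarrow> ('m \<Rightarrow> 'e) \<Rightarrow> 'm \<Rightarrow> bool" where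
  "holomorphic_at M L s x \<longleftrightarrow>
     (\<forall>(v, w)\<in>minus_i_eigenspace M x. conn L x v s + scl L \<i> (conn L x w s) = 0)"

definition cauchy_riemann_at ::
    "('m::topological_space, 'n::finite) kaehler_data \<Rightarrow> ('m \<Rightarrow> complex) \<Rightarrow> 'm \<Rightarrow> bool" where
  "cauchy_riemann_at M f x \<longleftrightarrow>
     (\<forall>c\<in>charts M. x \<in> fst c \<longrightarrow> (\<forall>a.
        frechet_derivative (f \<circ> chart_inv c) (at (snd c x)) (\<i> *s a)
          = \<i> * frechet_derivative (f \<circ> chart_inv c) (at (snd c x)) a))"

locale prequantum_bundle =
  fixes M :: "('m::{t2_space, second_countable_topology}, 'n::finite) kaehler_data"
    and L :: "('m, 'e::ab_group_add) line_bundle"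
    and hbar :: real
  assumes kaehler: "kaehler_manifold M"
    and prequantum: "prequantum_line_bundle M L hbar"
begin

lemma line_bundle: "complex_line_bundle M L"
  and metric: "hermitian_metric M L"
  and conn: "connection M L"
  and herm_conn: "hermitian_connection M L"
  using prequantum unfolding prequantum_line_bundle_def hermitian_connection_def by blast+

sublocale fib: vector_space "scl L"
  using line_bundle unfolding complex_line_bundle_def by blast

section \<open>Charts, smooth functions and tangent vectors\<close>

lemma chart_open: "c \<in> charts M \<Longrightarrow> open (fst c)"
  and chart_image_open: "c \<in> charts M \<Longrightarrow> open (snd c ` fst c)"
  and chart_homeomorphism: "c \<in> charts M \<Longrightarrow> homeomorphism (fst c) (snd c ` fst c) (snd c) (chart_inv c)"
  and chart_cover: "(\<Union>c\<in>charts M. fst c) = UNIV"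
  using kaehler unfolding kaehler_manifold_def complex_atlas_def by blast+

lemma chart_ex: obtains c where "c \<in> charts M" "x \<in> fst c"
  using chart_cover by blast

lemma chart_inv_chart: "c \<in> charts M \<Longrightarrow> x \<in> fst c \<Longrightarrow> chart_inv c (snd c x) = x"
  by (rule homeomorphism_apply1[OF chart_homeomorphism])

lemma open_chart_image:
  assumes "c \<in> charts M" "open W"
  shows "open (snd c ` (fst c \<inter> W))"
proof -
  have "openin (top_of_set (snd c ` fst c)) (snd c ` (fst c \<inter> W))"
    by (rule homeomorphism_imp_open_map[OF chart_homeomorphism[OF assms(1)]])
      (use assms(2) in \<open>auto simp: openin_open\<close>)
  then show ?thesis
    by (rule openin_open_trans[OF _ chart_image_open[OF assms(1)]])
qed

lemma smooth_funI:
  assumes "\<And>c k. c \<in> charts M \<Longrightarrow> Ck_on k (snd c ` (fst c \<inter> W)) (\<lambda>p. f (chart_inv c p))"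
  shows "smooth_fun (charts M) W f"
  using assms unfolding smooth_fun_def smooth_on_def comp_def by blast

lemma smooth_funD:
  "smooth_fun (charts M) W f \<Longrightarrow> c \<in> charts M \<Longrightarrow> Ck_on k (snd c ` (fst c \<inter> W)) (\<lambda>p. f (chart_inv c p))"
  unfolding smooth_fun_def smooth_on_def comp_def by blast

lemma smooth_fun_cong:
  assumes "open W" "smooth_fun (charts M) W f" "\<And>x. x \<in> W \<Longrightarrow> f x = g x"
  shows "smooth_fun (charts M) W g"
proof (rule smooth_funI)
  fix c k assume c: "c \<in> charts M"
  show "Ck_on k (snd c ` (fst c \<inter> W)) (\<lambda>p. g (chart_inv c p))"
    by (rule Ck_on_cong[OF open_chart_image[OF c assms(1)] _ smooth_funD[OF assms(2) c]])
      (use assms(3) chart_inv_chart[OF c] in auto)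
qed

lemma smooth_fun_const: "smooth_fun (charts M) W (\<lambda>x. c)"
  by (intro smooth_funI Ck_on_const)

lemma smooth_fun_mult:
  fixes f g :: "'m \<Rightarrow> complex"
  shows "open W \<Longrightarrow> smooth_fun (charts M) W f \<Longrightarrow> smooth_fun (charts M) W g \<Longrightarrow>
    smooth_fun (charts M) W (\<lambda>x. f x * g x)"
  by (rule smooth_funI) (rule Ck_on_mult[OF open_chart_image smooth_funD smooth_funD])

lemma smooth_fun_bounded_linear:
  "open W \<Longrightarrow> bounded_linear h \<Longrightarrow> smooth_fun (charts M) W f \<Longrightarrow> smooth_fun (charts M) W (\<lambda>x. h (f x))"
  by (rule smooth_funI) (rule Ck_on_bounded_linear[OF open_chart_image _ smooth_funD])

lemma smooth_fun_inverse:
  fixes f :: "'m \<Rightarrow> complex"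
  assumes "open W" "smooth_fun (charts M) W f" "\<And>x. x \<in> W \<Longrightarrow> f x \<noteq> 0"
  shows "smooth_fun (charts M) W (\<lambda>x. inverse (f x))"
proof (rule smooth_funI)
  fix c k assume c: "c \<in> charts M"
  show "Ck_on k (snd c ` (fst c \<inter> W)) (\<lambda>p. inverse (f (chart_inv c p)))"
    by (rule Ck_on_inverse[OF open_chart_image[OF c assms(1)] _ smooth_funD[OF assms(2) c]])
      (use assms(3) chart_inv_chart[OF c] in auto)
qed

lemma smooth_fun_imp_continuous_on:
  assumes "open W" "smooth_fun (charts M) W f"
  shows "continuous_on W f"
proof -
  have "continuous_on (fst c \<inter> W) f" if c: "c \<in> charts M" for c
  proof -
    have "continuous_on (snd c ` (fst c \<inter> W)) (\<lambda>p. f (chart_inv c p))"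
      using smooth_funD[OF assms(2) c, of 0] by simp
    moreover have "continuous_on (fst c \<inter> W) (snd c)"
      using homeomorphism_cont1[OF chart_homeomorphism[OF c]] by (rule continuous_on_subset) blast
    ultimately have "continuous_on (fst c \<inter> W) (\<lambda>x. f (chart_inv c (snd c x)))"
      by (rule continuous_on_compose2) simp
    then show ?thesis
      by (rule continuous_on_eq) (use chart_inv_chart[OF c] in auto)
  qed
  then have "continuous_on (\<Union>c\<in>charts M. fst c \<inter> W) f"
    using chart_open assms(1) by (intro continuous_on_open_UN) auto
  moreover have "(\<Union>c\<in>charts M. fst c \<inter> W) = W" using chart_cover by blast
  ultimately show ?thesis by simp
qed

lemma smooth_near_imp_isCont: "smooth_near (charts M) x f \<Longrightarrow> isCont f x"
  unfolding smooth_near_def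
  using smooth_fun_imp_continuous_on continuous_on_eq_continuous_at by blast

lemma smooth_near_bounded_linear:
  "bounded_linear h \<Longrightarrow> smooth_near (charts M) x f \<Longrightarrow> smooth_near (charts M) x (\<lambda>y. h (f y))"
  unfolding smooth_near_def using smooth_fun_bounded_linear by blast

lemma smooth_near_cong:
  assumes "smooth_near (charts M) x f" "open W" "x \<in> W" "\<And>y. y \<in> W \<Longrightarrow> f y = g y"
  shows "smooth_near (charts M) x g"
proof -
  obtain W' where W': "open W'" "x \<in> W'" "smooth_fun (charts M) W' f"
    using assms(1) unfolding smooth_near_def by blast
  have "smooth_fun (charts M) (W \<inter> W') g"
    using assms(2,4) W' by (intro smooth_fun_cong[OF _ smooth_fun_subset[OF W'(3)]]) auto
  then show ?thesis unfolding smooth_near_def using assms(2,3) W' by blast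
qed

lemma smooth_near_has_derivative:
  assumes "smooth_near (charts M) x f" "c \<in> charts M" "x \<in> fst c"
  shows "((f \<circ> chart_inv c) has_derivative frechet_derivative (f \<circ> chart_inv c) (at (snd c x))) (at (snd c x))"
proof -
  obtain W where W: "x \<in> W" "smooth_fun (charts M) W f"
    using assms(1) unfolding smooth_near_def by blast
  have "smooth_on (snd c ` (fst c \<inter> W)) (f \<circ> chart_inv c)"
    using W(2) assms(2) unfolding smooth_fun_def by blast
  then have "(f \<circ> chart_inv c) differentiable (at (snd c x))"
    by (rule smooth_on_imp_differentiable) (use W assms(3) in blast)
  then show ?thesis by (simp add: frechet_derivative_works)
qed

text \<open>Tangent vectors return 0 on functions that are not smooth near the point, so the real
  and imaginary parts have to be known to be smooth before they are differentiated.\<close>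

lemma deriv_complex_coord_vec:
  assumes f: "smooth_near (charts M) x f" and c: "c \<in> charts M" "x \<in> fst c"
  shows "deriv_complex (coord_vec (charts M) c x a) f = frechet_derivative (f \<circ> chart_inv c) (at (snd c x)) a"
proof -
  note d = smooth_near_has_derivative[OF f c]
  have "frechet_derivative ((\<lambda>y. Re (f y)) \<circ> chart_inv c) (at (snd c x)) a
      = Re (frechet_derivative (f \<circ> chart_inv c) (at (snd c x)) a)"
    using frechet_derivative_at[OF has_derivative_Re[OF d]] by (simp add: comp_def fun_eq_iff)
  moreover have "frechet_derivative ((\<lambda>y. Im (f y)) \<circ> chart_inv c) (at (snd c x)) a
      = Im (frechet_derivative (f \<circ> chart_inv c) (at (snd c x)) a)"
    using frechet_derivative_at[OF has_derivative_Im[OF d]] by (simp add: comp_def fun_eq_iff)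
  moreover have "smooth_near (charts M) x (\<lambda>y. Re (f y))" "smooth_near (charts M) x (\<lambda>y. Im (f y))"
    using smooth_near_bounded_linear[OF bounded_linear_Re f] smooth_near_bounded_linear[OF bounded_linear_Im f] by auto
  ultimately show ?thesis by (simp add: deriv_complex_def coord_vec_def)
qed

lemma tangent_spaceE:
  assumes "v \<in> tangent_space (charts M) x"
  obtains c a where "c \<in> charts M" "x \<in> fst c" "v = coord_vec (charts M) c x a"
  using assms unfolding tangent_space_def by blast

lemma coord_vec_tangent: "c \<in> charts M \<Longrightarrow> x \<in> fst c \<Longrightarrow> coord_vec (charts M) c x a \<in> tangent_space (charts M) x"
  unfolding tangent_space_def by blast

lemma cplx_coord_vec:
  "c \<in> charts M \<Longrightarrow> x \<in> fst c \<Longrightarrow> cplx M x (coord_vec (charts M) c x a) = coord_vec (charts M) c x (\<i> *s a)"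
  using kaehler unfolding kaehler_manifold_def by blast

lemma coord_vec_minus:
  assumes "c \<in> charts M" "x \<in> fst c"
  shows "coord_vec (charts M) c x (- a) = (\<lambda>f. - coord_vec (charts M) c x a f)"
proof
  fix f :: "'m \<Rightarrow> real"
  show "coord_vec (charts M) c x (- a) f = - coord_vec (charts M) c x a f"
    using linear_neg[OF has_derivative_linear[OF smooth_near_has_derivative[OF _ assms]], of f a]
    by (auto simp: coord_vec_def)
qed

lemma eigenspace_coord_vec:
  assumes "c \<in> charts M" "x \<in> fst c"
  shows "(coord_vec (charts M) c x a, coord_vec (charts M) c x (\<i> *s a)) \<in> minus_i_eigenspace M x"
  unfolding minus_i_eigenspace_def
  using assms by (simp add: cplx_coord_vec coord_vec_tangent vector_smult_assoc flip: coord_vec_minus)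

text \<open>The second component is forced to be \<open>I v\<close>. In a chart,
  \<open>v + i I v\<close> is twice an antiholomorphic derivative, so holomorphy becomes the
  Cauchy-Riemann equations.\<close>

lemma eigenspaceE:
  assumes "(v, w) \<in> minus_i_eigenspace M x"
  obtains c a where "c \<in> charts M" "x \<in> fst c" "v = coord_vec (charts M) c x a" "w = coord_vec (charts M) c x (\<i> *s a)"
proof -
  have v: "v \<in> tangent_space (charts M) x" "cplx M x v = w"
    using assms unfolding minus_i_eigenspace_def by auto
  obtain c a where c: "c \<in> charts M" "x \<in> fst c" "v = coord_vec (charts M) c x a"
    using tangent_spaceE[OF v(1)] .
  moreover have "w = coord_vec (charts M) c x (\<i> *s a)"
    using cplx_coord_vec[OF c(1,2)] c(3) v(2) by simp
  ultimately show thesis by (rule that)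
qed

section \<open>Fibres, frames and the Hermitian metric\<close>

lemma frame_facts:
  assumes "(U, e) \<in> frames L"
  shows "open U" "smooth_section M L U e" "y \<in> U \<Longrightarrow> e y \<in> fibre L y" "y \<in> U \<Longrightarrow> e y \<noteq> 0"
    "smooth_fun (charts M) U (\<lambda>x. herm L x (e x) (e x))"
proof -
  have 1: "\<forall>(U, e)\<in>frames L. open U \<and> (\<forall>x\<in>U. e x \<in> fibre L x \<and> e x \<noteq> 0)"
    and 2: "\<forall>(U, e)\<in>frames L. smooth_section M L U e"
    using line_bundle unfolding complex_line_bundle_def by simp_all
  have 3: "\<forall>(U, e)\<in>frames L. smooth_fun (charts M) U (\<lambda>x. herm L x (e x) (e x))"
    using metric unfolding hermitian_metric_def by simp
  show "open U" "y \<in> U \<Longrightarrow> e y \<in> fibre L y" "y \<in> U \<Longrightarrow> e y \<noteq> 0" using bspec[OF 1 assms] by simp_all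
  show "smooth_section M L U e" using bspec[OF 2 assms] by simp
  show "smooth_fun (charts M) U (\<lambda>x. herm L x (e x) (e x))" using bspec[OF 3 assms] by simp
qed

lemma frame_ex: "\<exists>U e. (U, e) \<in> frames L \<and> x \<in> U"
proof -
  have "x \<in> (\<Union>(U, e)\<in>frames L. U)" using line_bundle unfolding complex_line_bundle_def by simp
  then show ?thesis by blast
qed

lemma fibre_subspace: "fib.subspace (fibre L x)"
  using line_bundle unfolding complex_line_bundle_def by blast

lemma scl_fibre: "l \<in> fibre L x \<Longrightarrow> scl L a l \<in> fibre L x"
  using fib.subspace_scale[OF fibre_subspace] .

lemma fibre_spanned:
  assumes "u \<in> fibre L x" "u \<noteq> 0" "l \<in> fibre L x"
  shows "\<exists>t. l = scl L t u"
proof -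
  have "fib.dim (fibre L x) = 1" using line_bundle unfolding complex_line_bundle_def by blast
  then obtain B where B: "fibre L x \<subseteq> fib.span B" "card B = 1"
    using fib.basis_exists[of "fibre L x"] by metis
  then obtain w where "B = {w}" by (meson card_1_singletonE)
  then have "\<exists>t. l = scl L t w" "\<exists>t. u = scl L t w"
    using B(1) assms(1,3) by (auto simp: fib.span_singleton)
  then obtain r t where "l = scl L r w" "u = scl L t w" by blast
  moreover have "t \<noteq> 0" using assms(2) \<open>u = scl L t w\<close> by auto
  ultimately have "l = scl L (r / t) u" by simp
  then show ?thesis ..
qed

lemma herm_scl_right:
  assumes "l \<in> fibre L x" "m \<in> fibre L x"
  shows "herm L x l (scl L a m) = a * herm L x l m"
proof -
  have "herm L x l (scl L a m + scl L 0 m) = a * herm L x l m + 0 * herm L x l m"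
    using metric assms unfolding hermitian_metric_def by blast
  then show ?thesis by simp
qed

lemma herm_add_right:
  assumes "l \<in> fibre L x" "m \<in> fibre L x" "m' \<in> fibre L x"
  shows "herm L x l (m + m') = herm L x l m + herm L x l m'"
proof -
  have "herm L x l (scl L 1 m + scl L 1 m') = 1 * herm L x l m + 1 * herm L x l m'"
    using metric assms unfolding hermitian_metric_def by blast
  then show ?thesis by simp
qed

lemma herm_sym: "l \<in> fibre L x \<Longrightarrow> m \<in> fibre L x \<Longrightarrow> herm L x m l = cnj (herm L x l m)"
  using metric unfolding hermitian_metric_def by blast

lemma herm_scl_left:
  assumes "l \<in> fibre L x" "m \<in> fibre L x"
  shows "herm L x (scl L a l) m = cnj a * herm L x l m"
  using herm_sym[OF assms(2) scl_fibre[OF assms(1), of a]] herm_scl_right[OF assms(2,1), of a]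
    herm_sym[OF assms(2,1)] by simp

lemma herm_pos: "l \<in> fibre L x \<Longrightarrow> l \<noteq> 0 \<Longrightarrow> 0 < Re (herm L x l l)"
  using metric unfolding hermitian_metric_def by blast

lemma herm_self: "l \<in> fibre L x \<Longrightarrow> herm L x l l = of_real (Re (herm L x l l))"
  using herm_sym[of l x l] by (simp add: complex_eq_iff)

lemma herm_nonzero: "l \<in> fibre L x \<Longrightarrow> l \<noteq> 0 \<Longrightarrow> herm L x l l \<noteq> 0"
  using herm_pos by fastforce

lemma ratio_works:
  assumes "t y \<in> fibre L y" "t y \<noteq> 0" "s y \<in> fibre L y"
  shows "s y = scl L (ratio L s t y) (t y)"
proof -
  obtain a where a: "s y = scl L a (t y)" using fibre_spanned[OF assms] by blast
  then have "ratio L s t y = a"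
    unfolding ratio_def using herm_nonzero[OF assms(1,2)] by (simp add: herm_scl_right assms)
  then show ?thesis using a by simp
qed

lemma smooth_section_in_fibre:
  assumes "smooth_section M L W s" "x \<in> W"
  shows "s x \<in> fibre L x"
proof -
  obtain U e where e: "(U, e) \<in> frames L" "x \<in> U" "e x \<in> fibre L x"
    using frame_ex frame_facts by meson
  then obtain g :: "'m \<Rightarrow> complex" where "\<forall>y\<in>U \<inter> W. s y = scl L (g y) (e y)"
    using assms(1) unfolding smooth_section_def by fastforce
  then show ?thesis using e assms(2) scl_fibre by auto
qed

lemma smooth_section_near_in_fibre: "smooth_section_near M L x s \<Longrightarrow> s x \<in> fibre L x"
  unfolding smooth_section_near_def using smooth_section_in_fibre by blast

lemma frame_coefficient:
  assumes "smooth_section M L W s" "(U, e) \<in> frames L"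
  obtains g :: "'m \<Rightarrow> complex" where "smooth_fun (charts M) (U \<inter> W) g" "\<And>y. y \<in> U \<inter> W \<Longrightarrow> s y = scl L (g y) (e y)"
  using assms unfolding smooth_section_def by fastforce

lemma smooth_section_scl:
  assumes "open W" "smooth_fun (charts M) W f" "smooth_section M L W s"
  shows "smooth_section M L W (\<lambda>y. scl L (f y) (s y))"
  unfolding smooth_section_def
proof (safe)
  fix U e assume Ue: "(U, e) \<in> frames L"
  then obtain g where g: "smooth_fun (charts M) (U \<inter> W) g" "\<And>y. y \<in> U \<inter> W \<Longrightarrow> s y = scl L (g y) (e y)"
    using frame_coefficient[OF assms(3)] by blast
  have "smooth_fun (charts M) (U \<inter> W) (\<lambda>y. f y * g y)"
    using frame_facts(1)[OF Ue] assms(1) g(1) smooth_fun_subset[OF assms(2)] by (intro smooth_fun_mult) auto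
  moreover have "\<forall>y\<in>U \<inter> W. scl L (f y) (s y) = scl L (f y * g y) (e y)" using g(2) by simp
  ultimately show "\<exists>g. smooth_fun (charts M) (U \<inter> W) g \<and> (\<forall>y\<in>U \<inter> W. scl L (f y) (s y) = scl L (g y) (e y))"
    by blast
qed

lemma smooth_section_subset: "smooth_section M L W s \<Longrightarrow> W' \<subseteq> W \<Longrightarrow> smooth_section M L W' s"
  unfolding smooth_section_def
  by (fastforce intro: smooth_fun_subset)

lemma smooth_section_near_scl:
  assumes "smooth_near (charts M) x f" "smooth_section_near M L x s"
  shows "smooth_section_near M L x (\<lambda>y. scl L (f y) (s y))"
proof -
  obtain W W' where W: "open W" "x \<in> W" "smooth_fun (charts M) W f" "open W'" "x \<in> W'" "smooth_section M L W' s"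
    using assms unfolding smooth_near_def smooth_section_near_def by blast
  have "smooth_section M L (W \<inter> W') (\<lambda>y. scl L (f y) (s y))"
    using W by (intro smooth_section_scl) (auto intro: smooth_fun_subset smooth_section_subset)
  then show ?thesis unfolding smooth_section_near_def using W by blast
qed

lemma smooth_section_near_cong:
  assumes "smooth_section_near M L x s" "open W" "x \<in> W" "\<And>y. y \<in> W \<Longrightarrow> s y = t y"
  shows "smooth_section_near M L x t"
proof -
  obtain W' where W: "open W'" "x \<in> W'" "smooth_section M L W' s"
    using assms(1) unfolding smooth_section_near_def by blast
  have "smooth_section M L (W \<inter> W') t"
    unfolding smooth_section_def
  proof safe
    fix U e assume "(U, e) \<in> frames L"
    then obtain g :: "'m \<Rightarrow> complex" where g: "smooth_fun (charts M) (U \<inter> W') g" "\<And>y. y \<in> U \<inter> W' \<Longrightarrow> s y = scl L (g y) (e y)"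
      using frame_coefficient[OF W(3)] by blast
    then have "smooth_fun (charts M) (U \<inter> (W \<inter> W')) g" by (auto intro: smooth_fun_subset)
    then show "\<exists>g. smooth_fun (charts M) (U \<inter> (W \<inter> W')) g \<and> (\<forall>y\<in>U \<inter> (W \<inter> W'). t y = scl L (g y) (e y))"
      using g(2) assms(4) by (metis IntD1 IntD2 IntI)
  qed
  then show ?thesis unfolding smooth_section_near_def using assms(2,3) W by blast
qed

text \<open>One frame serves both sections, so that their pairings and quotients reduce to those of
  the coefficients.\<close>

lemma local_coefficient:
  assumes "smooth_section_near M L x s" "smooth_section_near M L x t"
  shows "\<exists>W e (g :: 'm \<Rightarrow> complex) (h :: 'm \<Rightarrow> complex). open W \<and> x \<in> W \<and>
    smooth_fun (charts M) W g \<and> smooth_fun (charts M) W h \<and>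
    (\<forall>y\<in>W. s y = scl L (g y) (e y) \<and> t y = scl L (h y) (e y) \<and> e y \<in> fibre L y \<and> e y \<noteq> 0) \<and>
    smooth_fun (charts M) W (\<lambda>x. herm L x (e x) (e x))"
proof -
  obtain W1 W2 where W: "open W1" "x \<in> W1" "smooth_section M L W1 s" "open W2" "x \<in> W2" "smooth_section M L W2 t"
    using assms unfolding smooth_section_near_def by blast
  obtain U e where e: "(U, e) \<in> frames L" "x \<in> U" "open U" "\<And>y. y \<in> U \<Longrightarrow> e y \<in> fibre L y" "\<And>y. y \<in> U \<Longrightarrow> e y \<noteq> 0"
    "smooth_fun (charts M) U (\<lambda>x. herm L x (e x) (e x))"
    using frame_ex[of x] frame_facts by metis
  obtain g where g: "smooth_fun (charts M) (U \<inter> W1) g" "\<And>y. y \<in> U \<inter> W1 \<Longrightarrow> s y = scl L (g y) (e y)"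
    using frame_coefficient[OF W(3) e(1)] by blast
  obtain h where h: "smooth_fun (charts M) (U \<inter> W2) h" "\<And>y. y \<in> U \<inter> W2 \<Longrightarrow> t y = scl L (h y) (e y)"
    using frame_coefficient[OF W(6) e(1)] by blast
  have "smooth_fun (charts M) (U \<inter> W1 \<inter> W2) g" "smooth_fun (charts M) (U \<inter> W1 \<inter> W2) h"
    "smooth_fun (charts M) (U \<inter> W1 \<inter> W2) (\<lambda>x. herm L x (e x) (e x))"
    by (rule smooth_fun_subset[OF g(1)] smooth_fun_subset[OF h(1)] smooth_fun_subset[OF e(6)], blast)+
  then show ?thesis
    using W e g(2) h(2) by (intro exI[of _ "U \<inter> W1 \<inter> W2"] exI[of _ e] exI[of _ g] exI[of _ h]) auto
qed

lemma smooth_near_herm: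
  assumes "smooth_section_near M L x s" "smooth_section_near M L x t"
  shows "smooth_near (charts M) x (\<lambda>y. herm L y (s y) (t y))"
proof -
  obtain W e g h where W: "open W" "x \<in> W" "smooth_fun (charts M) W g" "smooth_fun (charts M) W h"
    "\<And>y. y \<in> W \<Longrightarrow> s y = scl L (g y) (e y) \<and> t y = scl L (h y) (e y) \<and> e y \<in> fibre L y \<and> e y \<noteq> 0"
    "smooth_fun (charts M) W (\<lambda>x. herm L x (e x) (e x))"
    using local_coefficient[OF assms] by blast
  have "smooth_fun (charts M) W (\<lambda>y. cnj (g y) * (h y * herm L y (e y) (e y)))"
    by (rule smooth_fun_mult[OF W(1) smooth_fun_bounded_linear[OF W(1) bounded_linear_cnj W(3)]
          smooth_fun_mult[OF W(1) W(4) W(6)]])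
  then have "smooth_fun (charts M) W (\<lambda>y. herm L y (s y) (t y))"
    by (rule smooth_fun_cong[OF W(1)]) (use W(5) in \<open>simp add: herm_scl_left herm_scl_right scl_fibre\<close>)
  then show ?thesis unfolding smooth_near_def using W by blast
qed

lemma isCont_herm:
  assumes "smooth_section_near M L x s" "smooth_section_near M L x t"
  shows "isCont (\<lambda>y. herm L y (s y) (t y)) x"
  by (rule smooth_near_imp_isCont[OF smooth_near_herm[OF assms]])

lemma smooth_near_ratio:
  assumes "smooth_section_near M L x s" "smooth_section_near M L x t" "t x \<noteq> 0"
  shows "smooth_near (charts M) x (ratio L s t)"
    and "\<exists>W. open W \<and> x \<in> W \<and> (\<forall>y\<in>W. t y \<noteq> 0 \<and> s y = scl L (ratio L s t y) (t y))"
proof -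
  obtain W0 e g h where W0: "open W0" "x \<in> W0" "smooth_fun (charts M) W0 g" "smooth_fun (charts M) W0 h"
    "\<And>y. y \<in> W0 \<Longrightarrow> s y = scl L (g y) (e y) \<and> t y = scl L (h y) (e y) \<and> e y \<in> fibre L y \<and> e y \<noteq> 0"
    using local_coefficient[OF assms(1,2)] by blast
  define W where "W = {y \<in> W0. h y \<noteq> 0}"
  have "W = W0 \<inter> h -` (- {0})" unfolding W_def by auto
  then have W: "open W"
    using continuous_open_preimage[OF smooth_fun_imp_continuous_on[OF W0(1,4)] W0(1), of "- {0}"] by (simp add: open_Compl)
  have x: "x \<in> W" unfolding W_def using W0(2) W0(5)[OF W0(2)] assms(3) by auto
  have sub: "W \<subseteq> W0" unfolding W_def by auto
  have *: "t y \<in> fibre L y \<and> t y \<noteq> 0 \<and> s y \<in> fibre L y" if "y \<in> W" for y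
    using W0(5)[of y] that scl_fibre unfolding W_def by auto
  have eq: "s y = scl L (ratio L s t y) (t y)" if "y \<in> W" for y
    using *[OF that] ratio_works by blast
  have "smooth_fun (charts M) W (\<lambda>y. g y * inverse (h y))"
    by (intro smooth_fun_mult smooth_fun_inverse smooth_fun_subset[OF W0(3) sub] smooth_fun_subset[OF W0(4) sub] W)
      (auto simp: W_def)
  then have "smooth_fun (charts M) W (ratio L s t)"
  proof (rule smooth_fun_cong[OF W])
    fix y assume y: "y \<in> W"
    then have y0: "y \<in> W0" "h y \<noteq> 0" unfolding W_def by auto
    show "g y * inverse (h y) = ratio L s t y"
      unfolding ratio_def using W0(5)[OF y0(1)] y0(2) herm_nonzero[of "e y" y]
      by (simp add: herm_scl_left herm_scl_right scl_fibre field_simps)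
  qed
  then show "smooth_near (charts M) x (ratio L s t)" unfolding smooth_near_def using W x by blast
  show "\<exists>W. open W \<and> x \<in> W \<and> (\<forall>y\<in>W. t y \<noteq> 0 \<and> s y = scl L (ratio L s t y) (t y))"
    using W x eq * by blast
qed

section \<open>Locality of the connection and germs of holomorphic sections\<close>

lemma conn_in_fibre:
  assumes "smooth_section_near M L x s" "v \<in> tangent_space (charts M) x"
  shows "conn L x v s \<in> fibre L x"
  using conn[unfolded connection_def, THEN conjunct1, rule_format, OF assms(1)] assms(2) by blast

lemma conn_scl:
  assumes "smooth_section_near M L x s" "smooth_near (charts M) x f" "v \<in> tangent_space (charts M) x"
  shows "conn L x v (\<lambda>y. scl L (f y) (s y)) = scl L (deriv_complex v f) (s x) + scl L (f x) (conn L x v s)"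
  using conn[unfolded connection_def, THEN conjunct2, THEN conjunct2, THEN conjunct1, rule_format, OF assms] .

text \<open>Serves for the indicator function of a neighbourhood, which is smooth near the point
  although it may jump elsewhere.\<close>

lemma deriv_complex_locally_const:
  assumes "v \<in> tangent_space (charts M) x" "open W" "x \<in> W" "\<And>y. y \<in> W \<Longrightarrow> f y = c"
  shows "smooth_near (charts M) x f" "deriv_complex v f = 0"
proof -
  show f: "smooth_near (charts M) x f"
    using assms smooth_fun_cong[OF assms(2) smooth_fun_const[of W c], of f]
    unfolding smooth_near_def by auto
  obtain d a where d: "d \<in> charts M" "x \<in> fst d" "v = coord_vec (charts M) d x a"
    using tangent_spaceE[OF assms(1)] .
  have "((\<lambda>p. c) has_derivative (\<lambda>h. 0)) (at (snd d x))" by simp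
  then have "((f \<circ> chart_inv d) has_derivative (\<lambda>h. 0)) (at (snd d x))"
    by (rule has_derivative_transform_within_open[OF _ open_chart_image[OF d(1) assms(2)]])
      (use assms(3,4) d chart_inv_chart[OF d(1)] in auto)
  from frechet_derivative_at[OF this] show "deriv_complex v f = 0"
    unfolding d(3) deriv_complex_coord_vec[OF f d(1,2)] by metis
qed

text \<open>The connection acts on global functions; multiplying by the indicator function of a
  neighbourhood shows that it is nevertheless local.\<close>

lemma conn_cong:
  assumes "smooth_section_near M L x s" "v \<in> tangent_space (charts M) x"
    and "open W" "x \<in> W" "\<And>y. y \<in> W \<Longrightarrow> s y = t y"
  shows "conn L x v s = conn L x v t"
proof -
  define ind :: "'m \<Rightarrow> complex" where "ind y = (if y \<in> W then 1 else 0)" for y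
  have ind: "smooth_near (charts M) x ind" "deriv_complex v ind = 0" "ind x = 1"
    using deriv_complex_locally_const[OF assms(2-4), of ind 1] assms(4) unfolding ind_def by auto
  have "conn L x v r = conn L x v (\<lambda>y. scl L (ind y) (r y))" if "smooth_section_near M L x r" for r
    using conn_scl[OF that ind(1) assms(2)] ind(2,3) by simp
  moreover have "(\<lambda>y. scl L (ind y) (s y)) = (\<lambda>y. scl L (ind y) (t y))"
    unfolding ind_def using assms(5) by auto
  ultimately show ?thesis
    using assms(1) smooth_section_near_cong[OF assms(1,3-5)] by metis
qed

lemma conn_zero:
  assumes "v \<in> tangent_space (charts M) x"
  shows "smooth_section_near M L x (\<lambda>_. 0)" "conn L x v (\<lambda>_. 0) = 0"
proof -
  obtain U e where "x \<in> U" "open U" "smooth_section M L U e"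
    using frame_ex[of x] frame_facts(1,2) by blast
  then have e: "smooth_section_near M L x e" unfolding smooth_section_near_def by blast
  have 0: "smooth_near (charts M) x (\<lambda>_. 0 :: complex)" "deriv_complex v (\<lambda>_. 0) = 0"
    using deriv_complex_locally_const[OF assms, of UNIV "\<lambda>_. 0" 0] by auto
  show "smooth_section_near M L x (\<lambda>_. 0)" using smooth_section_near_scl[OF 0(1) e] by simp
  show "conn L x v (\<lambda>_. 0) = 0" using conn_scl[OF e 0(1) assms] 0(2) by simp
qed

lemma holomorphic_at_cong:
  assumes "smooth_section_near M L x s" "open W" "x \<in> W" "\<And>y. y \<in> W \<Longrightarrow> s y = t y"
  shows "holomorphic_at M L s x \<longleftrightarrow> holomorphic_at M L t x"
proof -
  have "conn L x v s = conn L x v t" if "v \<in> tangent_space (charts M) x" for v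
    by (rule conn_cong[OF assms(1) that assms(2-4)])
  moreover have "v \<in> tangent_space (charts M) x" "w \<in> tangent_space (charts M) x"
    if "(v, w) \<in> minus_i_eigenspace M x" for v w
    using that unfolding minus_i_eigenspace_def by auto
  ultimately show ?thesis unfolding holomorphic_at_def by auto
qed

text \<open>Leibniz rule: for holomorphic \<open>s\<close>, the antiholomorphic derivative of
  \<open>f s\<close> is that of \<open>f\<close> times \<open>s\<close>. Since \<open>s x\<close> is
  not 0, it vanishes exactly when that of \<open>f\<close> does.\<close>

lemma holomorphic_at_scl_iff:
  assumes s: "smooth_section_near M L x s" "holomorphic_at M L s x" "s x \<noteq> 0"
    and f: "smooth_near (charts M) x f"
  shows "holomorphic_at M L (\<lambda>y. scl L (f y) (s y)) x \<longleftrightarrow> cauchy_riemann_at M f x"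
proof -
  let ?D = "\<lambda>c. frechet_derivative (f \<circ> chart_inv c) (at (snd c x))"
  let ?t = "\<lambda>y. scl L (f y) (s y)"
  have key: "conn L x (coord_vec (charts M) c x a) ?t + scl L \<i> (conn L x (coord_vec (charts M) c x (\<i> *s a)) ?t)
      = scl L (?D c a + \<i> * ?D c (\<i> *s a)) (s x)" if c: "c \<in> charts M" "x \<in> fst c" for c a
  proof -
    let ?v = "coord_vec (charts M) c x a" and ?w = "coord_vec (charts M) c x (\<i> *s a)"
    have "conn L x ?v s + scl L \<i> (conn L x ?w s) = 0"
      using s(2) eigenspace_coord_vec[OF c] unfolding holomorphic_at_def by auto
    then have "scl L (f x) (conn L x ?v s) + scl L \<i> (scl L (f x) (conn L x ?w s)) = 0"
      by (metis fib.scale_left_commute fib.scale_right_distrib fib.scale_zero_right)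
    then show ?thesis
      using conn_scl[OF s(1) f coord_vec_tangent[OF c, of a]] conn_scl[OF s(1) f coord_vec_tangent[OF c, of "\<i> *s a"]]
      by (simp add: deriv_complex_coord_vec[OF f c] fib.scale_right_distrib fib.scale_left_distrib add_ac)
  qed
  have eq: "p + \<i> * q = 0 \<longleftrightarrow> q = \<i> * p" for p q by (auto simp: complex_eq_iff)
  show ?thesis
  proof
    assume h: "holomorphic_at M L ?t x"
    show "cauchy_riemann_at M f x"
      unfolding cauchy_riemann_at_def
    proof (intro ballI impI allI)
      fix c a assume c: "c \<in> charts M" "x \<in> fst c"
      have "scl L (?D c a + \<i> * ?D c (\<i> *s a)) (s x) = 0"
        using h eigenspace_coord_vec[OF c, of a] unfolding holomorphic_at_def key[OF c, symmetric] by auto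
      then show "?D c (\<i> *s a) = \<i> * ?D c a" using s(3) eq by simp
    qed
  next
    assume cr: "cauchy_riemann_at M f x"
    show "holomorphic_at M L ?t x"
      unfolding holomorphic_at_def
    proof (safe)
      fix v w assume "(v, w) \<in> minus_i_eigenspace M x"
      then obtain c a where c: "c \<in> charts M" "x \<in> fst c" "v = coord_vec (charts M) c x a" "w = coord_vec (charts M) c x (\<i> *s a)"
        using eigenspaceE by blast
      have "?D c a + \<i> * ?D c (\<i> *s a) = 0"
        using cr c(1,2) eq unfolding cauchy_riemann_at_def by blast
      then show "conn L x v ?t + scl L \<i> (conn L x w ?t) = 0"
        unfolding c(3,4) key[OF c(1,2)] by simp
    qed
  qed
qed

lemma cauchy_riemann_ratio:
  assumes "smooth_section_near M L x s" "holomorphic_at M L s x"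
    and "smooth_section_near M L x t" "holomorphic_at M L t x" "t x \<noteq> 0"
  shows "cauchy_riemann_at M (ratio L s t) x"
proof -
  obtain W where W: "open W" "x \<in> W" "\<And>y. y \<in> W \<Longrightarrow> s y = scl L (ratio L s t y) (t y)"
    using smooth_near_ratio(2)[OF assms(1,3,5)] by blast
  have "holomorphic_at M L (\<lambda>y. scl L (ratio L s t y) (t y)) x"
    using holomorphic_at_cong[OF assms(1) W] assms(2) by blast
  then show ?thesis
    using holomorphic_at_scl_iff[OF assms(3-5) smooth_near_ratio(1)[OF assms(1,3,5)]] by blast
qed

text \<open>A maximum of \<open>|s|\<^sup>2\<close> makes \<open>\<langle>s, \<nabla>\<^sub>v s\<rangle>\<close> purely imaginary for every real \<open>v\<close>; complex linearity of
  \<open>\<nabla>s\<close> then makes it vanish.\<close>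

lemma conn_zero_at_max:
  assumes s: "smooth_section_near M L x s" "holomorphic_at M L s x" "s x \<noteq> 0"
    and max: "\<And>y. Re (herm L y (s y) (s y)) \<le> Re (herm L x (s x) (s x))"
    and v: "v \<in> tangent_space (charts M) x"
  shows "conn L x v s = 0"
proof -
  have re: "Re (herm L x (s x) (conn L x w s)) = 0" if w: "w \<in> tangent_space (charts M) x" for w
  proof -
    let ?h = "\<lambda>y. herm L y (s y) (s y)"
    obtain c a where c: "c \<in> charts M" "x \<in> fst c" "w = coord_vec (charts M) c x a"
      using tangent_spaceE[OF w] .
    have h: "smooth_near (charts M) x ?h" by (rule smooth_near_herm[OF s(1) s(1)])
    note d = has_derivative_Re[OF smooth_near_has_derivative[OF h c(1,2)]]
    have "(\<lambda>v. Re (frechet_derivative (?h \<circ> chart_inv c) (at (snd c x)) v)) = (\<lambda>v. 0)"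
      by (rule differential_zero_maxmin[OF UNIV_I open_UNIV d])
        (use max chart_inv_chart[OF c(1,2)] in auto)
    then have "Re (deriv_complex w ?h) = 0"
      unfolding c(3) deriv_complex_coord_vec[OF h c(1,2)] by metis
    moreover have "deriv_complex w ?h = herm L x (conn L x w s) (s x) + herm L x (s x) (conn L x w s)"
      using herm_conn s(1) w unfolding hermitian_connection_def by blast
    moreover have "herm L x (conn L x w s) (s x) = cnj (herm L x (s x) (conn L x w s))"
      by (rule herm_sym[OF smooth_section_near_in_fibre[OF s(1)] conn_in_fibre[OF s(1) w]])
    ultimately show ?thesis by simp
  qed
  obtain c a where c: "c \<in> charts M" "x \<in> fst c" "v = coord_vec (charts M) c x a"
    using tangent_spaceE[OF v] .
  let ?w = "coord_vec (charts M) c x (\<i> *s a)"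
  have w: "?w \<in> tangent_space (charts M) x" by (rule coord_vec_tangent[OF c(1,2)])
  have eq: "conn L x v s + scl L \<i> (conn L x ?w s) = 0"
    using s(2) eigenspace_coord_vec[OF c(1,2), of a] unfolding holomorphic_at_def c(3) by auto
  have F: "s x \<in> fibre L x" "conn L x v s \<in> fibre L x" "conn L x ?w s \<in> fibre L x"
    using smooth_section_near_in_fibre conn_in_fibre s(1) v w by auto
  have "conn L x v s = scl L (- \<i>) (conn L x ?w s)"
    using eq by (simp add: eq_neg_iff_add_eq_0)
  then have "herm L x (s x) (conn L x v s) = - \<i> * herm L x (s x) (conn L x ?w s)"
    using herm_scl_right[OF F(1,3), of "- \<i>"] by simp
  then have "Im (herm L x (s x) (conn L x v s)) = 0" using re[OF w] by simp
  then have 0: "herm L x (s x) (conn L x v s) = 0" using re[OF v] by (simp add: complex_eq_iff)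
  obtain t where t: "conn L x v s = scl L t (s x)" using fibre_spanned[OF F(1) s(3) F(2)] by blast
  then have "t * herm L x (s x) (s x) = 0" using 0 herm_scl_right[OF F(1) F(1)] by simp
  then show ?thesis using t herm_nonzero[OF F(1) s(3)] by simp
qed

end

section \<open>The Bergman kernel in a measurable unitary frame\<close>

context prequantum_bundle
begin

text \<open>A global smooth frame need not exist. By second countability, countably many of the
  frame domains cover the manifold; the normalised frames are glued along Borel pieces, and
  measurable coordinates are all that the integrals need.\<close>

lemma measurable_unit_section:
  "\<exists>u. (\<forall>x. u x \<in> fibre L x \<and> herm L x (u x) (u x) = 1) \<and>
     (\<forall>s. measurable_section L s \<longrightarrow> (\<lambda>x. herm L x (u x) (s x)) \<in> borel_measurable borel)"
proof -
  have op: "open S" if "S \<in> fst ` frames L" for S using that frame_facts(1) by auto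
  obtain \<U> where \<U>: "\<U> \<subseteq> fst ` frames L" "countable \<U>" "\<Union>\<U> = \<Union>(fst ` frames L)"
    using Lindelof[of "fst ` frames L", OF op] .
  have cov: "\<Union>\<U> = UNIV"
  proof -
    have "x \<in> \<Union>(fst ` frames L)" for x
    proof -
      obtain U e where "(U, e) \<in> frames L" "x \<in> U" using frame_ex by blast
      then show ?thesis by (metis UN_I fst_conv)
    qed
    then show ?thesis unfolding \<U>(3) by blast
  qed
  then have ne: "\<U> \<noteq> {}" by auto
  define U where "U = from_nat_into \<U>"
  have U: "range U = \<U>" unfolding U_def by (rule range_from_nat_into[OF ne \<U>(2)])
  have "\<exists>e. (U n, e) \<in> frames L" for n
  proof -
    have "U n \<in> fst ` frames L" using \<U>(1) U by blast
    then show ?thesis by auto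
  qed
  then obtain e where e: "\<And>n. (U n, e n) \<in> frames L" by metis
  \<comment> \<open>The index of the first set of the enumeration that contains \<open>x\<close>;
    its level sets are disjoint and Borel.\<close>
  define k where "k x = (LEAST n. x \<in> U n)" for x
  have k: "x \<in> U (k x)" for x
    unfolding k_def by (rule LeastI_ex) (use cov U in blast)
  define r where "r n x = 1 / sqrt (Re (herm L x (e n x) (e n x)))" for n x
  define u where "u x = scl L (of_real (r (k x) x)) (e (k x) x)" for x
  have ex: "e (k x) x \<in> fibre L x" "e (k x) x \<noteq> 0" for x
    using frame_facts(3,4)[OF e k] by auto
  have "herm L x (u x) (u x) = 1" for x
  proof -
    let ?h = "Re (herm L x (e (k x) x) (e (k x) x))"
    have "?h > 0" by (rule herm_pos[OF ex])
    then have "r (k x) x * (r (k x) x * ?h) = 1" unfolding r_def by (simp add: field_simps)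
    then have "complex_of_real (r (k x) x * (r (k x) x * ?h)) = 1" by simp
    then show ?thesis
      unfolding u_def herm_scl_left[OF ex(1) scl_fibre[OF ex(1)]] herm_scl_right[OF ex(1) ex(1)]
      using herm_self[OF ex(1)] by (metis complex_cnj_complex_of_real of_real_mult)
  qed
  moreover have "u x \<in> fibre L x" for x unfolding u_def by (rule scl_fibre[OF ex(1)])
  moreover have "(\<lambda>x. herm L x (u x) (s x)) \<in> borel_measurable borel" if s: "measurable_section L s" for s
  proof (rule measurable_piecewise_restrict)
    let ?D = "\<lambda>n. {x. k x = n}"
    have D: "?D n = U n - (\<Union>m<n. U m)" for n
    proof (rule set_eqI, rule iffI)
      fix x assume "x \<in> ?D n"
      then have kx: "k x = n" by simp
      have "x \<notin> U m" if "m < n" for m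
        using not_less_Least[of m "\<lambda>n. x \<in> U n"] that kx unfolding k_def by blast
      then show "x \<in> U n - (\<Union>m<n. U m)" using k[of x] kx by auto
    next
      fix x assume "x \<in> U n - (\<Union>m<n. U m)"
      then have "k x = n" unfolding k_def by (intro Least_equality) (auto intro: leI)
      then show "x \<in> ?D n" by simp
    qed
    show "countable (range ?D)" by simp
    show "\<Omega> \<inter> space borel \<in> sets borel" if "\<Omega> \<in> range ?D" for \<Omega>
      using that frame_facts(1)[OF e] by (auto simp: D intro!: sets.Diff sets.countable_UN')
    show "space borel \<subseteq> \<Union>(range ?D)" by auto
    show "(\<lambda>x. herm L x (u x) (s x)) \<in> borel_measurable (restrict_space borel \<Omega>)" if \<Omega>: "\<Omega> \<in> range ?D" for \<Omega>
    proof -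
      obtain n where n: "\<Omega> = ?D n" using \<Omega> by blast
      have sub: "?D n \<subseteq> U n" unfolding D by auto
      have "(\<lambda>x. herm L x (e n x) (s x)) \<in> borel_measurable (restrict_space borel (U n))"
        using s e unfolding measurable_section_def by fastforce
      moreover have "(\<lambda>x. complex_of_real (r n x)) \<in> borel_measurable (restrict_space borel (U n))"
      proof (rule borel_measurable_continuous_on_restrict)
        have "Re (herm L x (e n x) (e n x)) \<noteq> 0" if "x \<in> U n" for x
          using herm_pos[OF frame_facts(3,4)[OF e that]] by simp
        then show "continuous_on (U n) (\<lambda>x. complex_of_real (r n x))"
          unfolding r_def
          by (intro continuous_intros smooth_fun_imp_continuous_on frame_facts[OF e]) auto
      qed
      ultimately have "(\<lambda>x. complex_of_real (r n x) * herm L x (e n x) (s x)) \<in> borel_measurable (restrict_space borel (U n))"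
        by (rule borel_measurable_times[rotated])
      then have "(\<lambda>x. complex_of_real (r n x) * herm L x (e n x) (s x)) \<in> borel_measurable (restrict_space borel \<Omega>)"
        unfolding n by (rule measurable_restrict_mono[OF _ sub])
      moreover have "herm L x (u x) (s x) = complex_of_real (r n x) * herm L x (e n x) (s x)" if "x \<in> \<Omega>" for x
      proof -
        have kx: "k x = n" using that n by simp
        have "s x \<in> fibre L x" using s unfolding measurable_section_def by blast
        then show ?thesis using herm_scl_left[OF ex(1), of "s x" x] unfolding u_def kx
          using kx by (metis complex_cnj_complex_of_real)
      qed
      ultimately show ?thesis
        by (subst measurable_cong) (auto simp: space_restrict_space)
    qed
  qed
  ultimately show ?thesis by blast
qed

end

locale bergman_setup = prequantum_bundle M L hbar
  for M :: "('m::{t2_space, second_countable_topology}, 'n::finite) kaehler_data"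
    and L :: "('m, 'e::ab_group_add) line_bundle"
    and hbar :: real +
  fixes N :: "'m measure" and J :: "'i set" and \<Psi> :: "'i \<Rightarrow> 'm \<Rightarrow> 'e" and u :: "'m \<Rightarrow> 'e"
  assumes N_borel: "sets N = sets borel"
    and onb: "orthonormal_basis M L N J \<Psi>"
    and diag_pos: "0 < bergman_diag L J \<Psi> x"
    and u_fibre: "u x \<in> fibre L x"
    and u_unit: "herm L x (u x) (u x) = 1"
    and u_measurable: "measurable_section L s \<Longrightarrow> (\<lambda>x. herm L x (u x) (s x)) \<in> borel_measurable borel"
begin

definition coord :: "'m \<Rightarrow> 'e \<Rightarrow> complex" where
  "coord x l = herm L x (u x) l"

abbreviation b :: "'m \<Rightarrow> real" where
  "b x \<equiv> bergman_diag L J \<Psi> x"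

definition \<psi> :: "'i \<Rightarrow> 'm \<Rightarrow> complex" where
  "\<psi> \<alpha> x = coord x (\<Psi> \<alpha> x)"

lemma u_nonzero: "u x \<noteq> 0"
proof
  assume "u x = 0"
  then have "herm L x (u x) (scl L 0 (u x)) = 1" using u_unit[of x] by simp
  then show False using herm_scl_right[OF u_fibre u_fibre, of x 0] by simp
qed

lemma coord_scl_u [simp]: "coord x (scl L a (u x)) = a"
  unfolding coord_def by (simp add: herm_scl_right u_fibre u_unit)

lemma scl_coord: "l \<in> fibre L x \<Longrightarrow> scl L (coord x l) (u x) = l"
  using fibre_spanned[OF u_fibre u_nonzero] coord_scl_u by metis

lemma scl_u_fibre: "scl L a (u x) \<in> fibre L x"
  by (rule scl_fibre[OF u_fibre])

lemma herm_coord: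
  assumes "l \<in> fibre L x" "m \<in> fibre L x"
  shows "herm L x l m = cnj (coord x l) * coord x m"
proof -
  have "herm L x (scl L (coord x l) (u x)) m = cnj (coord x l) * coord x m"
    unfolding coord_def by (rule herm_scl_left[OF u_fibre assms(2)])
  then show ?thesis by (simp add: scl_coord assms(1))
qed

lemma herm_scl_u: "l \<in> fibre L x \<Longrightarrow> herm L x l (scl L a (u x)) = cnj (coord x l) * a"
  by (simp add: herm_coord scl_u_fibre)

lemma norm_sq_coord: "s x \<in> fibre L x \<Longrightarrow> norm_sq L s x = (cmod (coord x (s x)))\<^sup>2"
  unfolding norm_sq_def cmod_power2 by (simp add: herm_coord power2_eq_square)

lemma \<Psi>_smooth_section: "\<alpha> \<in> J \<Longrightarrow> smooth_section M L UNIV (\<Psi> \<alpha>)"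
  and \<Psi>_holomorphic_at: "\<alpha> \<in> J \<Longrightarrow> holomorphic_at M L (\<Psi> \<alpha>) x"
  and \<Psi>_square_integrable: "\<alpha> \<in> J \<Longrightarrow> square_integrable L N (\<Psi> \<alpha>)"
  using onb
  unfolding orthonormal_basis_def holomorphic_L2_def holomorphic_section_def holomorphic_at_def by blast+

lemma \<Psi>_smooth: "\<alpha> \<in> J \<Longrightarrow> smooth_section_near M L x (\<Psi> \<alpha>)"
  unfolding smooth_section_near_def using \<Psi>_smooth_section by blast

lemma \<Psi>_fibre: "\<alpha> \<in> J \<Longrightarrow> \<Psi> \<alpha> x \<in> fibre L x"
  by (rule smooth_section_near_in_fibre[OF \<Psi>_smooth])

lemma \<Psi>_coord: "\<alpha> \<in> J \<Longrightarrow> \<Psi> \<alpha> x = scl L (\<psi> \<alpha> x) (u x)"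
  unfolding \<psi>_def by (simp add: scl_coord \<Psi>_fibre)

lemma square_integrable_coord:
  assumes "square_integrable L N s"
  shows "L2_fun N (\<lambda>x. coord x (s x))" "L2_sq N (\<lambda>x. coord x (s x)) = integral\<^sup>L N (norm_sq L s)"
proof -
  have s: "measurable_section L s" "integrable N (norm_sq L s)"
    using assms unfolding square_integrable_def by auto
  have f: "s x \<in> fibre L x" for x using s(1) unfolding measurable_section_def by blast
  have "(\<lambda>x. coord x (s x)) \<in> borel_measurable N"
    using u_measurable[OF s(1)] measurable_cong_sets[OF N_borel refl] unfolding coord_def by blast
  moreover have eq: "norm_sq L s = (\<lambda>x. (cmod (coord x (s x)))\<^sup>2)"
    by (rule ext) (rule norm_sq_coord[of s, OF f])
  ultimately show "L2_fun N (\<lambda>x. coord x (s x))" using s(2) unfolding L2_fun_def by simp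
  show "L2_sq N (\<lambda>x. coord x (s x)) = integral\<^sup>L N (norm_sq L s)" unfolding L2_sq_def eq by simp
qed

lemma norm_sq_\<Psi>: "\<alpha> \<in> J \<Longrightarrow> norm_sq L (\<Psi> \<alpha>) x = (cmod (\<psi> \<alpha> x))\<^sup>2"
  unfolding \<psi>_def by (rule norm_sq_coord[of "\<Psi> \<alpha>", OF \<Psi>_fibre])

lemma sq_sum_\<psi>: "sq_sum J (\<lambda>\<alpha>. \<psi> \<alpha> x) = b x"
  unfolding sq_sum_def bergman_diag_def by (rule infsum_cong) (simp add: norm_sq_\<Psi>)

sublocale orthonormal_family N J \<psi>
proof
  show "L2_fun N (\<psi> \<alpha>)" if "\<alpha> \<in> J" for \<alpha>
    using square_integrable_coord(1)[OF \<Psi>_square_integrable[OF that]] unfolding \<psi>_def .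
  show "(LINT x|N. cnj (\<psi> \<alpha> x) * \<psi> \<beta> x) = (if \<alpha> = \<beta> then 1 else 0)" if "\<alpha> \<in> J" "\<beta> \<in> J" for \<alpha> \<beta>
  proof -
    have "(LINT x|N. herm L x (\<Psi> \<alpha> x) (\<Psi> \<beta> x)) = (if \<alpha> = \<beta> then 1 else 0)"
      using onb that unfolding orthonormal_basis_def by blast
    then show ?thesis by (simp add: herm_coord \<Psi>_fibre that \<psi>_def)
  qed
  show "sq_summable J (\<lambda>\<alpha>. \<psi> \<alpha> x)" for x
  \<comment> \<open>An \<open>infsum\<close> that does not converge has the value 0, so positivity
    of the diagonal forces convergence.\<close>
  proof (rule ccontr)
    assume "\<not> sq_summable J (\<lambda>\<alpha>. \<psi> \<alpha> x)"
    then have "sq_sum J (\<lambda>\<alpha>. \<psi> \<alpha> x) = 0"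
      unfolding sq_sum_def sq_summable_def by (rule infsum_not_exists)
    then show False using diag_pos[of x] sq_sum_\<psi> by simp
  qed
qed

text \<open>Positivity of the diagonal excludes common zeros, so near every point some basis section
  can serve as a holomorphic frame.\<close>

lemma \<psi>_nonzero_ex: "\<exists>\<beta>\<in>J. \<psi> \<beta> x \<noteq> 0"
proof (rule ccontr)
  assume "\<not> (\<exists>\<beta>\<in>J. \<psi> \<beta> x \<noteq> 0)"
  then have "sq_sum J (\<lambda>\<alpha>. \<psi> \<alpha> x) = 0" unfolding sq_sum_def by (intro infsum_0) auto
  then show False using diag_pos[of x] sq_sum_\<psi> by simp
qed

text \<open>The function \<open>\<psi> \<beta>\<close> inherits the jumps of \<open>u\<close>; its
  modulus is the pointwise norm of a smooth section and does not depend on \<open>u\<close>.\<close>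

lemma isCont_cmod_\<psi>:
  assumes "\<beta> \<in> J"
  shows "isCont (\<lambda>y. cmod (\<psi> \<beta> y)) x"
proof -
  have "isCont (\<lambda>y. sqrt (Re (herm L y (\<Psi> \<beta> y) (\<Psi> \<beta> y)))) x"
    by (intro continuous_real_sqrt isCont_Re isCont_herm \<Psi>_smooth assms)
  then show ?thesis
    using norm_sq_\<Psi>[OF assms] unfolding norm_sq_def by simp
qed

lemma open_\<psi>_nonzero:
  assumes "\<beta> \<in> J"
  shows "open {y. \<psi> \<beta> y \<noteq> 0}"
proof -
  have "continuous_on UNIV (\<lambda>y. cmod (\<psi> \<beta> y))"
    using isCont_cmod_\<psi>[OF assms] by (simp add: continuous_at_imp_continuous_on)
  then have "open {y. cmod (\<psi> \<beta> y) \<noteq> 0}"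
    by (intro open_Collect_neq) auto
  then show ?thesis by simp
qed

definition combination :: "('i \<Rightarrow> complex) \<Rightarrow> 'm \<Rightarrow> 'e" where
  "combination a y = scl L (lincomb a y) (u y)"

lemma ratio_scl_u: "a2 \<noteq> 0 \<Longrightarrow> s y = scl L a1 (u y) \<Longrightarrow> t y = scl L a2 (u y) \<Longrightarrow> ratio L s t y = a1 / a2"
  unfolding ratio_def by (simp add: herm_coord scl_u_fibre)

text \<open>Near a point, a section \<open>\<Psi> \<beta>\<close> that does not vanish there is a holomorphic frame. Relative to it
  the partial sums are holomorphic functions, and by the Cauchy--Schwarz inequality they converge uniformly
  where the diagonal of the Bergman kernel is bounded.\<close>

lemma combination_holomorphic:
  assumes b: "continuous_on UNIV b" and a: "sq_summable J a"
  shows "smooth_section_near M L x (combination a)" "holomorphic_at M L (combination a) x"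
proof -
  obtain \<beta> where \<beta>: "\<beta> \<in> J" "\<psi> \<beta> x \<noteq> 0" using \<psi>_nonzero_ex by blast
  define W where "W = {y. \<psi> \<beta> y \<noteq> 0}"
  have W: "open W" "x \<in> W" unfolding W_def using open_\<psi>_nonzero[OF \<beta>(1)] \<beta>(2) by auto
  let ?g = "\<lambda>\<alpha>. ratio L (\<Psi> \<alpha>) (\<Psi> \<beta>)"
  let ?f = "ratio L (combination a) (\<Psi> \<beta>)"
  have g: "?g \<alpha> y = \<psi> \<alpha> y / \<psi> \<beta> y" if "\<alpha> \<in> J" "y \<in> W" for \<alpha> y
    using that \<beta>(1) by (intro ratio_scl_u \<Psi>_coord) (auto simp: W_def)
  have f: "?f y = lincomb a y / \<psi> \<beta> y" if "y \<in> W" for y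
    using that \<beta>(1) by (intro ratio_scl_u \<Psi>_coord) (auto simp: W_def combination_def)
  have \<Psi>\<beta>: "\<Psi> \<beta> y \<noteq> 0" if "y \<in> W" for y
    using that u_nonzero \<Psi>_coord[OF \<beta>(1), of y] by (auto simp: W_def)
  have comb: "scl L (?f y) (\<Psi> \<beta> y) = combination a y" if "y \<in> W" for y
    using that f[OF that] \<Psi>_coord[OF \<beta>(1), of y] by (simp add: W_def combination_def)
  have hol: "hol_on (snd c ` (fst c \<inter> W)) (?f \<circ> chart_inv c)" if c: "c \<in> charts M" for c
  proof (rule hol_on_uniform_limit)
    let ?S = "snd c ` (fst c \<inter> W)"
    fix p assume p: "p \<in> ?S"
    have S: "open ?S" by (rule open_chart_image[OF c W(1)])
    have inv: "chart_inv c q \<in> fst c \<inter> W" "snd c (chart_inv c q) = q" if "q \<in> ?S" for q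
      using that chart_inv_chart[OF c] by auto
    have holg: "hol_on ?S (?g \<alpha> \<circ> chart_inv c)" if \<alpha>: "\<alpha> \<in> J" for \<alpha>
    proof (rule hol_onI)
      fix q assume q: "q \<in> ?S"
      let ?y = "chart_inv c q"
      have y: "?y \<in> fst c" "?y \<in> W" "snd c ?y = q" using inv[OF q] by auto
      note \<Psi> = \<Psi>_smooth[OF \<alpha>] \<Psi>_holomorphic_at[OF \<alpha>] \<Psi>_smooth[OF \<beta>(1)] \<Psi>_holomorphic_at[OF \<beta>(1)]
      show "((?g \<alpha> \<circ> chart_inv c) has_derivative frechet_derivative (?g \<alpha> \<circ> chart_inv c) (at q)) (at q)"
        using smooth_near_has_derivative[OF smooth_near_ratio(1)[OF \<Psi>(1,3) \<Psi>\<beta>[OF y(2)]] c y(1)] y(3) by simp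
      show "frechet_derivative (?g \<alpha> \<circ> chart_inv c) (at q) (\<i> *s v)
          = \<i> * frechet_derivative (?g \<alpha> \<circ> chart_inv c) (at q) v" for v
        using cauchy_riemann_ratio[OF \<Psi> \<Psi>\<beta>[OF y(2)]] c y unfolding cauchy_riemann_at_def by metis
    qed
    \<comment> \<open>Relative to \<open>\<Psi> \<beta>\<close>, the error of a partial sum is at
      most this function times the norm of the tail. Continuity of \<open>b\<close> makes it locally
      bounded.\<close>
    let ?B = "\<lambda>y. sqrt (b y) / cmod (\<psi> \<beta> y)"
    have "continuous_on W (\<lambda>y. cmod (\<psi> \<beta> y))"
      using isCont_cmod_\<psi>[OF \<beta>(1)] by (simp add: continuous_at_imp_continuous_on)
    then have "continuous_on W ?B"
      using continuous_on_subset[OF b subset_UNIV[of W]] by (intro continuous_on_divide continuous_on_real_sqrt) (auto simp: W_def)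
    moreover have "continuous_on ?S (chart_inv c)"
      using homeomorphism_cont2[OF chart_homeomorphism[OF c]] by (rule continuous_on_subset) blast
    ultimately have contB: "continuous_on ?S (\<lambda>q. ?B (chart_inv c q))"
      by (rule continuous_on_compose2) (use inv in blast)
    then have "isCont (\<lambda>q. ?B (chart_inv c q)) p"
      using p continuous_on_eq_continuous_at[OF S] by blast
    then have "\<forall>\<^sub>F q in nhds p. ?B (chart_inv c q) < ?B (chart_inv c p) + 1"
      unfolding continuous_at tendsto_at_iff_tendsto_nhds[of "\<lambda>q. ?B (chart_inv c q)"]
      by (rule order_tendstoD(2)) simp
    moreover have "\<forall>\<^sub>F q in nhds p. q \<in> ?S" using S p by (rule eventually_nhds_in_open)
    ultimately have "\<forall>\<^sub>F q in nhds p. q \<in> ?S \<and> ?B (chart_inv c q) < ?B (chart_inv c p) + 1"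
      by eventually_elim blast
    then obtain r where r: "r > 0"
      "\<And>q. q \<in> ball p r \<Longrightarrow> q \<in> ?S \<and> ?B (chart_inv c q) < ?B (chart_inv c p) + 1"
      unfolding eventually_nhds_metric by (auto simp: dist_commute)
    let ?K = "?B (chart_inv c p) + 1"
    obtain F where F: "\<And>n. finite (F n)" "\<And>n. F n \<subseteq> J" "(\<lambda>n. sq_sum J (off (F n) a)) \<longlonglongrightarrow> 0"
      using sq_sum_tail_sequence[OF a] by blast
    let ?h = "\<lambda>n q. \<Sum>\<alpha>\<in>F n. a \<alpha> * (?g \<alpha> \<circ> chart_inv c) q"
    have H: "hol_on (ball p r) (?h n)" for n
      using F(2) r(2) by (intro hol_on_sum hol_on_cmult hol_on_subset[OF holg]) auto
    have lim: "uniform_limit (ball p r) ?h (?f \<circ> chart_inv c) sequentially"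
    proof (rule uniform_limitI)
      fix \<epsilon> :: real assume "\<epsilon> > 0"
      have est: "dist (?h n q) ((?f \<circ> chart_inv c) q) \<le> sqrt (sq_sum J (off (F n) a)) * ?K"
        if q: "q \<in> ball p r" for n q
      proof -
        let ?y = "chart_inv c q"
        have y: "?y \<in> W" "?B ?y < ?K" using r(2)[OF q] inv by auto
        have "(?f \<circ> chart_inv c) q - ?h n q = (lincomb a ?y - (\<Sum>\<alpha>\<in>F n. a \<alpha> * \<psi> \<alpha> ?y)) / \<psi> \<beta> ?y"
          using F(2)[of n] by (simp add: f[OF y(1)] g[OF _ y(1)] subset_eq diff_divide_distrib sum_divide_distrib)
        also have "\<dots> = lincomb (off (F n) a) ?y / \<psi> \<beta> ?y"
          by (simp add: lincomb_off[OF a F(1,2)])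
        finally have "dist (?h n q) ((?f \<circ> chart_inv c) q) = cmod (lincomb (off (F n) a) ?y) / cmod (\<psi> \<beta> ?y)"
          unfolding dist_norm norm_minus_commute[of "?h n q"] by (simp only: norm_divide)
        also have "\<dots> \<le> sqrt (sq_sum J (off (F n) a)) * sqrt (b ?y) / cmod (\<psi> \<beta> ?y)"
          using cmod_lincomb_le[OF sq_summable_off(1)[OF a F(1,2)]]
          by (intro divide_right_mono) (auto simp: sq_sum_\<psi>)
        also have "\<dots> = sqrt (sq_sum J (off (F n) a)) * ?B ?y" by simp
        also have "\<dots> \<le> sqrt (sq_sum J (off (F n) a)) * ?K"
          using y(2) sq_sum_nonneg by (intro mult_left_mono) auto
        finally show ?thesis .
      qed
      have "(\<lambda>n. sqrt (sq_sum J (off (F n) a)) * ?K) \<longlonglongrightarrow> sqrt 0 * ?K"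
        by (rule tendsto_mult_right[OF tendsto_real_sqrt[OF F(3)]])
      then have "\<forall>\<^sub>F n in sequentially. sqrt (sq_sum J (off (F n) a)) * ?K < \<epsilon>"
        using \<open>\<epsilon> > 0\<close> by (intro order_tendstoD(2)) auto
      then show "\<forall>\<^sub>F n in sequentially. \<forall>q\<in>ball p r. dist (?h n q) ((?f \<circ> chart_inv c) q) < \<epsilon>"
        by eventually_elim (use est in \<open>blast intro: le_less_trans\<close>)
    qed
    show "\<exists>r>0. \<exists>F. (\<forall>n. hol_on (ball p r) (F n)) \<and> uniform_limit (ball p r) F (?f \<circ> chart_inv c) sequentially"
      by (intro exI[of _ r] exI[of _ ?h] conjI allI r(1) H lim)
  qed
  have "smooth_fun (charts M) W ?f"
    unfolding smooth_fun_def by (rule ballI) (rule hol_on_imp_smooth_on[OF open_chart_image[OF _ W(1)] hol])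
  then have sm: "smooth_near (charts M) x ?f" unfolding smooth_near_def using W by blast
  have cr: "cauchy_riemann_at M ?f x"
    unfolding cauchy_riemann_at_def
  proof (intro ballI impI allI)
    fix c v assume c: "c \<in> charts M" "x \<in> fst c"
    show "frechet_derivative (?f \<circ> chart_inv c) (at (snd c x)) (\<i> *s v)
        = \<i> * frechet_derivative (?f \<circ> chart_inv c) (at (snd c x)) v"
      by (rule hol_on_frechet(2)[OF hol[OF c(1)]]) (use c W in blast)
  qed
  have S: "smooth_section_near M L x (\<lambda>y. scl L (?f y) (\<Psi> \<beta> y))"
    by (rule smooth_section_near_scl[OF sm \<Psi>_smooth[OF \<beta>(1)]])
  show "smooth_section_near M L x (combination a)"
    by (rule smooth_section_near_cong[OF S W comb])
  have "holomorphic_at M L (\<lambda>y. scl L (?f y) (\<Psi> \<beta> y)) x"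
    using holomorphic_at_scl_iff[OF \<Psi>_smooth[OF \<beta>(1)] \<Psi>_holomorphic_at[OF \<beta>(1)] \<Psi>\<beta>[OF W(2)] sm] cr by blast
  then show "holomorphic_at M L (combination a) x"
    using holomorphic_at_cong[OF S W comb] by blast
qed

end

section \<open>The propagator property\<close>

context bergman_setup
begin

lemma fibre_add: "l \<in> fibre L x \<Longrightarrow> m \<in> fibre L x \<Longrightarrow> l + m \<in> fibre L x"
  by (rule fib.subspace_add[OF fibre_subspace])

lemma coord_lincomb:
  assumes "l1 \<in> fibre L x" "l2 \<in> fibre L x"
  shows "coord x (scl L a1 l1 + scl L a2 l2) = a1 * coord x l1 + a2 * coord x l2"
  unfolding coord_def using assms by (simp add: herm_add_right herm_scl_right u_fibre scl_fibre)

lemma b_pos [simp]: "0 < b x" by (rule diag_pos)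

lemma b_nonzero [simp]: "b x \<noteq> 0" using b_pos[of x] by linarith

lemma b_nonneg [simp]: "0 \<le> b x" by (rule less_imp_le[OF b_pos])

lemma lincomb_cnj_\<psi>: "lincomb (\<lambda>\<alpha>. cnj (\<psi> \<alpha> x) * c) y = rkernel x y * c"
proof -
  have "lincomb (\<lambda>\<alpha>. cnj (\<psi> \<alpha> x) * c) y = (\<Sum>\<^sub>\<infinity>\<alpha>\<in>J. cnj (\<psi> \<alpha> x) * \<psi> \<alpha> y * c)"
    unfolding lincomb_def by (intro infsum_cong) (simp add: mult_ac)
  also have "\<dots> = rkernel x y * c"
    unfolding rkernel_def lincomb_def by (rule infsum_cmult_left')
  finally show ?thesis .
qed

lemma sq_summable_cnj_\<psi>: "sq_summable J (\<lambda>\<alpha>. cnj (\<psi> \<alpha> x) * c)"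
  by (rule sq_summable_mult_right(1)) (simp add: sq_summable_cnj \<psi>_sq_summable)

lemma rkernel_has_sum: "((\<lambda>\<alpha>. cnj (\<psi> \<alpha> x) * \<psi> \<alpha> y) has_sum rkernel x y) J"
  unfolding rkernel_def lincomb_def
  using summable_mult[OF sq_summable_cnj(1)[THEN iffD2, OF \<psi>_sq_summable] \<psi>_sq_summable]
  by (rule has_sum_infsum)

text \<open>Pairing with elements of the fibre reduces the series to the scalar one for
  \<open>rkernel\<close>; pairing with \<open>u y\<close> alone determines the limit, which is the
  uniqueness that \<open>THE\<close> requires.\<close>

lemma bergman_kernel_coord:
  assumes l: "l \<in> fibre L x"
  shows "bergman_kernel L J \<Psi> x y l = scl L (rkernel x y * coord x l) (u y)"
proof -
  have sum: "((\<lambda>\<alpha>. herm L x (\<Psi> \<alpha> x) l * herm L y m (\<Psi> \<alpha> y)) has_sum cnj (coord y m) * (rkernel x y * coord x l)) J"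
    if m: "m \<in> fibre L y" for m
  proof -
    have "((\<lambda>\<alpha>. cnj (\<psi> \<alpha> x) * \<psi> \<alpha> y * (cnj (coord y m) * coord x l)) has_sum
        rkernel x y * (cnj (coord y m) * coord x l)) J"
      by (rule has_sum_cmult_left[OF rkernel_has_sum])
    moreover have "cnj (\<psi> \<alpha> x) * \<psi> \<alpha> y * (cnj (coord y m) * coord x l) = herm L x (\<Psi> \<alpha> x) l * herm L y m (\<Psi> \<alpha> y)"
      if "\<alpha> \<in> J" for \<alpha>
      using that l m by (simp add: herm_coord \<Psi>_fibre \<psi>_def mult_ac)
    ultimately have "((\<lambda>\<alpha>. herm L x (\<Psi> \<alpha> x) l * herm L y m (\<Psi> \<alpha> y)) has_sum
        rkernel x y * (cnj (coord y m) * coord x l)) J"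
      by (simp cong: has_sum_cong)
    then show ?thesis by (simp add: mult_ac)
  qed
  show ?thesis
    unfolding bergman_kernel_def
  proof (rule the_equality, intro conjI ballI)
    show "scl L (rkernel x y * coord x l) (u y) \<in> fibre L y" by (rule scl_u_fibre)
    show "((\<lambda>\<alpha>. herm L x (\<Psi> \<alpha> x) l * herm L y m (\<Psi> \<alpha> y)) has_sum
        herm L y m (scl L (rkernel x y * coord x l) (u y))) J" if "m \<in> fibre L y" for m
      using sum[OF that] by (simp add: herm_scl_u that)
  next
    fix k assume k: "k \<in> fibre L y \<and> (\<forall>m\<in>fibre L y.
      ((\<lambda>\<alpha>. herm L x (\<Psi> \<alpha> x) l * herm L y m (\<Psi> \<alpha> y)) has_sum herm L y m k) J)"
    then have "herm L y (u y) k = cnj (coord y (u y)) * (rkernel x y * coord x l)"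
      using has_sum_unique sum[OF u_fibre] u_fibre by blast
    then have "coord y k = rkernel x y * coord x l"
      using u_unit by (simp add: coord_def)
    then show "k = scl L (rkernel x y * coord x l) (u y)"
      using scl_coord[of k y] k by simp
  qed
qed

abbreviation \<kappa> :: "'m \<Rightarrow> 'm \<Rightarrow> complex" where
  "\<kappa> x y \<equiv> rkernel x y / of_real (sqrt (b x) * sqrt (b y))"

lemma normalized_kernel_coord:
  "l \<in> fibre L x \<Longrightarrow> normalized_kernel L J \<Psi> x y l = scl L (\<kappa> x y * coord x l) (u y)"
  unfolding normalized_kernel_def by (simp add: bergman_kernel_coord)

lemma normalized_kernel_fibre: "l \<in> fibre L x \<Longrightarrow> normalized_kernel L J \<Psi> x y l \<in> fibre L y"
  by (simp add: normalized_kernel_coord scl_u_fibre)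

lemma rkernel_diag: "rkernel x x = of_real (b x)"
proof -
  have "((\<lambda>\<alpha>. complex_of_real ((cmod (\<psi> \<alpha> x))\<^sup>2)) has_sum complex_of_real (b x)) J"
  proof (rule has_sum_of_real)
    show "((\<lambda>\<alpha>. (cmod (\<psi> \<alpha> x))\<^sup>2) has_sum b x) J"
      using \<psi>_sq_summable[of x] sq_sum_\<psi>[of x] unfolding sq_summable_def sq_sum_def
      by (metis has_sum_infsum)
  qed
  moreover have "complex_of_real ((cmod (\<psi> \<alpha> x))\<^sup>2) = cnj (\<psi> \<alpha> x) * \<psi> \<alpha> x" for \<alpha>
    unfolding complex_norm_square by (rule mult.commute)
  ultimately show ?thesis using has_sum_unique[OF rkernel_has_sum] by simp
qed

lemma \<kappa>_diag: "\<kappa> x x = 1"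
  unfolding rkernel_diag by simp

lemma normalized_kernel_diag: "l \<in> fibre L x \<Longrightarrow> normalized_kernel L J \<Psi> x x l = l"
  unfolding normalized_kernel_coord \<kappa>_diag by (simp add: scl_coord)

lemma cmod_\<kappa>_le: "cmod (\<kappa> x y) \<le> 1"
proof -
  have "cmod (rkernel x y) \<le> sqrt (b x) * sqrt (b y)"
    using cmod_lincomb_le[of "\<lambda>\<alpha>. cnj (\<psi> \<alpha> x)" y] unfolding rkernel_def
    by (simp add: sq_summable_cnj sq_sum_\<psi> \<psi>_sq_summable)
  then show ?thesis by (simp add: norm_divide norm_mult divide_le_eq_1)
qed

lemma kernel_section_normalized: "kernel_section L (normalized_kernel L J \<Psi>)"
  unfolding kernel_section_def
  by (auto simp: normalized_kernel_coord normalized_kernel_fibre fibre_add scl_fibre coord_lincomb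
      scl_u_fibre distrib_left mult_ac add_divide_distrib fib.scale_left_distrib)

lemma normalized_kernel_adjoint:
  assumes "l \<in> fibre L x" "m \<in> fibre L y"
  shows "herm L y m (normalized_kernel L J \<Psi> x y l) = herm L x (normalized_kernel L J \<Psi> y x m) l"
  using assms by (simp add: normalized_kernel_coord herm_coord scl_u_fibre cnj_rkernel mult_ac)

text \<open>Undoing the normalisation turns \<open>l \<Omega>(x, y)\<close> into
  \<open>l B(x, y)\<close>, a series in the basis sections with square-summable coefficients, to
  which \<open>combination_holomorphic\<close> applies.\<close>

lemma normalized_kernel_combination:
  assumes "l \<in> fibre L x"
  shows "scl L (of_real (sqrt (b x) * sqrt (b y))) (normalized_kernel L J \<Psi> x y l)
    = combination (\<lambda>\<alpha>. cnj (\<psi> \<alpha> x) * coord x l) y"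
  unfolding combination_def lincomb_cnj_\<psi> by (simp add: normalized_kernel_coord assms)

text \<open>\<open>\<Omega>(x, y)\<close> is a contraction, so \<open>y \<mapsto> |l \<Omega>(x, y)|\<^sup>2\<close> has its maximum at \<open>y = x\<close>.\<close>

lemma parallel_at_diagonal:
  assumes b: "\<And>x. b x = b0" and l: "l \<in> fibre L x"
  shows "smooth_section_near M L x (\<lambda>y. normalized_kernel L J \<Psi> x y l)"
    and "v \<in> tangent_space (charts M) x \<Longrightarrow> conn L x v (\<lambda>y. normalized_kernel L J \<Psi> x y l) = 0"
proof -
  let ?s = "\<lambda>y. normalized_kernel L J \<Psi> x y l"
  \<comment> \<open>For constant \<open>b\<close> the two square roots multiply to
    \<open>b0\<close>, so the normalisation is absorbed into the coefficients and \<open>?s\<close>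
    itself is a combination.\<close>
  let ?a = "\<lambda>\<alpha>. cnj (\<psi> \<alpha> x) * (coord x l / of_real b0)"
  have b0: "b0 > 0" using b_pos b by metis
  have "complex_of_real (sqrt b0) * complex_of_real (sqrt b0) = complex_of_real b0"
    using b0 by (simp flip: of_real_mult)
  then have s: "?s = combination ?a"
    unfolding combination_def lincomb_cnj_\<psi> using b0 by (simp add: normalized_kernel_coord[OF l] b)
  have "continuous_on UNIV b" using b by simp
  note h = combination_holomorphic[OF this sq_summable_cnj_\<psi>[of x "coord x l / of_real b0"]]
  show sm: "smooth_section_near M L x ?s" unfolding s by (rule h(1))
  show "conn L x v ?s = 0" if v: "v \<in> tangent_space (charts M) x"
  proof (cases "l = 0")
    case True
    then have "coord x l = 0" unfolding coord_def using herm_scl_right[OF u_fibre u_fibre, of x 0] by simp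
    then have "?s = (\<lambda>_. 0)" by (simp add: normalized_kernel_coord[OF l])
    then show ?thesis using conn_zero(2)[OF v] by simp
  next
    case False
    show ?thesis
    proof (rule conn_zero_at_max[OF sm _ _ _ v])
      show "holomorphic_at M L ?s x" unfolding s by (rule h(2))
      show "?s x \<noteq> 0" using False by (simp add: normalized_kernel_diag l)
      show "Re (herm L y (?s y) (?s y)) \<le> Re (herm L x (?s x) (?s x))" for y
      proof -
        have "(cmod (\<kappa> x y * coord x l))\<^sup>2 \<le> (cmod (coord x l))\<^sup>2"
          using mult_right_mono[OF cmod_\<kappa>_le, of "cmod (coord x l)" x y]
          unfolding norm_mult[of "\<kappa> x y"] by (intro power_mono) simp_all
        moreover have "norm_sq L ?s y = (cmod (\<kappa> x y * coord x l))\<^sup>2"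
          by (subst norm_sq_coord) (simp_all add: scl_u_fibre l normalized_kernel_coord)
        moreover have "norm_sq L ?s x = (cmod (coord x l))\<^sup>2"
          by (subst norm_sq_coord) (simp_all add: l normalized_kernel_diag)
        ultimately show ?thesis unfolding norm_sq_def by simp
      qed
    qed
  qed
qed

section \<open>A constant diagonal yields a propagator\<close>

lemma scaled_integral:
  fixes f :: "'m \<Rightarrow> 'b::{banach, second_countable_topology}"
  assumes "0 < b0" "has_bochner_integral N f i"
  shows "has_bochner_integral (density N (\<lambda>_. ennreal b0)) f (b0 *\<^sub>R i)"
proof (rule has_bochner_integral_density)
  show "f \<in> borel_measurable N" using assms(2) by (rule borel_measurable_has_bochner_integral)
  show "has_bochner_integral N (\<lambda>x. b0 *\<^sub>R f x) (b0 *\<^sub>R i)"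
    by (rule has_bochner_integral_scaleR_right) (rule assms(2))
qed (use assms(1) in auto)

lemma scaled_square_integrable:
  assumes b0: "0 < b0" and s: "square_integrable L (density N (\<lambda>_. ennreal b0)) s"
  shows "square_integrable L N s"
    and "integral\<^sup>L (density N (\<lambda>_. ennreal b0)) (norm_sq L s) = b0 * integral\<^sup>L N (norm_sq L s)"
proof -
  have i: "integrable (density N (\<lambda>_. ennreal b0)) (norm_sq L s)" and m: "measurable_section L s"
    using s unfolding square_integrable_def by auto
  have meas: "norm_sq L s \<in> borel_measurable N"
    using borel_measurable_integrable[OF i] by simp
  have "integrable N (\<lambda>x. b0 *\<^sub>R norm_sq L s x)"
    using i b0 integrable_density[OF meas, of "\<lambda>_. b0"] by simp
  then show sq: "square_integrable L N s"
    unfolding square_integrable_def using m b0 by simp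
  show "integral\<^sup>L (density N (\<lambda>_. ennreal b0)) (norm_sq L s) = b0 * integral\<^sup>L N (norm_sq L s)"
    using integral_density[OF meas, of "\<lambda>_. b0"] b0 by simp
qed

text \<open>The kernel is \<open>rkernel / b0\<close> and the Bergman measure is \<open>b0\<close>
  times \<open>N\<close>. Composition collects two factors \<open>1 / b0\<close> from the kernels
  and one \<open>b0\<close> from the measure, which leaves the single \<open>1 / b0\<close> of the
  kernel itself.\<close>

lemma integrates_connection_if_constant:
  assumes b: "\<And>x. b x = b0"
  shows "integrates_connection M L (density N (\<lambda>_. ennreal b0)) (normalized_kernel L J \<Psi>)"
proof -
  let ?\<mu> = "density N (\<lambda>_. ennreal b0)"
  let ?K = "normalized_kernel L J \<Psi>"
  have b0: "b0 > 0" using b_pos b by metis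
  have sb: "complex_of_real (sqrt b0) * complex_of_real (sqrt b0) = complex_of_real b0"
    using b0 by (simp flip: of_real_mult)
  have K: "?K x y l = scl L (rkernel x y / of_real b0 * coord x l) (u y)" if "l \<in> fibre L x" for x y l
    using normalized_kernel_coord[OF that, of y] b0 by (simp add: b sb)
  have rep: "has_bochner_integral ?\<mu> (\<lambda>z. herm L y m (?K z y (?K x z l))) (herm L y m (?K x y l))"
    if l: "l \<in> fibre L x" and m: "m \<in> fibre L y" for x y l m
  proof -
    let ?c = "cnj (coord y m) * coord x l / (of_real b0 * of_real b0)"
    have "has_bochner_integral ?\<mu> (\<lambda>z. ?c * (rkernel z y * rkernel x z)) (b0 *\<^sub>R (?c * rkernel x y))"
      by (intro scaled_integral[OF b0] has_bochner_integral_mult_right rkernel_reproducing)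
    moreover have "herm L y m (?K z y (?K x z l)) = ?c * (rkernel z y * rkernel x z)" for z
      by (simp add: K l m scl_u_fibre herm_scl_u)
    moreover have "herm L y m (?K x y l) = b0 *\<^sub>R (?c * rkernel x y)"
      using b0 by (simp add: K l m herm_scl_u scaleR_conv_of_real)
    ultimately show ?thesis by simp
  qed
  have bounded: "bounded_kernel_form L ?\<mu> ?K"
    unfolding bounded_kernel_form_def
  \<comment> \<open>The constant is 1: the form is \<open>b0\<close> times the projection form over
    \<open>N\<close>, and each of the two norms over the Bergman measure contributes a factor
    \<open>sqrt b0\<close>.\<close>
  proof (intro exI[of _ 1] allI impI)
    fix s1 s2 assume s: "square_integrable L ?\<mu> s1" "square_integrable L ?\<mu> s2"
    let ?\<phi>1 = "\<lambda>x. coord x (s1 x)" and ?\<phi>2 = "\<lambda>x. coord x (s2 x)"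
    let ?I = "\<lambda>y x. cnj (?\<phi>1 y) * (rkernel x y * ?\<phi>2 x)"
    have f: "s1 x \<in> fibre L x" "s2 x \<in> fibre L x" for x
      using s unfolding square_integrable_def measurable_section_def by auto
    note sN = scaled_square_integrable[OF b0 s(1)] scaled_square_integrable[OF b0 s(2)]
    note form = rkernel_form_bounded[OF square_integrable_coord(1)[OF sN(1)] square_integrable_coord(1)[OF sN(3)]]
    have herm: "herm L y (s1 y) (?K x y (s2 x)) = ?I y x / of_real b0" for x y
      by (simp add: K f herm_scl_u mult_ac)
    have inner: "has_bochner_integral ?\<mu> (\<lambda>x. herm L y (s1 y) (?K x y (s2 x))) (LINT x|N. ?I y x)" for y
    proof -
      have "has_bochner_integral ?\<mu> (\<lambda>x. ?I y x / of_real b0) (b0 *\<^sub>R ((LINT x|N. ?I y x) / of_real b0))"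
        by (intro scaled_integral[OF b0] has_bochner_integral_divide_zero has_bochner_integral_integrable form(1))
      then show ?thesis unfolding herm using b0 by (simp add: scaleR_conv_of_real)
    qed
    have outer: "has_bochner_integral ?\<mu> (\<lambda>y. LINT x|?\<mu>. herm L y (s1 y) (?K x y (s2 x))) (b0 *\<^sub>R (LINT y|N. LINT x|N. ?I y x))"
      unfolding has_bochner_integral_integral_eq[OF inner]
      by (intro scaled_integral[OF b0] has_bochner_integral_integrable form(2))
    have l2: "l2_norm L ?\<mu> s1 = sqrt b0 * sqrt (L2_sq N ?\<phi>1)" "l2_norm L ?\<mu> s2 = sqrt b0 * sqrt (L2_sq N ?\<phi>2)"
      unfolding l2_norm_def sN(2,4) square_integrable_coord(2)[OF sN(1)] square_integrable_coord(2)[OF sN(3)]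
      by (simp_all add: real_sqrt_mult)
    have "cmod (b0 *\<^sub>R (LINT y|N. LINT x|N. ?I y x)) \<le> b0 * (sqrt (L2_sq N ?\<phi>1) * sqrt (L2_sq N ?\<phi>2))"
      using form(3) b0 by simp
    also have "\<dots> = (sqrt b0 * sqrt b0) * (sqrt (L2_sq N ?\<phi>1) * sqrt (L2_sq N ?\<phi>2))" using b0 by simp
    also have "\<dots> = 1 * l2_norm L ?\<mu> s1 * l2_norm L ?\<mu> s2" unfolding l2 by (simp only: mult_ac mult_1)
    finally show "(AE y in ?\<mu>. integrable ?\<mu> (\<lambda>x. herm L y (s1 y) (?K x y (s2 x)))) \<and>
        integrable ?\<mu> (\<lambda>y. LINT x|?\<mu>. herm L y (s1 y) (?K x y (s2 x))) \<and>
        cmod (LINT y|?\<mu>. LINT x|?\<mu>. herm L y (s1 y) (?K x y (s2 x))) \<le> 1 * l2_norm L ?\<mu> s1 * l2_norm L ?\<mu> s2"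
      using inner outer has_bochner_integral_integral_eq[OF outer]
      by (auto simp: has_bochner_integral_iff)
  qed
  show ?thesis
    unfolding integrates_connection_def
    using kernel_section_normalized rep parallel_at_diagonal[OF b] normalized_kernel_diag
      normalized_kernel_adjoint bounded by auto
qed

section \<open>A propagator has a constant diagonal\<close>

text \<open>Both \<open>|\<psi>\<^sub>\<alpha>(x)| / \<surd>b(x)\<close> and \<open>|\<psi>\<^sub>\<alpha>(y)| / \<surd>b(y)\<close> are unit vectors of the sequence space whose scalar
  product is at least \<open>|\<Omega>(x, y)|\<close>; one component of their difference is bounded by the norm of it.\<close>

lemma component_difference_le:
  assumes "\<beta> \<in> J"
  shows "(cmod (\<psi> \<beta> x) / sqrt (b x) - cmod (\<psi> \<beta> y) / sqrt (b y))\<^sup>2 \<le> 2 - 2 * cmod (\<kappa> x y)"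
proof -
  define f where "f \<alpha> x = cmod (\<psi> \<alpha> x) / sqrt (b x)" for \<alpha> x
  have one: "((\<lambda>\<alpha>. (f \<alpha> x)\<^sup>2) has_sum 1) J" for x
  proof -
    have "((\<lambda>\<alpha>. (cmod (\<psi> \<alpha> x))\<^sup>2) has_sum b x) J"
      using \<psi>_sq_summable[of x] sq_sum_\<psi>[of x] unfolding sq_summable_def sq_sum_def
      by (metis has_sum_infsum)
    from has_sum_cmult_left[OF this, of "1 / b x"] show ?thesis
      unfolding f_def by (simp add: power_divide)
  qed
  define p where "p = (\<Sum>\<^sub>\<infinity>\<alpha>\<in>J. cmod (cnj (\<psi> \<alpha> x) * \<psi> \<alpha> y))"
  have abs: "(\<lambda>\<alpha>. cmod (cnj (\<psi> \<alpha> x) * \<psi> \<alpha> y)) summable_on J"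
    by (rule abs_summable_mult) (simp_all add: sq_summable_cnj \<psi>_sq_summable)
  have "((\<lambda>\<alpha>. cmod (cnj (\<psi> \<alpha> x) * \<psi> \<alpha> y) * (1 / (sqrt (b x) * sqrt (b y)))) has_sum p * (1 / (sqrt (b x) * sqrt (b y)))) J"
    unfolding p_def by (rule has_sum_cmult_left[OF has_sum_infsum[OF abs]])
  then have prod: "((\<lambda>\<alpha>. f \<alpha> x * f \<alpha> y) has_sum p / (sqrt (b x) * sqrt (b y))) J"
    unfolding f_def by (simp add: norm_mult)
  have "((\<lambda>\<alpha>. (f \<alpha> x)\<^sup>2 + (f \<alpha> y)\<^sup>2 + - 2 * (f \<alpha> x * f \<alpha> y)) has_sum 1 + 1 + - 2 * (p / (sqrt (b x) * sqrt (b y)))) J"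
    by (intro has_sum_add has_sum_cmult_right one prod)
  then have sum: "((\<lambda>\<alpha>. (f \<alpha> x - f \<alpha> y)\<^sup>2) has_sum 2 - 2 * (p / (sqrt (b x) * sqrt (b y)))) J"
    by (simp add: power2_diff mult.assoc)
  have "(\<Sum>\<alpha>\<in>{\<beta>}. (f \<alpha> x - f \<alpha> y)\<^sup>2) \<le> 2 - 2 * (p / (sqrt (b x) * sqrt (b y)))"
    by (rule finite_sum_le_has_sum[OF sum]) (use assms in auto)
  moreover have "cmod (\<kappa> x y) \<le> p / (sqrt (b x) * sqrt (b y))"
  proof -
    have "cmod (rkernel x y) \<le> p"
      unfolding p_def rkernel_def lincomb_def by (rule norm_infsum_bound[OF abs])
    then show ?thesis by (simp add: norm_divide norm_mult divide_right_mono)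
  qed
  ultimately show ?thesis unfolding f_def by simp
qed

text \<open>The norm of \<open>?s y\<close> is \<open>cmod (\<kappa> x y)\<close>, which tends to 1
  as \<open>y\<close> tends to \<open>x\<close>. By \<open>component_difference_le\<close> the
  normalised component \<open>?r\<close> is then continuous at \<open>x\<close>, and
  \<open>b\<close> is recovered near \<open>x\<close> as the square of
  \<open>cmod (\<psi> \<beta> y) / ?r y\<close>.\<close>

lemma isCont_bergman_diag:
  assumes s: "smooth_section_near M L x (\<lambda>y. normalized_kernel L J \<Psi> x y (u x))"
  shows "isCont b x"
proof -
  let ?s = "\<lambda>y. normalized_kernel L J \<Psi> x y (u x)"
  obtain \<beta> where \<beta>: "\<beta> \<in> J" "\<psi> \<beta> x \<noteq> 0" using \<psi>_nonzero_ex by blast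
  let ?r = "\<lambda>y. cmod (\<psi> \<beta> y) / sqrt (b y)"
  have "sqrt (Re (herm L y (?s y) (?s y))) = cmod (\<kappa> x y)" for y
  proof -
    have "norm_sq L ?s y = (cmod (\<kappa> x y))\<^sup>2"
      using u_unit[of x] by (subst norm_sq_coord)
        (simp_all add: normalized_kernel_fibre u_fibre scl_u_fibre normalized_kernel_coord coord_def[of x "u x"])
    then show ?thesis unfolding norm_sq_def by (metis norm_ge_zero real_sqrt_unique)
  qed
  moreover have "isCont (\<lambda>y. sqrt (Re (herm L y (?s y) (?s y)))) x"
    by (intro continuous_real_sqrt isCont_Re isCont_herm s)
  ultimately have "isCont (\<lambda>y. cmod (\<kappa> x y)) x" by simp
  then have "(\<lambda>y. cmod (\<kappa> x y)) \<midarrow>x\<rightarrow> 1" unfolding isCont_def \<kappa>_diag by simp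
  then have "(\<lambda>y. sqrt (2 - 2 * cmod (\<kappa> x y))) \<midarrow>x\<rightarrow> sqrt (2 - 2 * 1)"
    by (intro tendsto_intros)
  then have lim: "(\<lambda>y. sqrt (2 - 2 * cmod (\<kappa> x y))) \<midarrow>x\<rightarrow> 0" by simp
  have "norm (?r y - ?r x) \<le> sqrt (2 - 2 * cmod (\<kappa> x y))" for y
    using real_sqrt_le_mono[OF component_difference_le[OF \<beta>(1), of x y]]
    by (simp add: abs_minus_commute)
  then have "(\<lambda>y. ?r y - ?r x) \<midarrow>x\<rightarrow> 0"
    by (intro Lim_null_comparison[OF _ lim] always_eventually) simp
  then have r: "isCont ?r x" unfolding isCont_def by (subst Lim_null) simp
  have rx: "?r x \<noteq> 0" using \<beta>(2) by simp
  have "isCont (\<lambda>y. (cmod (\<psi> \<beta> y) / ?r y)\<^sup>2) x"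
    by (intro continuous_power isCont_divide isCont_cmod_\<psi> \<beta>(1) r rx)
  moreover have "\<forall>\<^sub>F y in nhds x. (cmod (\<psi> \<beta> y) / ?r y)\<^sup>2 = b y"
  proof -
    have "\<forall>\<^sub>F y in nhds x. y \<in> {y. \<psi> \<beta> y \<noteq> 0}"
      using open_\<psi>_nonzero[OF \<beta>(1)] \<beta>(2) by (intro eventually_nhds_in_open) auto
    then show ?thesis by eventually_elim simp
  qed
  ultimately show ?thesis using isCont_cong by fast
qed

text \<open>The kernel is parallel only on the diagonal, so each point \<open>x\<close> needs its
  own section, the one with source \<open>x\<close>; it yields the vanishing of the derivative of
  \<open>sqrt b\<close> at that \<open>x\<close>.\<close>

lemma diag_constant_if_integrates:
  assumes "integrates_connection M L \<mu> (normalized_kernel L J \<Psi>)"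
  shows "\<exists>b0. \<forall>x. b x = b0"
proof -
  let ?K = "normalized_kernel L J \<Psi>"
  have sm: "smooth_section_near M L x (\<lambda>y. ?K x y (u x))"
    and par: "v \<in> tangent_space (charts M) x \<Longrightarrow> conn L x v (\<lambda>y. ?K x y (u x)) = 0" for x v
    using assms u_fibre unfolding integrates_connection_def by blast+
  have cont: "continuous_on UNIV b"
    using isCont_bergman_diag[OF sm] by (simp add: continuous_at_imp_continuous_on)
  have der: "((\<lambda>p. sqrt (b (chart_inv c p))) has_derivative (\<lambda>v. 0)) (at (snd c x))"
    if c: "c \<in> charts M" "x \<in> fst c" for c x
  proof -
    let ?s = "\<lambda>y. ?K x y (u x)"
    let ?R = "\<lambda>y. complex_of_real (sqrt (b x) * sqrt (b y))"
    let ?a = "\<lambda>\<alpha>. cnj (\<psi> \<alpha> x) * coord x (u x)"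
    have comb: "(\<lambda>y. scl L (?R y) (?s y)) = combination ?a"
      using normalized_kernel_combination[OF u_fibre] by blast
    note h = combination_holomorphic[OF cont sq_summable_cnj_\<psi>[of x "coord x (u x)"], of x]
    have sx: "?s x = u x" by (simp add: normalized_kernel_diag u_fibre)
    obtain W where W: "open W" "x \<in> W" "\<And>y. y \<in> W \<Longrightarrow> ?s y \<noteq> 0"
      using smooth_near_ratio(2)[OF h(1) sm] sx u_nonzero by metis
    have ratio_R: "ratio L (combination ?a) ?s y = ?R y" if "y \<in> W" for y
    proof -
      have f: "?s y \<in> fibre L y" by (rule normalized_kernel_fibre[OF u_fibre])
      have "combination ?a y = scl L (?R y) (?s y)"
        by (rule normalized_kernel_combination[OF u_fibre, symmetric])
      then show ?thesis
        unfolding ratio_def using herm_nonzero[OF f W(3)[OF that]] by (simp add: herm_scl_right[OF f f])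
    qed
    \<comment> \<open>Both sections are smooth near \<open>x\<close>: \<open>combination ?a\<close>
      because the series is holomorphic, \<open>?s\<close> by hypothesis. Their quotient is
      \<open>?R\<close>, which makes the square root of \<open>b\<close> smooth there.\<close>
    have "smooth_near (charts M) x (ratio L (combination ?a) ?s)"
      by (rule smooth_near_ratio(1)[OF h(1) sm]) (use sx u_nonzero in simp)
    then have R: "smooth_near (charts M) x ?R"
      by (rule smooth_near_cong[OF _ W(1,2) ratio_R])
    \<comment> \<open>Only the derivative of \<open>?R\<close> survives in the Leibniz rule, because
      \<open>?s\<close> is parallel at \<open>x\<close>.\<close>
    have conn: "conn L x v (combination ?a) = scl L (deriv_complex v ?R) (u x)"
      if v: "v \<in> tangent_space (charts M) x" for v
      using conn_scl[OF sm R v] par[OF v] unfolding comb sx by simp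
    note d = smooth_near_has_derivative[OF R c]
    let ?D = "frechet_derivative (?R \<circ> chart_inv c) (at (snd c x))"
    have Im: "Im (?D v) = 0" for v
    proof -
      have "((\<lambda>p. 0) has_derivative (\<lambda>v. Im (?D v))) (at (snd c x))"
        using has_derivative_Im[OF d] by (simp add: comp_def)
      then show ?thesis using has_derivative_unique[OF _ has_derivative_const[of "0::real"]] by metis
    qed
    \<comment> \<open>In \<open>?D v + \<i> * ?D (\<i> *s v) = 0\<close> both derivatives are real,
      so the real part of the equation is \<open>?D v\<close> alone.\<close>
    have Re: "Re (?D v) = 0" for v
    proof -
      have "conn L x (coord_vec (charts M) c x v) (combination ?a)
          + scl L \<i> (conn L x (coord_vec (charts M) c x (\<i> *s v)) (combination ?a)) = 0"
        using h(2) eigenspace_coord_vec[OF c, of v] unfolding holomorphic_at_def by auto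
      then have "scl L (?D v + \<i> * ?D (\<i> *s v)) (u x) = 0"
        unfolding conn[OF coord_vec_tangent[OF c]] deriv_complex_coord_vec[OF R c]
        by (simp add: fib.scale_left_distrib)
      then have "?D v + \<i> * ?D (\<i> *s v) = 0" using u_nonzero by simp
      then have "Re (?D v + \<i> * ?D (\<i> *s v)) = 0" by simp
      then show ?thesis using Im by simp
    qed
    have "((\<lambda>p. sqrt (b x) * sqrt (b (chart_inv c p))) has_derivative (\<lambda>v. 0)) (at (snd c x))"
      using has_derivative_Re[OF d] unfolding Re by (simp add: comp_def)
    from has_derivative_mult_right[OF this, of "1 / sqrt (b x)"]
    show ?thesis by simp
  qed
  \<comment> \<open>A vanishing derivative on a convex ball in a chart makes \<open>b\<close>
    locally constant; connectedness of the manifold does the rest.\<close>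
  have "b constant_on UNIV"
  proof (rule locally_constant_imp_constant)
    show "connected (UNIV :: 'm set)" using kaehler unfolding kaehler_manifold_def by blast
    fix x :: 'm
    obtain c where c: "c \<in> charts M" "x \<in> fst c" by (rule chart_ex)
    have "snd c x \<in> snd c ` fst c" using c(2) by blast
    then obtain r where r: "r > 0" "ball (snd c x) r \<subseteq> snd c ` fst c"
      using chart_image_open[OF c(1)] open_contains_ball by blast
    have z: "((\<lambda>p. sqrt (b (chart_inv c p))) has_derivative (\<lambda>v. 0)) (at p within ball (snd c x) r)"
      if p: "p \<in> ball (snd c x) r" for p
    proof -
      obtain y where y: "y \<in> fst c" "p = snd c y" using r(2) p by blast
      show ?thesis unfolding y(2) by (rule has_derivative_at_withinI[OF der[OF c(1) y(1)]])
    qed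
    let ?T = "fst c \<inter> snd c -` ball (snd c x) r"
    have "open ?T"
      by (rule continuous_open_preimage[OF homeomorphism_cont1[OF chart_homeomorphism[OF c(1)]] chart_open[OF c(1)] open_ball])
    moreover have "x \<in> ?T" using c(2) r(1) by simp
    moreover have "b y = b x" if y: "y \<in> ?T" for y
    proof -
      have "sqrt (b (chart_inv c (snd c y))) = sqrt (b (chart_inv c (snd c x)))"
        by (rule has_derivative_zero_unique[OF convex_ball z]) (use y r(1) in auto)
      then show ?thesis
        using y chart_inv_chart[OF c(1), of y] chart_inv_chart[OF c] by (simp only: IntD1 real_sqrt_eq_iff)
    qed
    ultimately show "\<exists>T. openin (top_of_set UNIV) T \<and> x \<in> T \<and> (\<forall>y\<in>T. b y = b x)"
      by (meson open_subset subset_UNIV)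
  qed
  then show ?thesis unfolding constant_on_def by simp
qed

end

theorem lemma5p1p1:
  fixes M :: "('m::{t2_space, second_countable_topology}, 'n::finite) kaehler_data"
    and L :: "('m, 'e::ab_group_add) line_bundle"
    and hbar :: real
    and V :: "'m measure"
    and J :: "'i set"
    and \<Psi> :: "'i \<Rightarrow> 'm \<Rightarrow> 'e"
  assumes "kaehler_manifold M"
    and "0 < hbar"
    and "prequantum_line_bundle M L hbar"
    and "volume_measure M V"
    and "orthonormal_basis M L (density V (\<lambda>x. ennreal (1 / hbar ^ CARD('n)))) J \<Psi>"
    and "\<forall>x. 0 < bergman_diag L J \<Psi> x"
  shows "integrates_connection M L
           (density V (\<lambda>x. ennreal (bergman_diag L J \<Psi> x / hbar ^ CARD('n))))
           (normalized_kernel L J \<Psi>)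
         \<longleftrightarrow> (\<exists>b. \<forall>x. bergman_diag L J \<Psi> x = b)"
proof -
  let ?N = "density V (\<lambda>x. ennreal (1 / hbar ^ CARD('n)))"
  interpret prequantum_bundle M L hbar
    using assms(1,3) by unfold_locales
  obtain u where u: "\<And>x. u x \<in> fibre L x" "\<And>x. herm L x (u x) (u x) = 1"
    "\<And>s. measurable_section L s \<Longrightarrow> (\<lambda>x. herm L x (u x) (s x)) \<in> borel_measurable borel"
    using measurable_unit_section by blast
  have "sets ?N = sets borel"
    using assms(4) unfolding volume_measure_def by simp
  then interpret bergman_setup M L hbar ?N J \<Psi> u
    using assms(5,6) u by unfold_locales auto
  show ?thesis
  proof
    assume "\<exists>b. \<forall>x. bergman_diag L J \<Psi> x = b"
    then obtain b0 where b0: "\<And>x. bergman_diag L J \<Psi> x = b0" by blast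
    have "0 < b0" using assms(6) b0 by metis
    \<comment> \<open>Splits the constant density so that the Bergman measure becomes
      \<open>b0\<close> times the measure of the inner product, the power of \<open>hbar\<close>
      staying with the latter.\<close>
    then have "ennreal (b0 / hbar ^ CARD('n)) = ennreal (1 / hbar ^ CARD('n)) * ennreal b0"
      using \<open>0 < hbar\<close> by (simp flip: ennreal_mult)
    then have "density V (\<lambda>x. ennreal (bergman_diag L J \<Psi> x / hbar ^ CARD('n))) = density ?N (\<lambda>_. ennreal b0)"
      by (simp add: b0 density_density_eq)
    then show "integrates_connection M L (density V (\<lambda>x. ennreal (bergman_diag L J \<Psi> x / hbar ^ CARD('n))))
        (normalized_kernel L J \<Psi>)"
      using integrates_connection_if_constant[OF b0] by simp
  qed (rule diag_constant_if_integrates)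
qed

end
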